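(* Fix constants $c,c'>0$. There is a randomized algorithm which, given an undirected weighted graph $G$ on $n$ vertices whose edge weights all lie in $[n^{-c},n^{c'}]$ and parameters $\delta,\gamma\in(0,1)$, outputs with probability at least $1-\gamma$ a $\delta$-multiplicative approximation of the smallest non-zero eigenvalue of the normalized Laplacian $L_G$, and uses $O(\frac1\delta\log n+\log\log(1/\gamma))$ space (the constant in the $O$ may depend on $c,c'$).
   Context: An undirected weighted graph $G=(V,E)$ on $n$ vertices (loops allowed) has a symmetric weight function $w:V\times V\to\mathbb R$ with $w(i,j)>0$ if $(i,j)\in E$ and $w(i,j)=0$ otherwise; $d_i=\sum_j w(i,j)$. The normalized Laplacian $L_G$ is the $n\times n$ symmetric matrix with $L_G[i,i]=1-w(i,i)/d_i$ if $d_i\ne0$, $L_G[i,j]=-w(i,j)/\sqrt{d_id_j}$ if $(i,j)\in E$, $i\neq j$, and $0$ otherwise. A real $a$ is a $\delta$-multiplicative approximation of a real $b$ if $|a-b|\le\delta|b|$. Computational model: space-bounded randomized algorithm with read-only input and random bits; arithmetic operations on $O(\log m)$-bit reals (absolute value between $m^{-C}$ and $m^{C'}$) are performed exactly in $O(\log m)$ space. *)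

theory Defs
  imports
    "HOL-Probability.Probability_Mass_Function"
    "HOL-Library.Log_Nat"
    "Jordan_Normal_Form.Char_Poly"
begin

section \<open>Weighted graphs and the normalized Laplacian\<close>

text \<open>The vertex set is \<open>{..<n}\<close>; edges are ordered pairs and loops are allowed.\<close>

definition weighted_graph :: "nat \<Rightarrow> (nat \<times> nat) set \<Rightarrow> (nat \<Rightarrow> nat \<Rightarrow> real) \<Rightarrow> bool" where
  "weighted_graph n E w \<longleftrightarrow>
     E \<subseteq> {..<n} \<times> {..<n} \<and> sym E \<and>
     (\<forall>i<n. \<forall>j<n. w i j = w j i) \<and>
     (\<forall>i<n. \<forall>j<n. if (i, j) \<in> E then w i j > 0 else w i j = 0)"

definition weighted_degree :: "nat \<Rightarrow> (nat \<Rightarrow> nat \<Rightarrow> real) \<Rightarrow> nat \<Rightarrow> real" where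
  "weighted_degree n w i = (\<Sum>j<n. w i j)"

definition normalized_laplacian ::
    "nat \<Rightarrow> (nat \<times> nat) set \<Rightarrow> (nat \<Rightarrow> nat \<Rightarrow> real) \<Rightarrow> real mat" where
  "normalized_laplacian n E w = Matrix.mat n n (\<lambda>(i, j).
     if i = j \<and> weighted_degree n w i \<noteq> 0 then 1 - w i i / weighted_degree n w i
     else if i \<noteq> j \<and> (i, j) \<in> E then - w i j / sqrt (weighted_degree n w i * weighted_degree n w j)
     else 0)"

definition smallest_nonzero_eigenvalue :: "real mat \<Rightarrow> real \<Rightarrow> bool" where
  "smallest_nonzero_eigenvalue A a \<longleftrightarrow>
     eigenvalue A a \<and> a \<noteq> 0 \<and> (\<forall>b. eigenvalue A b \<and> b \<noteq> 0 \<longrightarrow> a \<le> b)"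

definition mult_approx :: "real \<Rightarrow> real \<Rightarrow> real \<Rightarrow> bool" where
  "mult_approx \<delta> a b \<longleftrightarrow> \<bar>a - b\<bar> \<le> \<delta> * \<bar>b\<bar>"


section \<open>Space-bounded randomized algorithms\<close>

text \<open>
  An algorithm is a fixed program over finitely many integer registers, charged by the bit length
  of their contents. A real number with finitely many bits is handled as an integer scaled by a
  power of two, so that arithmetic on such numbers is exact and costs as much space as the numbers
  have bits. (Registers holding arbitrary reals at unit cost would not be a space-bounded model: a
  single real can encode an unbounded stack.)

  The input is read-only and not charged. Its real numbers are arbitrary, given by
  their infinite binary expansions: a read instruction fetches the digit of place value \<open>2 ^ k\<close>,
  where the (possibly negative) position \<open>k\<close> and the vertex indices are held in charged registers.
\<close>

record input =
  size_in :: nat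
  weight_in :: "nat \<Rightarrow> nat \<Rightarrow> real"
  delta_in :: real
  gamma_in :: real

type_synonym reg = nat
type_synonym state = "reg \<Rightarrow> int"

datatype arith = Add | Sub | Mul | Div

datatype prog =
    Skip
  | Const reg int
  | Arith arith reg reg reg        \<comment> \<open>target, left operand, right operand\<close>
  | ReadWeight reg reg reg reg     \<comment> \<open>target, row index, column index, digit position\<close>
  | ReadDelta reg reg              \<comment> \<open>target, digit position\<close>
  | ReadGamma reg reg              \<comment> \<open>target, digit position\<close>
  | Coin reg
  | Seq prog prog
  | IfPos reg prog prog
  | WhilePos reg prog

fun arith_val :: "arith \<Rightarrow> int \<Rightarrow> int \<Rightarrow> int" where
  "arith_val Add a b = a + b"
| "arith_val Sub a b = a - b"
| "arith_val Mul a b = a * b"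
| "arith_val Div a b = a div b"

definition digit :: "real \<Rightarrow> int \<Rightarrow> int" where
  "digit x k = \<lfloor>x * 2 powi (- k)\<rfloor> mod 2"

definition weight_digit :: "input \<Rightarrow> int \<Rightarrow> int \<Rightarrow> int \<Rightarrow> int" where
  "weight_digit I i j k =
     (if i \<in> {0..<int (size_in I)} \<and> j \<in> {0..<int (size_in I)}
      then digit (weight_in I (nat i) (nat j)) k else 0)"

text \<open>
  A configuration consists of the program that remains to be executed and the register contents.
  Only finitely many remaining programs can arise from a given program, so the first
  component is a finite control and is not charged. \<^const>\<open>Skip\<close> is the halted program.
\<close>

fun step :: "input \<Rightarrow> prog \<times> state \<Rightarrow> (prog \<times> state) pmf" where
  "step I (Skip, s) = return_pmf (Skip, s)"
| "step I (Const x a, s) = return_pmf (Skip, s(x := a))"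
| "step I (Arith f x y z, s) = return_pmf (Skip, s(x := arith_val f (s y) (s z)))"
| "step I (ReadWeight x i j k, s) = return_pmf (Skip, s(x := weight_digit I (s i) (s j) (s k)))"
| "step I (ReadDelta x k, s) = return_pmf (Skip, s(x := digit (delta_in I) (s k)))"
| "step I (ReadGamma x k, s) = return_pmf (Skip, s(x := digit (gamma_in I) (s k)))"
| "step I (Coin x, s) = map_pmf (\<lambda>b. (Skip, s(x := of_bool b))) (bernoulli_pmf (1 / 2))"
| "step I (Seq P Q, s) =
     (if P = Skip then return_pmf (Q, s)
      else map_pmf (\<lambda>(P', s'). (Seq P' Q, s')) (step I (P, s)))"
| "step I (IfPos x P Q, s) = return_pmf (if s x > 0 then P else Q, s)"
| "step I (WhilePos x P, s) = return_pmf (if s x > 0 then Seq P (WhilePos x P) else Skip, s)"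

definition init :: "input \<Rightarrow> state" where
  "init I = (\<lambda>_. 0)(0 := int (size_in I))"

fun run :: "prog \<Rightarrow> input \<Rightarrow> nat \<Rightarrow> (prog \<times> state) pmf" where
  "run P I 0 = return_pmf (P, init I)"
| "run P I (Suc t) = bind_pmf (run P I t) (step I)"

text \<open>
  The output is a rational number, given by numerator and denominator. Since the two registers are
  charged like all others, the output must itself fit into the space bound.
\<close>

definition result :: "state \<Rightarrow> real" where
  "result s = real_of_int (s 0) / real_of_int (s 1)"

fun regs :: "prog \<Rightarrow> reg set" where
  "regs Skip = {}"
| "regs (Const x a) = {x}"
| "regs (Arith f x y z) = {x, y, z}"
| "regs (ReadWeight x i j k) = {x, i, j, k}"
| "regs (ReadDelta x k) = {x, k}"
| "regs (ReadGamma x k) = {x, k}"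
| "regs (Coin x) = {x}"
| "regs (Seq P Q) = regs P \<union> regs Q"
| "regs (IfPos x P Q) = insert x (regs P \<union> regs Q)"
| "regs (WhilePos x P) = insert x (regs P)"

text \<open>One bit per register is charged for the sign.\<close>

definition space_used :: "prog \<Rightarrow> state \<Rightarrow> int" where
  "space_used P s = (\<Sum>x\<in>regs P. 1 + bitlen \<bar>s x\<bar>)"

definition uses_space :: "prog \<Rightarrow> input \<Rightarrow> real \<Rightarrow> bool" where
  "uses_space P I B \<longleftrightarrow> (\<forall>t. \<forall>(Q, s) \<in> set_pmf (run P I t). real_of_int (space_used P s) \<le> B)"

definition halts :: "prog \<Rightarrow> input \<Rightarrow> bool" where
  "halts P I \<longleftrightarrow> (\<exists>t. \<forall>(Q, s) \<in> set_pmf (run P I t). Q = Skip)"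

text \<open>
  Halted configurations do not change any more, so the probability below is nondecreasing in
  \<open>t\<close> and some \<open>t\<close> attains its limit whenever \<^const>\<open>halts\<close> holds.
\<close>

definition outputs_with_prob :: "prog \<Rightarrow> input \<Rightarrow> real set \<Rightarrow> real \<Rightarrow> bool" where
  "outputs_with_prob P I A p \<longleftrightarrow>
     (\<exists>t. measure_pmf.prob (run P I t) {(Q, s). Q = Skip \<and> result s \<in> A} \<ge> p)"

text \<open>
  \<open>ln (ln (1 / \<gamma>))\<close> is negative for \<open>\<gamma> > exp (-1)\<close> and unbounded below as \<open>\<gamma>\<close> tends to 1; there
  the term contributes nothing to the space bound.
\<close>

definition space_bound :: "nat \<Rightarrow> real \<Rightarrow> real \<Rightarrow> real" where
  "space_bound n \<delta> \<gamma> = 1 / \<delta> * ln (real n) + max 0 (ln (ln (1 / \<gamma>)))"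

end

theory Submission
  imports Defs "Jordan_Normal_Form.Schur_Decomposition"
begin

text \<open>
  Let \<open>P\<close> be the transition matrix of the random walk on the graph (isolated vertices stay put). Then
  \<open>1 - P\<close> is similar to \<open>L\<close>. A walk that at every tick ends a round with probability \<open>p\<close> and moves
  otherwise has, after \<open>m\<close> rounds, the distribution \<open>(1 + L / y) ^ (- m)\<close> with \<open>y = p / (1 - p)\<close>. Comparing
  whether it is back at its start before and after one further move estimates
  \<open>S y = tr (L (1 + L / y) ^ (- m)) = (\<Sum>l. l * (y / (y + l)) ^ m)\<close>, to which the zero eigenvalues do not
  contribute. Let \<open>\<mu>\<close> be the smallest non-zero eigenvalue. Since \<open>y / (y + \<mu>) = 1 / 2\<close> at \<open>y = \<mu>\<close> and \<open>\<mu>\<close>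
  is polynomially small at worst, \<open>S y\<close> lies far below \<open>2 ^ (- m)\<close> for \<open>y \<le> (1 - \<beta>) * \<mu>\<close> and far above for
  \<open>y \<ge> (1 + \<beta>) * \<mu>\<close> once \<open>m\<close> is a large multiple of \<open>ln n / \<delta>\<close> and \<open>\<beta>\<close> is of order \<open>\<delta>\<close>. So it suffices to
  count the \<open>p = j / 2 ^ m\<close> whose estimate is at most \<open>2 ^ (- m)\<close>.

  All parameters (ticks, trials, precision) are bounded by \<open>2 ^ O(m)\<close> times the number \<open>g\<close> of leading
  binary digits of \<open>\<gamma>\<close> up to its first 1, and Chernoff's bound makes the failure probability of each
  estimate at most \<open>\<gamma> / 2 ^ m\<close>. Moves are sampled by reservoir sampling: one pass over the vertices
  that replaces the current choice by \<open>u\<close> with probability \<open>w v u\<close> divided by the weight seen so far.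
\<close>

section \<open>Big-step semantics\<close>

text \<open>Powers of \<open>1 - L\<close> would not do: the spectrum of \<open>L\<close> lies in
  [0, 2], so 1 - l may be close to -1, and on bipartite graphs the top of the spectrum would mask
  \<mu>. A geometric number of moves per round replaces the power by a resolvent, whose factor y /
  (y + l) is positive and decreasing on the whole spectrum: all terms of \<open>S y\<close> are
  nonnegative, and \<mu> has the largest factor among the non-zero eigenvalues. Summing over all
  start vertices gives a trace, so no overlap of a start vector with an eigenvector has to be
  bounded from below. A relative change of y by \<beta> changes the factor by a relative amount of
  order \<beta>, which the m-th power must amplify beyond polynomial slack (n, the prefactor l, the
  lower bound on \<mu>); this forces m of order ln n / \<delta>. Tests inside the window around
  \<mu> may come out either way, since only their number enters the output. Long running times are
  cheap: counters up to 2 ^ O(m) take O(m) bits, and the factor g in the number of trials costs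
  about log g bits, of order ln ln (1 / \<gamma>).\<close>

definition bounded_regs :: "int \<Rightarrow> state \<Rightarrow> bool" where
  "bounded_regs b s \<longleftrightarrow> (\<forall>x. \<bar>s x\<bar> \<le> b)"

lemma bounded_regs_upd: "bounded_regs b s \<Longrightarrow> \<bar>v\<bar> \<le> b \<Longrightarrow> bounded_regs b (s(x := v))"
  by (auto simp: bounded_regs_def)

text \<open>
  \<open>bigstep I b (P, s) \<mu>\<close>: every execution from \<open>(P, s)\<close> halts, all register contents on the way
  are bounded by \<open>b\<close>, and \<open>\<mu>\<close> is the distribution of the final state. The recursion tree is
  well-founded and finitely branching, which yields a uniform time bound.
\<close>

inductive bigstep :: "input \<Rightarrow> int \<Rightarrow> prog \<times> state \<Rightarrow> state pmf \<Rightarrow> bool" for I b where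
  halt: "bounded_regs b s \<Longrightarrow> bigstep I b (Skip, s) (return_pmf s)"
| step: "P \<noteq> Skip \<Longrightarrow> bounded_regs b s \<Longrightarrow>
    (\<And>c. c \<in> set_pmf (step I (P, s)) \<Longrightarrow> bigstep I b c (\<nu> c)) \<Longrightarrow>
    bigstep I b (P, s) (bind_pmf (step I (P, s)) \<nu>)"

fun run_from :: "input \<Rightarrow> prog \<times> state \<Rightarrow> nat \<Rightarrow> (prog \<times> state) pmf" where
  "run_from I c 0 = return_pmf c"
| "run_from I c (Suc t) = bind_pmf (step I c) (\<lambda>c'. run_from I c' t)"

lemma run_from_Suc_right: "run_from I c (Suc t) = bind_pmf (run_from I c t) (step I)"
proof (induction t arbitrary: c)
  case 0
  then show ?case by (simp add: bind_return_pmf bind_return_pmf')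
next
  case (Suc t)
  have "run_from I c (Suc (Suc t)) = bind_pmf (step I c) (\<lambda>c'. run_from I c' (Suc t))"
    by simp
  also have "\<dots> = bind_pmf (step I c) (\<lambda>c'. bind_pmf (run_from I c' t) (step I))"
    using Suc by presburger
  also have "\<dots> = bind_pmf (run_from I c (Suc t)) (step I)"
    by (simp add: bind_assoc_pmf)
  finally show ?case .
qed

lemma run_eq_run_from: "run P I t = run_from I (P, init I) t"
  by (induction t) (simp_all add: run_from_Suc_right del: run_from.simps(2))

lemma finite_set_pmf_step: "finite (set_pmf (step I (P, s)))"
  by (induction P arbitrary: s) auto

lemma run_from_Skip: "run_from I (Skip, s) t = return_pmf (Skip, s)"
  by (induction t) (simp_all add: bind_return_pmf)

lemma run_from_halted_mono:
  assumes "run_from I c t = map_pmf (Pair Skip) \<mu>" "t \<le> t'"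
  shows "run_from I c t' = map_pmf (Pair Skip) \<mu>"
  using assms(2)
proof (induction t' rule: dec_induct)
  case base
  then show ?case using assms(1) by simp
next
  case (step u)
  then show ?case
    by (simp add: run_from_Suc_right map_pmf_def bind_assoc_pmf bind_return_pmf del: run_from.simps(2))
qed

lemma bigstep_run_from:
  assumes "bigstep I b c \<mu>"
  shows "(\<exists>t. run_from I c t = map_pmf (Pair Skip) \<mu>) \<and>
    (\<forall>t. \<forall>(Q, s) \<in> set_pmf (run_from I c t). bounded_regs b s)"
  using assms
proof induction
  case (halt s)
  then show ?case by (auto simp: run_from_Skip intro!: exI[of _ 0])
next
  case (step P s \<nu>)
  let ?S = "set_pmf (step I (P, s))"
  from step have "\<forall>c\<in>?S. \<exists>t. run_from I c t = map_pmf (Pair Skip) (\<nu> c)" by blast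
  then obtain f where f: "\<And>c. c \<in> ?S \<Longrightarrow> run_from I c (f c) = map_pmf (Pair Skip) (\<nu> c)"
    by metis
  define T where "T = Max (f ` ?S)"
  have T: "f c \<le> T" if "c \<in> ?S" for c
    unfolding T_def using that finite_set_pmf_step by (intro Max_ge) auto
  have "run_from I (P, s) (Suc T) = bind_pmf (step I (P, s)) (\<lambda>c. map_pmf (Pair Skip) (\<nu> c))"
    by (simp, rule bind_pmf_cong) (auto intro!: run_from_halted_mono[OF f T])
  also have "\<dots> = map_pmf (Pair Skip) (bind_pmf (step I (P, s)) \<nu>)"
    by (simp add: map_bind_pmf)
  finally have 1: "\<exists>t. run_from I (P, s) t = map_pmf (Pair Skip) (bind_pmf (step I (P, s)) \<nu>)" ..
  have 2: "\<forall>(Q, s') \<in> set_pmf (run_from I (P, s) t). bounded_regs b s'" for t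
  proof (cases t)
    case 0
    then show ?thesis using step by simp
  next
    case (Suc u)
    have "bounded_regs b s'" if "c \<in> ?S" "(Q, s') \<in> set_pmf (run_from I c u)" for c Q s'
      using step.IH[OF that(1)] that(2) by blast
    then show ?thesis by (auto simp: Suc simp del: step.simps)
  qed
  show ?case using 1 2 by blast
qed

lemma bigstep_det_step:
  assumes "P \<noteq> Skip" "bounded_regs b s" "step I (P, s) = return_pmf c" "bigstep I b c \<mu>"
  shows "bigstep I b (P, s) \<mu>"
  using bigstep.step[OF assms(1,2), of I "\<lambda>_. \<mu>"] assms(3,4) by (simp add: bind_return_pmf)

lemma bigstep_Seq:
  assumes "bigstep I b c \<mu>" "\<And>s. s \<in> set_pmf \<mu> \<Longrightarrow> bigstep I b (Q, s) (\<nu> s)"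
  shows "bigstep I b (Seq (fst c) Q, snd c) (bind_pmf \<mu> \<nu>)"
  using assms
proof induction
  case (halt s)
  then show ?case
    by (auto intro!: bigstep_det_step simp: bind_return_pmf)
next
  case (step P s \<kappa>)
  let ?f = "\<lambda>(P', s'). (Seq P' Q, s')"
  have inj: "inj ?f" by (auto simp: inj_def)
  have st: "step I (Seq P Q, s) = map_pmf ?f (step I (P, s))"
    using step.hyps by simp
  \<comment> \<open>The continuation must be a function of the configuration reached, here of the
    form \<open>Seq P' Q\<close>; since \<open>?f\<close> is injective, \<open>\<rho>\<close> can
    decode the configuration of the first program and look up its \<open>\<kappa>\<close>.\<close>
  define \<rho> where "\<rho> d = bind_pmf (\<kappa> (inv_into UNIV ?f d)) \<nu>" for d
  have \<rho>: "\<rho> (?f d) = bind_pmf (\<kappa> d) \<nu>" for d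
    unfolding \<rho>_def by (subst inv_f_f[OF inj]) (rule refl)
  have "bigstep I b (Seq P Q, s) (bind_pmf (step I (Seq P Q, s)) \<rho>)"
  proof (rule bigstep.step)
    fix c assume "c \<in> set_pmf (step I (Seq P Q, s))"
    then obtain d where d: "d \<in> set_pmf (step I (P, s))" "c = ?f d"
      unfolding st by auto
    have "bigstep I b (Seq (fst d) Q, snd d) (bind_pmf (\<kappa> d) \<nu>)"
      using d(1) step.prems by (intro step.IH) (auto simp del: step.simps)
    then show "bigstep I b c (\<rho> c)"
      unfolding d(2) \<rho> by (simp add: case_prod_beta)
  qed (use step.hyps in auto)
  also have "bind_pmf (step I (Seq P Q, s)) \<rho> = bind_pmf (bind_pmf (step I (P, s)) \<kappa>) \<nu>"
    unfolding st by (simp add: bind_map_pmf \<rho> bind_assoc_pmf del: step.simps)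
  finally show ?case by simp
qed

text \<open>Two halting times can be raised to their maximum, where both distributions describe the
  same run.\<close>

lemma bigstep_unique:
  assumes "bigstep I b c \<mu>" "bigstep I b c \<nu>"
  shows "\<mu> = \<nu>"
proof -
  obtain t u where "run_from I c t = map_pmf (Pair Skip) \<mu>" "run_from I c u = map_pmf (Pair Skip) \<nu>"
    using bigstep_run_from[OF assms(1)] bigstep_run_from[OF assms(2)] by blast
  then have "run_from I c (max t u) = map_pmf (Pair Skip) \<mu>"
    "run_from I c (max t u) = map_pmf (Pair Skip) \<nu>"
    using run_from_halted_mono by (metis max.cobounded1, metis max.cobounded2)
  then have "map_pmf snd (map_pmf (Pair Skip) \<mu>) = map_pmf snd (map_pmf (Pair Skip) \<nu>)" by simp
  then show ?thesis by (simp add: pmf.map_comp comp_def)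
qed

text \<open>Continuations are specified in terms of an abstract value \<open>a\<close>, but
  derivations assign them to states, and \<open>g\<close> may send several values to one state. By
  uniqueness of the final distribution \<open>\<nu> a\<close> depends on \<open>g a\<close> only, so
  any representative will do.\<close>

lemma bigstep_bind_representative:
  assumes "\<And>a. a \<in> set_pmf p \<Longrightarrow> bigstep I b (Q, g a) (\<nu> a)"
  obtains \<kappa> where "\<And>s. s \<in> set_pmf (map_pmf g p) \<Longrightarrow> bigstep I b (Q, s) (\<kappa> s)"
    "bind_pmf p \<nu> = bind_pmf (map_pmf g p) \<kappa>"
proof
  define r where "r s = (SOME a. a \<in> set_pmf p \<and> g a = s)" for s
  have r: "r s \<in> set_pmf p \<and> g (r s) = s" if "s \<in> set_pmf (map_pmf g p)" for s
    unfolding r_def by (rule someI_ex) (use that in auto)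
  show Q: "bigstep I b (Q, s) (\<nu> (r s))" if "s \<in> set_pmf (map_pmf g p)" for s
    using assms[of "r s"] r[OF that] by simp
  have "\<nu> a = \<nu> (r (g a))" if "a \<in> set_pmf p" for a
    using Q[of "g a"] assms[OF that] that by (intro bigstep_unique) auto
  then show "bind_pmf p \<nu> = bind_pmf (map_pmf g p) (\<lambda>s. \<nu> (r s))"
    unfolding bind_map_pmf by (intro bind_pmf_cong) auto
qed

section \<open>Rules for straight-line programs and counted loops\<close>

fun block :: "prog list \<Rightarrow> prog" where
  "block [] = Skip"
| "block (P # Ps) = Seq P (block Ps)"

lemma bigstep_block_Nil: "bounded_regs b s \<Longrightarrow> \<mu> = return_pmf s \<Longrightarrow> bigstep I b (block [], s) \<mu>"
  by (auto intro: bigstep.halt)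

lemma bigstep_block_Cons:
  assumes "bigstep I b (P, s) (map_pmf g p)"
    "\<And>a. a \<in> set_pmf p \<Longrightarrow> bigstep I b (block Ps, g a) (\<nu> a)"
  shows "bigstep I b (block (P # Ps), s) (bind_pmf p \<nu>)"
proof -
  obtain \<kappa> where "\<And>s. s \<in> set_pmf (map_pmf g p) \<Longrightarrow> bigstep I b (block Ps, s) (\<kappa> s)"
    "bind_pmf p \<nu> = bind_pmf (map_pmf g p) \<kappa>"
    using bigstep_bind_representative[where p=p and g=g and \<nu>=\<nu>, OF assms(2)] by blast
  then show ?thesis using bigstep_Seq[OF assms(1)] by simp
qed

lemma bigstep_block_Cons_det:
  assumes "bigstep I b (P, s) (return_pmf s')" "bigstep I b (block Ps, s') \<mu>"
  shows "bigstep I b (block (P # Ps), s) \<mu>"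
  using bigstep_Seq[OF assms(1), of "block Ps" "\<lambda>_. \<mu>"] assms(2) by (simp add: bind_return_pmf)

lemma bigstep_Const:
  "bounded_regs b s \<Longrightarrow> \<bar>a\<bar> \<le> b \<Longrightarrow> bigstep I b (Const x a, s) (return_pmf (s(x := a)))"
  by (rule bigstep_det_step) (auto intro!: bigstep.halt bounded_regs_upd)

lemma bigstep_Arith:
  "bounded_regs b s \<Longrightarrow> \<bar>arith_val f (s y) (s z)\<bar> \<le> b \<Longrightarrow>
   bigstep I b (Arith f x y z, s) (return_pmf (s(x := arith_val f (s y) (s z))))"
  by (rule bigstep_det_step) (auto intro!: bigstep.halt bounded_regs_upd)

lemma digit_bounds: "0 \<le> digit x k" "digit x k \<le> 1"
  by (auto simp: digit_def)

lemma bigstep_ReadWeight: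
  "bounded_regs b s \<Longrightarrow> 1 \<le> b \<Longrightarrow> bigstep I b (ReadWeight x i j k, s)
     (return_pmf (s(x := weight_digit I (s i) (s j) (s k))))"
  by (rule bigstep_det_step)
     (auto intro!: bigstep.halt bounded_regs_upd order_trans[OF digit_bounds(2)]
       simp: weight_digit_def digit_bounds abs_of_nonneg)

lemma bigstep_ReadDelta:
  "bounded_regs b s \<Longrightarrow> 1 \<le> b \<Longrightarrow> bigstep I b (ReadDelta x k, s)
     (return_pmf (s(x := digit (delta_in I) (s k))))"
  by (rule bigstep_det_step)
     (auto intro!: bigstep.halt bounded_regs_upd
       intro: order_trans[OF digit_bounds(2)] simp: digit_bounds abs_of_nonneg)

lemma bigstep_ReadGamma:
  "bounded_regs b s \<Longrightarrow> 1 \<le> b \<Longrightarrow> bigstep I b (ReadGamma x k, s)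
     (return_pmf (s(x := digit (gamma_in I) (s k))))"
  by (rule bigstep_det_step)
     (auto intro!: bigstep.halt bounded_regs_upd
       intro: order_trans[OF digit_bounds(2)] simp: digit_bounds abs_of_nonneg)

lemma bigstep_Coin:
  assumes "bounded_regs b s" "1 \<le> b"
  shows "bigstep I b (Coin x, s) (map_pmf (\<lambda>u. s(x := of_bool u)) (bernoulli_pmf (1 / 2)))"
proof -
  have "bigstep I b (Coin x, s) (bind_pmf (step I (Coin x, s)) (\<lambda>c. return_pmf (snd c)))"
    using assms by (intro bigstep.step) (auto intro!: bigstep.halt bounded_regs_upd)
  then show ?thesis by (simp add: map_pmf_def bind_assoc_pmf bind_return_pmf)
qed

lemma bigstep_IfPos:
  "bounded_regs b s \<Longrightarrow> bigstep I b (if s x > 0 then P else Q, s) \<mu> \<Longrightarrow>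
   bigstep I b (IfPos x P Q, s) \<mu>"
  by (rule bigstep_det_step) auto

lemma bigstep_Skip: "bounded_regs b s \<Longrightarrow> bigstep I b (Skip, s) (return_pmf s)"
  by (rule bigstep.halt)

lemma bigstep_While_stop:
  "bounded_regs b s \<Longrightarrow> s x \<le> 0 \<Longrightarrow> bigstep I b (WhilePos x P, s) (return_pmf s)"
  by (rule bigstep_det_step) (auto intro: bigstep.halt)

lemma bigstep_While_continue:
  assumes "bounded_regs b s" "s x > 0" "bigstep I b (P, s) (map_pmf g p)"
    "\<And>a. a \<in> set_pmf p \<Longrightarrow> bigstep I b (WhilePos x P, g a) (\<nu> a)"
  shows "bigstep I b (WhilePos x P, s) (bind_pmf p \<nu>)"
proof -
  obtain \<kappa> where \<kappa>: "\<And>s. s \<in> set_pmf (map_pmf g p) \<Longrightarrow> bigstep I b (WhilePos x P, s) (\<kappa> s)"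
    "bind_pmf p \<nu> = bind_pmf (map_pmf g p) \<kappa>"
    using bigstep_bind_representative[where p=p and g=g and \<nu>=\<nu>, OF assms(4)] by blast
  show ?thesis
  proof (rule bigstep_det_step)
    show "step I (WhilePos x P, s) = return_pmf (Seq P (WhilePos x P), s)"
      using assms(2) by simp
  qed (use assms(1) bigstep_Seq[OF assms(3) \<kappa>(1)] \<kappa>(2) in auto)
qed

text \<open>The index handed to \<open>f\<close> is the number of iterations still to come after the
  present one, in agreement with a loop whose counter register runs down to 0.\<close>

fun iter :: "(nat \<Rightarrow> 'a \<Rightarrow> 'a pmf) \<Rightarrow> nat \<Rightarrow> 'a \<Rightarrow> 'a pmf" where
  "iter f 0 a = return_pmf a"
| "iter f (Suc k) a = bind_pmf (f k a) (iter f k)"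

lemma iter_invariant:
  assumes "\<And>k a a'. V (Suc k) a \<Longrightarrow> a' \<in> set_pmf (f k a) \<Longrightarrow> V k a'"
    and "V k a" and "a' \<in> set_pmf (iter f k a)"
  shows "V 0 a'"
  using assms(2,3)
  by (induction k arbitrary: a) (use assms(1) in \<open>auto\<close>)

lemma finite_set_pmf_iter:
  "(\<And>k a. finite (set_pmf (f k a))) \<Longrightarrow> finite (set_pmf (iter f k a))"
  by (induction k arbitrary: a) auto

text \<open>\<open>S k a\<close> is the state that encodes the counter \<open>k\<close> and the
  abstract value \<open>a\<close>; the body only has to be matched with \<open>f\<close> on encoded
  states. \<open>V\<close> may depend on the counter, as bounds on accumulators require.\<close>

lemma bigstep_for:
  assumes body: "\<And>k a. V (Suc k) a \<Longrightarrow> Suc k \<le> k0 \<Longrightarrow>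
      bigstep I b (P, S (Suc k) a) (map_pmf (S k) (f k a))"
    and inv: "\<And>k a a'. V (Suc k) a \<Longrightarrow> Suc k \<le> k0 \<Longrightarrow> a' \<in> set_pmf (f k a) \<Longrightarrow> V k a'"
    and bnd: "\<And>k a. V k a \<Longrightarrow> k \<le> k0 \<Longrightarrow> bounded_regs b (S k a)"
    and cnt: "\<And>k a. V k a \<Longrightarrow> k \<le> k0 \<Longrightarrow> S k a x = int k"
    and V: "V k a" "k \<le> k0"
  shows "bigstep I b (WhilePos x P, S k a) (map_pmf (S 0) (iter f k a))"
  using V
proof (induction k arbitrary: a)
  case 0
  then show ?case using bnd[of 0 a] cnt[of 0 a] by (auto intro: bigstep_While_stop)
next
  case (Suc k)
  have "bigstep I b (WhilePos x P, S (Suc k) a) (bind_pmf (f k a) (\<lambda>a'. map_pmf (S 0) (iter f k a')))"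
  proof (rule bigstep_While_continue[OF _ _ body])
    fix a' assume "a' \<in> set_pmf (f k a)"
    then show "bigstep I b (WhilePos x P, S k a') (map_pmf (S 0) (iter f k a'))"
      using Suc.prems inv by (intro Suc.IH) auto
  qed (use Suc.prems bnd cnt in auto)
  then show ?case by (simp add: map_bind_pmf)
qed

declare block.simps [simp del]

lemma bigstep_final_bounded: "bigstep I b c \<mu> \<Longrightarrow> s \<in> set_pmf \<mu> \<Longrightarrow> bounded_regs b s"
  by (induction rule: bigstep.induct) auto

lemma block_Nil:
  "bounded_regs b s \<Longrightarrow> (\<And>x. s x = s' x) \<Longrightarrow> bigstep I b (block [], s) (return_pmf s')"
  by (rule bigstep_block_Nil) (auto simp: fun_eq_iff)

lemma block_det:
  assumes "bigstep I b (P, s) (return_pmf s')"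
    "bounded_regs b s' \<Longrightarrow> bigstep I b (block Ps, s') \<mu>"
  shows "bigstep I b (block (P # Ps), s) \<mu>"
  using assms bigstep_final_bounded[OF assms(1)] by (intro bigstep_block_Cons_det[OF assms(1)]) auto

lemma block_Const:
  "bounded_regs b s \<Longrightarrow> \<bar>a\<bar> \<le> b \<Longrightarrow> (bounded_regs b (s(x := a)) \<Longrightarrow> bigstep I b (block Ps, s(x := a)) \<mu>) \<Longrightarrow>
   bigstep I b (block (Const x a # Ps), s) \<mu>"
  by (rule block_det[OF bigstep_Const])

lemma block_Arith:
  "bounded_regs b s \<Longrightarrow> v = arith_val f (s y) (s z) \<Longrightarrow> \<bar>v\<bar> \<le> b \<Longrightarrow>
   (bounded_regs b (s(x := v)) \<Longrightarrow> bigstep I b (block Ps, s(x := v)) \<mu>) \<Longrightarrow>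
   bigstep I b (block (Arith f x y z # Ps), s) \<mu>"
  using block_det[OF bigstep_Arith] by metis

lemma block_map:
  assumes "bigstep I b (P, s) (map_pmf g p)"
    "\<And>a. a \<in> set_pmf p \<Longrightarrow> bounded_regs b (g a) \<Longrightarrow> bigstep I b (block Ps, g a) (map_pmf (h a) (q a))"
  shows "bigstep I b (block (P # Ps), s) (bind_pmf p (\<lambda>a. map_pmf (h a) (q a)))"
  by (rule bigstep_block_Cons[OF assms(1)])
     (use assms(2) bigstep_final_bounded[OF assms(1)] in auto)

lemma block_map_return:
  assumes "bigstep I b (P, s) (map_pmf g p)"
    "\<And>a. a \<in> set_pmf p \<Longrightarrow> bounded_regs b (g a) \<Longrightarrow> bigstep I b (block Ps, g a) (return_pmf (h a))"
  shows "bigstep I b (block (P # Ps), s) (map_pmf h p)"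
  unfolding map_pmf_def
  by (rule bigstep_block_Cons[OF assms(1)])
     (use assms(2) bigstep_final_bounded[OF assms(1)] in auto)

lemma block_If:
  assumes "bounded_regs b s" "bigstep I b (if s x > 0 then P else Q, s) (return_pmf s')"
    "bounded_regs b s' \<Longrightarrow> bigstep I b (block Ps, s') \<mu>"
  shows "bigstep I b (block (IfPos x P Q # Ps), s) \<mu>"
  using assms by (intro block_det[OF bigstep_IfPos])

section \<open>The program\<close>

text \<open>
  Register 2 holds the constant 1 and register 28 the constant 0. Registers 0 and 3 to 10 hold the
  parameters \<open>n\<close>, \<open>m\<close>, \<open>2 ^ m\<close>, \<open>M\<close>, \<open>2 * M\<close>, \<open>2 ^ (2 * M)\<close>, the number of ticks, the
  threshold and the number of trials, where \<open>M\<close> binary digits of a weight are read on either side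
  of the binary point; registers 11 to 18 hold the loop variables \<open>j\<close>, count, accumulator, trial, start vertex, current vertex, remaining rounds and tick. The
  others are temporary and are reset to 0 after use.
\<close>

definition copy :: "reg \<Rightarrow> reg \<Rightarrow> prog" where
  "copy x y = Arith Add x y 28"

definition draw_prog :: "reg \<Rightarrow> prog" where
  "draw_prog x = block [copy 24 x,
     WhilePos 24 (block [Arith Sub 24 24 2, Coin 26, Arith Add 23 23 23, Arith Add 23 23 26, Const 26 0])]"

definition read_prog :: prog where
  "read_prog = block [copy 24 6,
     WhilePos 24 (block [Arith Sub 24 24 2, Arith Sub 25 24 5, ReadWeight 26 16 21 25,
       Arith Add 22 22 22, Arith Add 22 22 26, Const 25 0, Const 26 0])]"

definition walk_prog :: prog where
  "walk_prog = block [copy 20 16, copy 21 0,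
     WhilePos 21 (block [Arith Sub 21 21 2, read_prog, draw_prog 6,
       Arith Add 19 19 22, Arith Mul 22 22 7, Arith Mul 23 23 19, Arith Sub 22 22 23,
       IfPos 22 (copy 20 21) Skip, Const 22 0, Const 23 0]),
     copy 16 20, Const 19 0, Const 20 0]"

definition tick_prog :: prog where
  "tick_prog = block [Arith Sub 18 18 2,
     IfPos 17 (block [draw_prog 3, Arith Sub 23 11 23,
       IfPos 23 (block [Const 23 0, Arith Sub 17 17 2]) (block [Const 23 0, walk_prog])]) Skip]"

text \<open>\<open>IfPos\<close> tests only for positivity, so equality with the start vertex is
  tested by squaring the difference. Called with \<open>Add\<close> before and \<open>Sub\<close>
  after the last move, it accumulates the signed difference of the two return indicators.\<close>

definition check_prog :: "arith \<Rightarrow> prog" where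
  "check_prog f = block [Arith Sub 27 16 15, Arith Mul 27 27 27,
     IfPos 27 Skip (Arith f 13 13 2), Const 27 0]"

text \<open>The start vertex is the trial number modulo \<open>n\<close>, so all vertices serve
  equally often when the number of trials is a multiple of \<open>n\<close>. The tick loop has a
  fixed length, which makes halting certain; a walk with rounds left contributes nothing.\<close>

definition trial_prog :: prog where
  "trial_prog = block [Arith Div 15 14 0, Arith Mul 15 15 0, Arith Sub 15 14 15,
     copy 16 15, copy 17 3, copy 18 8, WhilePos 18 tick_prog,
     IfPos 17 Skip (block [check_prog Add, walk_prog, check_prog Sub]),
     Const 15 0, Const 16 0, Const 17 0]"

text \<open>If \<open>c\<close> of the tests pass, the transition from small to large estimates lies
  near p = c / 2 ^ m, where y = p / (1 - p) is c / (2 ^ m - c); hence the numerator and the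
  denominator.\<close>

definition main_prog :: prog where
  "main_prog = block [Arith Sub 11 4 2,
     WhilePos 11 (block [copy 14 10, WhilePos 14 (block [trial_prog, Arith Sub 14 14 2]),
       Arith Sub 13 13 9, IfPos 13 Skip (Arith Add 12 12 2), Const 13 0, Arith Sub 11 11 2]),
     copy 0 12, Arith Sub 1 4 12]"

section \<open>The distributions computed by the program\<close>

text \<open>The second argument is a prefix to which the random digits are appended; keeping it
  general makes induction on their number possible.\<close>

definition bits :: "nat \<Rightarrow> int \<Rightarrow> int pmf" where
  "bits = iter (\<lambda>_ u. map_pmf (\<lambda>c. 2 * u + of_bool c) (bernoulli_pmf (1 / 2)))"

text \<open>\<open>b\<close> majorises every intermediate value: \<open>b_prod\<close> covers the
  product of a random number and a total weight in the sampling test, \<open>b_sum\<close> the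
  accumulator and its difference to the threshold, \<open>b_sq\<close> the squared difference of two
  vertices.\<close>

locale estimator =
  fixes I :: input and b :: int and n m M T thr NN :: nat
  assumes n_eq: "size_in I = n" and n_pos: "0 < n"
    and weight_range: "\<And>i j. i < n \<Longrightarrow> j < n \<Longrightarrow> 0 \<le> weight_in I i j \<and> weight_in I i j < 2 ^ M"
    and m_le: "m \<le> 2 * M"
    and b_prod: "int n * 2 ^ (2 * M) * 2 ^ (2 * M) \<le> b"
    and b_sum: "int (NN + thr) \<le> b" and b_T: "int T \<le> b" and b_sq: "int n * int n \<le> b"
begin

definition trunc_weight :: "nat \<Rightarrow> nat \<Rightarrow> int" where
  "trunc_weight v u = \<lfloor>weight_in I v u * 2 ^ M\<rfloor>"

definition trunc_total :: "nat \<Rightarrow> nat \<Rightarrow> int" where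
  "trunc_total v u = (\<Sum>x\<in>{u..<n}. trunc_weight v x)"

text \<open>The coin has bias weight / total up to rounding; cross-multiplication avoids the
  quotient. As the pass runs from n - 1 down to 0, the weight seen so far is the sum from
  \<open>u\<close> upwards. At an isolated vertex the test reads 0 < 0 and the walk stays.\<close>

definition reservoir :: "nat \<Rightarrow> nat \<Rightarrow> nat \<Rightarrow> nat pmf" where
  "reservoir v u ch = map_pmf (\<lambda>x. if x * trunc_total v u < trunc_weight v u * 2 ^ (2 * M) then u else ch)
     (bits (2 * M) 0)"

definition walk :: "nat \<Rightarrow> nat pmf" where
  "walk v = iter (reservoir v) n v"

definition tick :: "nat \<Rightarrow> nat \<times> nat \<Rightarrow> (nat \<times> nat) pmf" where
  "tick j = (\<lambda>(v, r). if r = 0 then return_pmf (v, r)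
     else bind_pmf (bits m 0) (\<lambda>x. if x < int j then return_pmf (v, r - 1)
       else map_pmf (\<lambda>v'. (v', r)) (walk v)))"

text \<open>With exact sampling, the mean outcome given the position v after the last round is the
  entry (v, v0) of 1 - P. Averaged over the walk from v0 it becomes a diagonal entry of the filtered
  matrix, and summation over v0 gives the trace.\<close>

definition trial :: "nat \<Rightarrow> nat \<Rightarrow> int pmf" where
  "trial j v0 = bind_pmf (iter (\<lambda>_. tick j) T (v0, m)) (\<lambda>(v, r).
     if r > 0 then return_pmf 0
     else map_pmf (\<lambda>v'. of_bool (v = v0) - of_bool (v' = v0)) (walk v))"

definition total :: "nat \<Rightarrow> int pmf" where
  "total j = iter (\<lambda>i acc. map_pmf (\<lambda>x. acc + x) (trial j (Suc i mod n))) NN 0"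

definition counting :: "nat \<Rightarrow> int pmf" where
  "counting k = iter (\<lambda>j c. map_pmf (\<lambda>acc. c + of_bool (acc \<le> int thr)) (total (Suc j))) k 0"

definition ready :: "state \<Rightarrow> bool" where
  "ready s \<longleftrightarrow> bounded_regs b s \<and> s 0 = int n \<and> s 2 = 1 \<and> s 3 = int m \<and> s 4 = 2 ^ m \<and>
     s 5 = int M \<and> s 6 = 2 * int M \<and> s 7 = 2 ^ (2 * M) \<and> s 8 = int T \<and> s 9 = int thr \<and>
     s 10 = int NN \<and> s 19 = 0 \<and> s 20 = 0 \<and> s 21 = 0 \<and> s 22 = 0 \<and> s 23 = 0 \<and> s 24 = 0 \<and>
     s 25 = 0 \<and> s 26 = 0 \<and> s 27 = 0 \<and> s 28 = 0"

lemma b_facts: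
  "(2::int) ^ (2 * M) \<le> b" "int n \<le> b" "1 \<le> b" "(2::int) ^ m \<le> b" "int (2 * M) \<le> b" "int m \<le> b"
  "int n * 2 ^ (2 * M) \<le> b" "(2::int) ^ (2 * M) * 2 ^ (2 * M) \<le> b"
proof -
  have 1: "(1::int) \<le> 2 ^ (2 * M)" by simp
  have 2: "(1::int) \<le> int n" using n_pos by simp
  have 3: "(2::int) ^ (2 * M) * 1 \<le> 2 ^ (2 * M) * 2 ^ (2 * M)" by (rule mult_left_mono) simp_all
  have "1 * (2 ^ (2 * M) * 2 ^ (2 * M)) \<le> int n * (2 ^ (2 * M) * 2 ^ (2 * M))"
    by (rule mult_right_mono[OF 2]) simp
  also have "\<dots> \<le> b" using b_prod by (simp only: mult.assoc)
  finally show 4: "(2::int) ^ (2 * M) * 2 ^ (2 * M) \<le> b" by (simp only: mult_1_left)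
  show 5: "(2::int) ^ (2 * M) \<le> b" using order_trans[OF 3 4] by (simp only: mult_1_right)
  have "int n * 2 ^ (2 * M) * 1 \<le> int n * 2 ^ (2 * M) * 2 ^ (2 * M)"
    by (rule mult_left_mono) simp_all
  then show 6: "int n * 2 ^ (2 * M) \<le> b" using b_prod by simp
  have "int n * 1 \<le> int n * 2 ^ (2 * M)" by (rule mult_left_mono) simp_all
  then show "int n \<le> b" using 6 by simp
  then show "1 \<le> b" using 2 by simp
  have 7: "(2::int) ^ m \<le> 2 ^ (2 * M)" using m_le by (rule power_increasing) simp
  show "(2::int) ^ m \<le> b" by (rule order_trans[OF 7 5])
  have "int (2 * M) \<le> 2 ^ (2 * M)" by (metis of_nat_less_two_power less_imp_le of_nat_numeral of_nat_power)
  then show "int (2 * M) \<le> b" using 5 by simp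
  then show "int m \<le> b" using m_le by simp
qed

end

section \<open>Correctness of the sampling subprograms\<close>

lemma set_pmf_bits: "x \<in> set_pmf (bits k u) \<Longrightarrow> u * 2 ^ k \<le> x \<and> x < (u + 1) * 2 ^ k"
proof (induction k arbitrary: u)
  case 0
  then show ?case by (simp add: bits_def)
next
  case (Suc k)
  from Suc.prems obtain c :: bool where "x \<in> set_pmf (bits k (2 * u + of_bool c))"
    by (auto simp: bits_def)
  from Suc.IH[OF this] show ?case
    by (cases c) (auto simp: algebra_simps intro: order_trans order_le_less_trans order_less_le_trans)
qed

lemma bigstep_copy:
  "bounded_regs b s \<Longrightarrow> s 28 = 0 \<Longrightarrow> bigstep I b (copy x y, s) (return_pmf (s(x := s y)))"
  using bigstep_Arith[of b s Add y 28 I x]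
  by (auto simp: copy_def bounded_regs_def)

lemma bigstep_draw:
  assumes s: "bounded_regs b s" "s 2 = 1" "s 28 = 0" "s 23 = 0" "s 24 = 0" "s 26 = 0"
    and x: "s x = int k" "(2::int) ^ k \<le> b"
  shows "bigstep I b (draw_prog x, s) (map_pmf (\<lambda>u. s(23 := u)) (bits k 0))"
proof -
  define S where "S i u = s(24 := int i, 23 := u)" for i and u :: int
  have kb: "int k < b" using x(2) by (smt (verit) of_nat_less_two_power)
  have le: "(2::int) ^ (k - i) \<le> b" for i
    by (rule order_trans[OF power_increasing x(2)]) auto
  define V where "V i u \<longleftrightarrow> 0 \<le> u \<and> u < 2 ^ (k - i)" for i and u :: int
  have cnt: "S i u 24 = int i" for i u by (simp add: S_def)
  have bnd: "bounded_regs b (S i u)" if "V i u" "i \<le> k" for i u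
    unfolding S_def using that s(1) kb le[of i] by (intro bounded_regs_upd) (auto simp: V_def)
  have step: "2 * u + 1 < 2 ^ (k - i)" "0 \<le> u" "2 * u + 1 < b" if "V (Suc i) u" "Suc i \<le> k" for i u
  proof -
    have "(2::int) ^ (k - i) = 2 * 2 ^ (k - Suc i)"
      using that(2) by (metis Suc_diff_le diff_Suc_Suc power_Suc)
    then show "2 * u + 1 < 2 ^ (k - i)" "0 \<le> u" using that(1) by (auto simp: V_def)
    then show "2 * u + 1 < b" using le[of i] by simp
  qed
  have "bigstep I b (WhilePos 24 (block [Arith Sub 24 24 2, Coin 26, Arith Add 23 23 23,
      Arith Add 23 23 26, Const 26 0]), S k 0)
    (map_pmf (S 0) (iter (\<lambda>_ u. map_pmf (\<lambda>c. 2 * u + of_bool c) (bernoulli_pmf (1 / 2))) k 0))"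
  proof (rule bigstep_for[where V = V and ?k0.0 = k])
    fix i u assume V: "V (Suc i) u" and i: "Suc i \<le> k"
    note st = step[OF V i]
    show "bigstep I b (block [Arith Sub 24 24 2, Coin 26, Arith Add 23 23 23,
      Arith Add 23 23 26, Const 26 0], S (Suc i) u)
      (map_pmf (S i) (map_pmf (\<lambda>c. 2 * u + of_bool c) (bernoulli_pmf (1 / 2))))"
      unfolding pmf.map_comp
      apply (rule block_Arith[OF bnd[OF V i] refl])
      subgoal using kb i by (simp add: S_def s)
      apply (rule block_map_return[OF bigstep_Coin])
      subgoal .
      subgoal using st by simp
      subgoal for c
        apply (intro block_Arith[OF _ refl] block_Const block_Nil)
        using st by (auto simp: S_def s abs_if)
      done
  next
    fix i u u' assume "V (Suc i) u" "Suc i \<le> k"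
      "u' \<in> set_pmf (map_pmf (\<lambda>c. 2 * u + of_bool c) (bernoulli_pmf (1 / 2)))"
    then show "V i u'" using step[of i u] by (auto simp: V_def)
  qed (use bnd cnt in \<open>auto simp: V_def\<close>)
  moreover have "S 0 = (\<lambda>u. s(23 := u))"
    using s by (auto simp: S_def fun_eq_iff)
  moreover have "s(24 := s x) = S k 0" using s x by (auto simp: S_def fun_eq_iff)
  ultimately have *: "bigstep I b (WhilePos 24 (block [Arith Sub 24 24 2, Coin 26, Arith Add 23 23 23,
      Arith Add 23 23 26, Const 26 0]), s(24 := s x)) (map_pmf (\<lambda>u. s(23 := u)) (bits k 0))"
    by (simp add: bits_def)
  show ?thesis
    unfolding draw_prog_def
    by (rule block_det[OF bigstep_copy[OF s(1,3)]], rule block_map_return[OF *], rule block_Nil) auto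
qed

context estimator
begin

text \<open>One Horner step: moving the cut one binary place to the right doubles the integer part
  and appends the digit uncovered.\<close>

lemma floor_double:
  "\<lfloor>x * 2 powi (int M - int k)\<rfloor> = 2 * \<lfloor>x * 2 powi (int M - int (Suc k))\<rfloor> + digit x (int k - int M)"
proof -
  define y :: real where "y = x * 2 powi (int M - int (Suc k))"
  have "(2::real) powi (int M - int k) = 2 powi ((int M - int (Suc k)) + 1)" by simp
  also have "\<dots> = 2 powi (int M - int (Suc k)) * 2" by (subst power_int_add) auto
  finally have 1: "x * 2 powi (int M - int k) = 2 * y" by (simp add: y_def)
  have "digit x (int k - int M) = \<lfloor>2 * y\<rfloor> mod 2" unfolding digit_def using 1 by simp
  moreover have "\<lfloor>2 * y\<rfloor> div 2 = \<lfloor>y\<rfloor>"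
    using floor_divide_real_eq_div[of 2 "2 * y"] by simp
  ultimately show ?thesis unfolding 1 y_def[symmetric] by (metis mult_div_mod_eq)
qed

lemma trunc_weight_bounds:
  assumes "v < n" "u < n"
  shows "0 \<le> trunc_weight v u" "trunc_weight v u < 2 ^ (2 * M)"
proof -
  show "0 \<le> trunc_weight v u" using weight_range[OF assms] by (simp add: trunc_weight_def)
  have "weight_in I v u * 2 ^ M < 2 ^ M * 2 ^ M" using weight_range[OF assms] by simp
  also have "\<dots> = real_of_int (2 ^ (2 * M))" by (simp add: power_add[symmetric] mult_2)
  finally show "trunc_weight v u < 2 ^ (2 * M)" unfolding trunc_weight_def floor_less_iff .
qed

lemma bigstep_read:
  assumes s: "bounded_regs b s" "s 2 = 1" "s 28 = 0" "s 22 = 0" "s 24 = 0" "s 25 = 0" "s 26 = 0"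
      "s 6 = 2 * int M" "s 5 = int M"
    and vu: "s 16 = int v" "s 21 = int u" "v < n" "u < n"
  shows "bigstep I b (read_prog, s) (return_pmf (s(22 := trunc_weight v u)))"
proof -
  let ?w = "weight_in I v u"
  let ?P = "block [Arith Sub 24 24 2, Arith Sub 25 24 5, ReadWeight 26 16 21 25,
       Arith Add 22 22 22, Arith Add 22 22 26, Const 25 0, Const 26 0]"
  define y where "y i = \<lfloor>?w * 2 powi (int M - int i)\<rfloor>" for i :: nat
  define S where "S i u = s(24 := int i, 22 := y i)" for i and u :: unit
  note w = weight_range[OF vu(3,4)]
  have y0: "0 \<le> y i" for i using w by (simp add: y_def)
  have ydec: "y (Suc i) \<le> y i" for i
    unfolding y_def using w by (intro floor_mono mult_left_mono power_int_increasing) auto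
  have yb: "y i < 2 ^ (2 * M)" for i
  proof (induction i)
    case 0
    show ?case using trunc_weight_bounds(2)[OF vu(3,4)] by (simp add: y_def trunc_weight_def)
  next
    case (Suc i) then show ?case using ydec[of i] by simp
  qed
  \<comment> \<open>Digits are read at the places M - 1 down to - M. The weight is below 2 ^ M, so
    nothing lies above them and the accumulator may start at 0.\<close>
  have top: "y (2 * M) = 0"
  proof -
    have "?w * 2 powi (int M - int (2 * M)) = ?w / 2 ^ M"
      by (simp add: power_int_minus divide_inverse)
    also have "\<lfloor>\<dots>\<rfloor> = 0" using w by (simp add: floor_eq_iff)
    finally show ?thesis by (simp add: y_def)
  qed
  have ystep: "y i = 2 * y (Suc i) + digit ?w (int i - int M)" for i
    unfolding y_def by (rule floor_double)
  have cnt: "S i x 24 = int i" for i x by (simp add: S_def)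
  have bnd: "bounded_regs b (S i x)" if "i \<le> 2 * M" for i x
    unfolding S_def using that s(1) y0[of i] yb[of i] b_facts(1,5)
    by (intro bounded_regs_upd) auto
  have "bigstep I b (WhilePos 24 ?P, S (2 * M) ()) (map_pmf (S 0) (iter (\<lambda>_ _. return_pmf ()) (2 * M) ()))"
  proof (rule bigstep_for[where V = "\<lambda>_ _. True" and ?k0.0 = "2 * M"])
    fix i and x :: unit assume i: "Suc i \<le> 2 * M"
    have rd: "bigstep I b (ReadWeight 26 16 21 25, t) (return_pmf (t(26 := digit ?w (int i - int M))))"
      if "bounded_regs b t" "t 16 = int v" "t 21 = int u" "t 25 = int i - int M" for t
      using bigstep_ReadWeight[OF that(1) b_facts(3), of I 26 16 21 25] that vu n_eq
      by (simp add: weight_digit_def)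
    have "bigstep I b (?P, S (Suc i) x) (return_pmf (S i ()))"
      apply (rule block_Arith[OF bnd[OF i] refl])
      subgoal using b_facts(5) i by (simp add: S_def s)
      apply (rule block_Arith, assumption, rule refl)
      subgoal using b_facts(5) i by (simp add: S_def s)
      apply (rule block_det, rule rd, assumption)
      subgoal by (simp add: S_def vu)
      subgoal by (simp add: S_def vu)
      subgoal by (simp add: S_def s)
      apply (intro block_Arith[OF _ refl] block_Const block_Nil; assumption?)
      using y0[of i] yb[of i] y0[of "Suc i"] b_facts(1,3) ystep[of i] digit_bounds[of ?w "int i - int M"]
      by (auto simp: S_def s abs_if)
    then show "bigstep I b (?P, S (Suc i) x) (map_pmf (S i) (return_pmf ()))" by simp
  qed (use bnd cnt in auto)
  moreover have "iter (\<lambda>_ _. return_pmf ()) k () = return_pmf ()" for k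
    by (induction k) (auto simp: bind_return_pmf)
  moreover have "S 0 () = s(22 := trunc_weight v u)" using s by (auto simp: S_def fun_eq_iff y_def trunc_weight_def)
  moreover have "s(24 := s 6) = S (2 * M) ()" using s by (auto simp: S_def fun_eq_iff top)
  ultimately have *: "bigstep I b (WhilePos 24 ?P, s(24 := s 6)) (return_pmf (s(22 := trunc_weight v u)))"
    by simp
  show ?thesis
    unfolding read_prog_def
    by (intro block_det[OF bigstep_copy[OF s(1,3)]] block_det[OF *] block_Nil) auto
qed

lemma trunc_total_bounds:
  assumes "v < n" "u < n"
  shows "0 \<le> trunc_total v u" "trunc_total v (Suc u) + trunc_weight v u = trunc_total v u"
    "trunc_total v u \<le> int n * 2 ^ (2 * M)"
proof -
  show "0 \<le> trunc_total v u"
    unfolding trunc_total_def using assms by (intro sum_nonneg trunc_weight_bounds) auto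
  show "trunc_total v (Suc u) + trunc_weight v u = trunc_total v u"
    unfolding trunc_total_def using assms by (simp add: sum.atLeast_Suc_lessThan)
  have "trunc_total v u \<le> (\<Sum>x\<in>{u..<n}. 2 ^ (2 * M))"
    unfolding trunc_total_def using assms by (intro sum_mono less_imp_le trunc_weight_bounds) auto
  also have "\<dots> \<le> int n * 2 ^ (2 * M)" by (simp add: mult_right_mono)
  finally show "trunc_total v u \<le> int n * 2 ^ (2 * M)" .
qed

lemma bigstep_walk:
  assumes s: "ready s" and v: "s 16 = int v" "v < n"
  shows "bigstep I b (walk_prog, s) (map_pmf (\<lambda>u. s(16 := int u)) (walk v))"
proof -
  let ?P = "block [Arith Sub 21 21 2, read_prog, draw_prog 6,
       Arith Add 19 19 22, Arith Mul 22 22 7, Arith Mul 23 23 19, Arith Sub 22 22 23,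
       IfPos 22 (copy 20 21) Skip, Const 22 0, Const 23 0]"
  note s' = s[unfolded ready_def]
  define tt where "tt u = (if u < n then trunc_total v u else 0)" for u
  define S where "S u c = s(19 := tt u, 20 := int c, 21 := int u)" for u c :: nat
  define V where "V u c \<longleftrightarrow> c < n" for u c :: nat
  have tt: "0 \<le> tt u" "tt u \<le> int n * 2 ^ (2 * M)" for u
    using trunc_total_bounds[OF v(2)] by (auto simp: tt_def)
  have tt_Suc: "tt (Suc u) + trunc_weight v u = tt u" if "u < n" for u
  proof (cases "Suc u < n")
    case False
    then have "Suc u = n" using that by simp
    then show ?thesis using that trunc_total_bounds(2)[OF v(2) that]
      by (auto simp: tt_def trunc_total_def)
  qed (use that trunc_total_bounds[OF v(2) that] in \<open>auto simp: tt_def\<close>)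
  have cnt: "S u c 21 = int u" for u c by (simp add: S_def)
  have bnd: "bounded_regs b (S u c)" if "V u c" "u \<le> n" for u c
    unfolding S_def using that s' tt[of u] b_facts(2,7)
    by (intro bounded_regs_upd) (auto simp: V_def)
  have "bigstep I b (WhilePos 21 ?P, S n v) (map_pmf (S 0) (iter (reservoir v) n v))"
  proof (rule bigstep_for[where V = V and ?k0.0 = n])
    fix u c assume V: "V (Suc u) c" and u: "Suc u \<le> n"
    have un: "u < n" using u by simp
    let ?w = "trunc_weight v u"
    note w = trunc_weight_bounds[OF v(2) un]
    let ?s1 = "(S (Suc u) c)(21 := int u)"
    let ?s2 = "?s1(22 := ?w)"
    have b1: "bounded_regs b ?s1"
      using u b_facts(2) by (intro bounded_regs_upd[OF bnd[OF V u]]) auto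
    have rd: "bigstep I b (read_prog, ?s1) (return_pmf ?s2)"
      by (rule bigstep_read[OF b1 _ _ _ _ _ _ _ _ _ _ v(2) un]) (use s' v in \<open>auto simp: S_def\<close>)
    have b2: "bounded_regs b ?s2" using bigstep_final_bounded[OF rd] by simp
    have dr: "bigstep I b (draw_prog 6, ?s2) (map_pmf (\<lambda>x. ?s2(23 := x)) (bits (2 * M) 0))"
      by (rule bigstep_draw[OF b2]) (use s' b_facts(1) in \<open>auto simp: S_def\<close>)
    show "bigstep I b (?P, S (Suc u) c) (map_pmf (S u) (reservoir v u c))"
      unfolding reservoir_def pmf.map_comp
      apply (rule block_Arith[where v = "int u", OF bnd[OF V u]])
      subgoal using s' by (simp add: S_def)
      subgoal using un b_facts(2) by simp
      apply (rule block_det[OF rd])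
      apply (rule block_map_return[OF dr])
      subgoal premises prems for x
      proof -
        let ?tot = "trunc_total v u"
        have x: "0 \<le> x" "x < 2 ^ (2 * M)" using set_pmf_bits[OF prems(3)] by auto
        have tu: "tt u = ?tot" using un by (simp add: tt_def)
        have xt: "0 \<le> x * ?tot" "x * ?tot \<le> b"
        proof -
          have "x * ?tot \<le> 2 ^ (2 * M) * (int n * 2 ^ (2 * M))"
            using x tt[of u] tu by (intro mult_mono) auto
          also have "\<dots> \<le> b" using b_prod by (simp add: ac_simps)
          finally show "x * ?tot \<le> b" .
        qed (use x tt[of u] tu in auto)
        have wq: "0 \<le> ?w * 2 ^ (2 * M)" "?w * 2 ^ (2 * M) \<le> b"
        proof -
          have "?w * 2 ^ (2 * M) \<le> 2 ^ (2 * M) * 2 ^ (2 * M)"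
            using w by (intro mult_right_mono) auto
          from this b_facts(8) show "?w * 2 ^ (2 * M) \<le> b" by (rule order_trans)
        qed (use w in auto)
        let ?s3 = "s(19 := ?tot, 20 := int c, 21 := int u, 22 := ?w * 2 ^ (2 * M) - x * ?tot, 23 := x * ?tot)"
        have d: "\<bar>?w * 2 ^ (2 * M) - x * ?tot\<bar> \<le> b" using xt wq by linarith
        have s3: "bounded_regs b ?s3"
          using d s' tt[of u] tu b_facts(2,7) V un x xt wq
          by (intro bounded_regs_upd) (auto simp: V_def)
        have fin: "bigstep I b (IfPos 22 (copy 20 21) Skip, ?s3)
          (return_pmf (?s3(20 := if x * ?tot < ?w * 2 ^ (2 * M) then int u else int c)))"
        proof (rule bigstep_IfPos[OF s3])
          show "bigstep I b (if 0 < ?s3 22 then copy 20 21 else Skip, ?s3)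
            (return_pmf (?s3(20 := if x * ?tot < ?w * 2 ^ (2 * M) then int u else int c)))"
            using bigstep_copy[OF s3, of I 20 21] bigstep_Skip[OF s3, of I] s'
            by (auto simp: fun_upd_twist)
        qed
        show ?thesis
          apply (rule block_Arith[OF prems(4) refl])
          subgoal using tt[of u] tu b_facts(7) tt_Suc[OF un] by (simp add: S_def)
          apply (rule block_Arith, assumption, rule refl)
          subgoal using wq s' by (simp add: S_def)
          apply (rule block_Arith, assumption, rule refl)
          subgoal using xt tu tt_Suc[OF un] s' by (simp add: S_def)
          apply (rule block_Arith, assumption, rule refl)
          subgoal using xt tu tt_Suc[OF un] s' wq by (simp add: S_def)
          apply (rule block_det)
           apply (rule back_subst[where P = "\<lambda>t. bigstep I b (IfPos 22 (copy 20 21) Skip, t) _", OF fin])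
          subgoal using tu tt_Suc[OF un] s' by (auto simp: S_def fun_eq_iff)
          apply (intro block_Const block_Nil; assumption?)
          using b_facts(3) s' tu by (auto simp: S_def)
      qed
      done
  next
    fix u c c' assume "V (Suc u) c" "Suc u \<le> n" "c' \<in> set_pmf (reservoir v u c)"
    then show "V u c'" by (auto simp: V_def reservoir_def split: if_splits)
  qed (use bnd cnt v in \<open>auto simp: V_def\<close>)
  then have *: "bigstep I b (WhilePos 21 ?P, S n v) (map_pmf (S 0) (walk v))"
    by (simp add: walk_def)
  have init: "(s(20 := s 16))(21 := (s(20 := s 16)) 0) = S n v"
    using s' v by (auto simp: S_def fun_eq_iff tt_def)
  have b0: "bounded_regs b s" "bounded_regs b (s(20 := s 16))"
    using s' v b_facts(2) by (auto intro!: bounded_regs_upd)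
  have t0: "tt 0 = trunc_total v 0" using n_pos by (simp add: tt_def)
  show ?thesis
    unfolding walk_prog_def
    apply (rule block_det[OF bigstep_copy])
    subgoal by (rule b0)
    subgoal using s' by simp
    apply (rule block_det[OF bigstep_copy])
    subgoal by (rule b0)
    subgoal using s' by simp
    unfolding init
    apply (rule block_map_return[OF *])
    subgoal premises prems for u
      apply (rule block_det[OF bigstep_copy[OF prems(4)]])
      subgoal using s' by (simp add: S_def)
      apply (intro block_Const block_Nil; assumption?)
      using b_facts(3) s' by (auto simp: S_def)
    done
qed

lemma walk_less:
  assumes "v < n" "u \<in> set_pmf (walk v)"
  shows "u < n"
proof -
  have "a' < n" if "Suc k \<le> n \<and> a < n" "a' \<in> set_pmf (reservoir v k a)" for k a a'
    using that by (auto simp: reservoir_def split: if_splits)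
  then show ?thesis
    using iter_invariant[where V = "\<lambda>k c. k \<le> n \<and> c < n" and f = "reservoir v" and k = n and a = v and a' = u]
      assms by (auto simp: walk_def)
qed

end

lemma block_single:
  assumes "bigstep I b (P, s) \<mu>"
  shows "bigstep I b (block [P], s) \<mu>"
proof -
  have "bigstep I b (block [P], s) (bind_pmf \<mu> return_pmf)"
  proof (rule bigstep_block_Cons[where g = id])
    show "bigstep I b (P, s) (map_pmf id \<mu>)" using assms by (simp add: pmf.map_id)
    show "bigstep I b (block [], id a) (return_pmf a)" if "a \<in> set_pmf \<mu>" for a
      using bigstep_final_bounded[OF assms that] by (simp add: block.simps bigstep.halt)
  qed
  then show ?thesis by (simp add: bind_return_pmf')
qed

context estimator
begin

lemma ready_upd:
  assumes "ready s" "x \<in> {1, 11, 12, 13, 14, 15, 16, 17, 18}" "\<bar>v\<bar> \<le> b"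
  shows "ready (s(x := v))"
proof -
  have "bounded_regs b (s(x := v))"
    using assms by (intro bounded_regs_upd) (simp_all add: ready_def)
  moreover have "(s(x := v)) y = s y" if "y \<notin> {1, 11, 12, 13, 14, 15, 16, 17, 18}" for y
    using assms(2) that by (metis fun_upd_other)
  ultimately show ?thesis using assms(1) by (simp add: ready_def del: fun_upd_apply)
qed

lemma ready_bounded: "ready s \<Longrightarrow> bounded_regs b s"
  by (simp add: ready_def)

lemma bigstep_tick:
  assumes s: "ready s" and vr: "s 16 = int v" "v < n" "s 17 = int r" "r \<le> m"
    and j: "s 11 = int j" "int j \<le> b" and t: "s 18 = int (Suc t)" "int t \<le> b"
  shows "bigstep I b (tick_prog, s) (map_pmf (\<lambda>(v, r). s(16 := int v, 17 := int r, 18 := int t)) (tick j (v, r)))"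
proof -
  note s' = s[unfolded ready_def]
  let ?s1 = "s(18 := int t)"
  have b1: "bounded_regs b ?s1" using s' t by (auto intro!: bounded_regs_upd)
  have r1: "ready ?s1" using s t by (auto intro!: ready_upd)
  let ?Q = "IfPos 17 (block [draw_prog 3, Arith Sub 23 11 23,
       IfPos 23 (block [Const 23 0, Arith Sub 17 17 2]) (block [Const 23 0, walk_prog])]) Skip"
  have main: "bigstep I b (?Q, ?s1) (map_pmf (\<lambda>(v, r). s(16 := int v, 17 := int r, 18 := int t)) (tick j (v, r)))"
  proof (cases "r = 0")
    case True
    have "map_pmf (\<lambda>(v, r). s(16 := int v, 17 := int r, 18 := int t)) (tick j (v, r)) = return_pmf ?s1"
      using True vr(1,3) by (auto simp: tick_def fun_eq_iff)
    then show ?thesis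
      using bigstep_IfPos[OF b1, of I 17 _ Skip] bigstep_Skip[OF b1, of I] True vr(3) by simp
  next
    case False
    let ?s2 = "\<lambda>x. ?s1(23 := x)"
    have dr: "bigstep I b (draw_prog 3, ?s1) (map_pmf ?s2 (bits m 0))"
      by (rule bigstep_draw[OF b1]) (use s' b_facts(4) in auto)
    let ?f = "\<lambda>x. map_pmf (\<lambda>(v, r). s(16 := int v, 17 := int r, 18 := int t))
       (if x < int j then return_pmf (v, r - 1) else map_pmf (\<lambda>v'. (v', r)) (walk v))"
    let ?B = "block [draw_prog 3, Arith Sub 23 11 23,
       IfPos 23 (block [Const 23 0, Arith Sub 17 17 2]) (block [Const 23 0, walk_prog])]"
    have dist: "bind_pmf (bits m 0) ?f = map_pmf (\<lambda>(v, r). s(16 := int v, 17 := int r, 18 := int t)) (tick j (v, r))"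
      using False by (simp add: tick_def map_bind_pmf)
    have B: "bigstep I b (?B, ?s1) (map_pmf (\<lambda>(v, r). s(16 := int v, 17 := int r, 18 := int t)) (tick j (v, r)))"
      unfolding dist[symmetric]
      apply (rule bigstep_block_Cons[OF dr])
      subgoal premises prems for x
      proof -
        have x: "0 \<le> x" "x < 2 ^ m" using set_pmf_bits[OF prems] by auto
        have b2: "bounded_regs b (?s2 x)" using x b_facts(4) by (intro bounded_regs_upd[OF b1]) auto
        have b3: "bounded_regs b (?s1(23 := int j - x))"
          using x b_facts(4) j by (intro bounded_regs_upd[OF b1]) auto
        have "bigstep I b (if int j - x > 0 then block [Const 23 0, Arith Sub 17 17 2]
            else block [Const 23 0, walk_prog], ?s1(23 := int j - x)) (?f x)"
        proof (cases "x < int j")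
          case True
          show ?thesis
            using True apply (simp only: if_True diff_gt_0_iff_gt map_return_pmf prod.case)
            apply (intro block_Const block_Arith[OF _ refl] block_Nil b3; assumption?)
            using True False vr b_facts(3,6) s' by (auto simp: of_nat_diff)
        next
          case F: False
          have e: "?s1(23 := int j - x, 23 := 0) = ?s1" using s' by (auto simp: fun_eq_iff)
          have e2: "bounded_regs b (?s1(23 := int j - x, 23 := 0))" unfolding e by (rule b1)
          have "bigstep I b (block [walk_prog], ?s1) (map_pmf (\<lambda>v'. s(16 := int v', 17 := int r, 18 := int t)) (walk v))"
            by (rule block_map_return[OF bigstep_walk[OF r1, of v]])
               (use vr in \<open>auto intro: block_Nil\<close>)
          then have W: "bigstep I b (block [walk_prog], ?s1(23 := int j - x, 23 := 0))
              (map_pmf (\<lambda>v'. s(16 := int v', 17 := int r, 18 := int t)) (walk v))"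
            unfolding e .
          have "bigstep I b (block [Const 23 0, walk_prog], ?s1(23 := int j - x))
              (map_pmf (\<lambda>v'. s(16 := int v', 17 := int r, 18 := int t)) (walk v))"
            by (rule block_Const[OF b3 _ W]) (use b_facts(3) in simp)
          then show ?thesis using F by (simp add: pmf.map_comp comp_def)
        qed
        then have *: "bigstep I b (IfPos 23 (block [Const 23 0, Arith Sub 17 17 2])
            (block [Const 23 0, walk_prog]), ?s1(23 := int j - x)) (?f x)"
          by (intro bigstep_IfPos[OF b3]) simp
        show ?thesis
          apply (rule block_Arith[OF b2 refl])
          subgoal using x j b_facts(4) by simp
          subgoal
            by (rule block_single) (use * j in simp)
          done
      qed
      done
    have "(if 0 < ?s1 17 then ?B else Skip) = ?B" using False vr by simp
    then show ?thesis by (intro bigstep_IfPos[OF b1]) (simp only: B)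
  qed
  show ?thesis unfolding tick_prog_def
    apply (rule block_Arith[where v = "int t", OF ready_bounded[OF s]])
    subgoal using s' t by simp
    subgoal using t by simp
    subgoal
      by (rule block_single[OF main])
    done
qed

end

section \<open>Trials, their total, and the sweep over the stopping probability\<close>

context estimator
begin

lemma bigstep_check:
  assumes s: "ready s" and v: "s 16 = int v" "s 15 = int v0" "v < n" "v0 < n"
    and f: "\<bar>arith_val f (s 13) 1\<bar> \<le> b"
  shows "bigstep I b (check_prog f, s) (return_pmf (s(13 := if v = v0 then arith_val f (s 13) 1 else s 13)))"
proof -
  note s' = s[unfolded ready_def]
  let ?d = "(int v - int v0) * (int v - int v0)"
  have d1: "\<bar>int v - int v0\<bar> \<le> int n" using v by simp
  have d2: "\<bar>?d\<bar> \<le> b"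
    unfolding abs_mult using mult_mono[OF d1 d1] b_sq by simp
  have z: "?d > 0 \<longleftrightarrow> v \<noteq> v0" by (cases "v = v0") (auto simp: zero_less_mult_iff)
  let ?s1 = "s(27 := ?d)"
  have b1: "bounded_regs b ?s1" using s' d2 by (intro bounded_regs_upd) auto
  have I1: "bigstep I b (IfPos 27 Skip (Arith f 13 13 2), ?s1)
      (return_pmf (?s1(13 := if v = v0 then arith_val f (s 13) 1 else s 13)))"
  proof (rule bigstep_IfPos[OF b1], cases "v = v0")
    case True
    have "bigstep I b (Arith f 13 13 2, ?s1) (return_pmf (?s1(13 := arith_val f (?s1 13) (?s1 2))))"
      by (rule bigstep_Arith[OF b1]) (use s' f in simp)
    then show "bigstep I b (if 0 < ?s1 27 then Skip else Arith f 13 13 2, ?s1)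
      (return_pmf (?s1(13 := if v = v0 then arith_val f (s 13) 1 else s 13)))"
      using True s' by simp
  next
    case False
    have "?s1(13 := s 13) = ?s1" by (auto simp: fun_eq_iff)
    then show "bigstep I b (if 0 < ?s1 27 then Skip else Arith f 13 13 2, ?s1)
      (return_pmf (?s1(13 := if v = v0 then arith_val f (s 13) 1 else s 13)))"
      using False z bigstep_Skip[OF b1] by simp
  qed
  show ?thesis
    unfolding check_prog_def
    apply (rule block_Arith[where v = "int v - int v0", OF ready_bounded[OF s]])
    subgoal using v by simp
    subgoal using d1 b_facts(2) by simp
    apply (rule block_Arith[where v = "?d"], assumption)
    subgoal by simp
    subgoal by (rule d2)
    apply (rule block_det[where s' = "?s1(13 := if v = v0 then arith_val f (s 13) 1 else s 13)"])
    subgoal using I1 by simp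
    apply (intro block_Const block_Nil; assumption?)
    using s' b_facts(3) by auto
qed

lemma iter_tick_invariant:
  assumes "v < n" "r \<le> m" "a \<in> set_pmf (iter (\<lambda>_. tick j) t (v, r))"
  shows "fst a < n \<and> snd a \<le> m"
proof -
  have "fst a' < n \<and> snd a' \<le> m"
    if "fst a < n \<and> snd a \<le> m" "a' \<in> set_pmf (tick j a)" for a a'
    using that walk_less by (cases a) (fastforce simp: tick_def split: if_splits)
  then show ?thesis
    using iter_invariant[where V = "\<lambda>_ a. fst a < n \<and> snd a \<le> m" and f = "\<lambda>_. tick j"] assms
    by (metis fst_conv snd_conv)
qed

lemma tick_invariant:
  assumes "fst a < n \<and> snd a \<le> m" "a' \<in> set_pmf (tick j a)"
  shows "fst a' < n \<and> snd a' \<le> m"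
  using iter_tick_invariant[of "fst a" "snd a" a' j "Suc 0"] assms by (simp add: bind_return_pmf')

lemma bigstep_ticks:
  assumes s: "ready s" and v: "v < n" and j: "s 11 = int j" "int j \<le> b"
  shows "bigstep I b (WhilePos 18 tick_prog, s(16 := int v, 17 := int m, 18 := int T))
    (map_pmf (\<lambda>(v, r). s(16 := int v, 17 := int r, 18 := 0)) (iter (\<lambda>_. tick j) T (v, m)))"
proof -
  define S where "S t a = s(16 := int (fst a), 17 := int (snd a), 18 := int t)" for t and a :: "nat \<times> nat"
  define V where "V k a \<longleftrightarrow> fst a < n \<and> snd a \<le> m" for k :: nat and a :: "nat \<times> nat"
  have S_eq: "(\<lambda>(v, r). s(16 := int v, 17 := int r, 18 := int t)) = S t" for t
    by (rule ext) (simp add: S_def case_prod_beta)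
  have rd: "ready (S t a)" if "V t a" "t \<le> T" for t a
  proof -
    have "int (fst a) \<le> b" "int (snd a) \<le> b" "int t \<le> b"
      using that b_facts(2,6) b_T by (simp_all add: V_def)
    then show ?thesis unfolding S_def by (intro ready_upd s) simp_all
  qed
  have cnt: "S t a 16 = int (fst a)" "S t a 17 = int (snd a)" "S t a 18 = int t" "S t a 11 = int j" for t a
    using j by (simp_all add: S_def)
  have upd: "(S u a)(16 := x, 17 := y, 18 := z) = s(16 := x, 17 := y, 18 := z)" for u a x y z
    by (rule ext) (simp add: S_def)
  have "bigstep I b (WhilePos 18 tick_prog, S T (v, m)) (map_pmf (S 0) (iter (\<lambda>_. tick j) T (v, m)))"
  proof (rule bigstep_for[where V = V and ?k0.0 = T])
    fix t and a :: "nat \<times> nat" assume V: "V (Suc t) a" and t: "Suc t \<le> T"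
    have tb: "int t \<le> b" using t b_T by simp
    have "bigstep I b (tick_prog, S (Suc t) a)
      (map_pmf (\<lambda>(v, r). (S (Suc t) a)(16 := int v, 17 := int r, 18 := int t)) (tick j (fst a, snd a)))"
      using V by (intro bigstep_tick[OF rd[OF V t] cnt(1) _ cnt(2) _ cnt(4) j(2) cnt(3) tb]) (simp_all add: V_def)
    then show "bigstep I b (tick_prog, S (Suc t) a) (map_pmf (S t) (tick j a))"
      unfolding upd S_eq prod.collapse .
  next
    fix t a a' assume "V (Suc t) a" "Suc t \<le> T" "a' \<in> set_pmf (tick j a)"
    then show "V t a'" using tick_invariant unfolding V_def by blast
  next
    fix t and a :: "nat \<times> nat" assume "V t a" "t \<le> T"
    then show "bounded_regs b (S t a)" using ready_bounded[OF rd] by blast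
  next
    show "V T (v, m)" using v by (simp add: V_def)
  qed (simp_all add: cnt)
  then show ?thesis using S_eq[of 0] by (simp add: S_def)
qed

text \<open>Registers 15 to 18 have to be 0 beforehand because a trial leaves them at 0: the final
  state then differs from the initial one in the accumulator alone, so trials can be
  chained.\<close>

lemma bigstep_trial:
  assumes s: "ready s" and i: "s 14 = int (Suc i)" "Suc i \<le> NN"
    and acc: "\<bar>s 13\<bar> + 1 \<le> b" and j: "s 11 = int j" "int j \<le> b"
    and z: "s 15 = 0" "s 16 = 0" "s 17 = 0" "s 18 = 0"
  shows "bigstep I b (trial_prog, s) (map_pmf (\<lambda>x. s(13 := s 13 + x)) (trial j (Suc i mod n)))"
proof -
  note s' = s[unfolded ready_def]
  define v0 where "v0 = Suc i mod n"
  have v0: "v0 < n" using n_pos by (simp add: v0_def)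
  have NNb: "int (Suc i) \<le> b" using i b_sum by simp
  have q: "int (Suc i) div int n = int (Suc i div n)" by (rule zdiv_int[symmetric])
  have q1: "int (Suc i div n) \<le> b" using NNb by (meson div_le_dividend of_nat_le_iff order_trans)
  have q2: "int (Suc i div n) * int n \<le> b"
    using NNb by (metis div_times_less_eq_dividend of_nat_le_iff of_nat_mult order_trans)
  have q3: "int (Suc i) - int (Suc i div n) * int n = int v0"
    unfolding v0_def by (metis minus_div_mult_eq_mod of_nat_mult zdiv_int zmod_int)
  let ?s1 = "s(15 := int v0)"
  have r1: "ready ?s1" using v0 b_facts(2) by (intro ready_upd s) auto
  have b1: "bounded_regs b ?s1" by (rule ready_bounded[OF r1])
  let ?B = "block [check_prog Add, walk_prog, check_prog Sub]"
  let ?R = "[Const 15 0, Const 16 0, Const 17 0]"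
  let ?q = "\<lambda>(v, r). if r > 0 then return_pmf 0
     else map_pmf (\<lambda>v'. of_bool (v = v0) - of_bool (v' = v0)) (walk v)"
  have rest: "bigstep I b (block (IfPos 17 Skip ?B # ?R), ?s1(16 := int v, 17 := int r, 18 := 0))
      (map_pmf (\<lambda>x. s(13 := s 13 + x)) (?q (v, r)))" if v: "v < n" and r: "r \<le> m" for v r
  proof -
    let ?s2 = "?s1(16 := int v, 17 := int r, 18 := 0)"
    have r2: "ready ?s2" using v r b_facts(2,6) by (intro ready_upd r1) auto
    note b2 = ready_bounded[OF r2]
    show ?thesis
    proof (cases "r > 0")
      case True
      have "bigstep I b (block (IfPos 17 Skip ?B # ?R), ?s2) (return_pmf s)"
        apply (rule block_If[OF b2, where s' = ?s2])
        subgoal using True bigstep_Skip[OF b2] by simp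
        apply (intro block_Const block_Nil; assumption?)
        using z b_facts(3) by auto
      moreover have "s(13 := s 13) = s" by simp
      ultimately show ?thesis using True by simp
    next
      case False
      then have r0: "r = 0" by simp
      let ?a = "s 13 + of_bool (v = v0)"
      let ?s3 = "?s2(13 := ?a)"
      have r3: "ready ?s3" using acc by (intro ready_upd r2) auto
      have c1: "bigstep I b (check_prog Add, ?s2) (return_pmf ?s3)"
        using bigstep_check[OF r2, of v v0 Add] v v0 acc by (auto split: if_splits)
      have c2: "bigstep I b (walk_prog, ?s3) (map_pmf (\<lambda>u. ?s3(16 := int u)) (walk v))"
        by (rule bigstep_walk[OF r3]) (use v in auto)
      let ?x = "\<lambda>v'. of_bool (v = v0) - of_bool (v' = v0) :: int"
      have "bigstep I b (?B, ?s2) (map_pmf (\<lambda>v'. ?s3(16 := int v', 13 := s 13 + ?x v')) (walk v))"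
      proof (rule block_det[OF c1], rule block_map_return[OF c2])
        fix v' assume v': "v' \<in> set_pmf (walk v)"
        have vn: "v' < n" by (rule walk_less[OF v v'])
        have r4: "ready (?s3(16 := int v'))" using vn b_facts(2) by (intro ready_upd r3) auto
        have "bigstep I b (check_prog Sub, ?s3(16 := int v'))
          (return_pmf ((?s3(16 := int v'))(13 := if v' = v0 then arith_val Sub ((?s3(16 := int v')) 13) 1 else (?s3(16 := int v')) 13)))"
          by (rule bigstep_check[OF r4]) (use vn v0 acc in auto)
        moreover have "(?s3(16 := int v'))(13 := if v' = v0 then arith_val Sub ((?s3(16 := int v')) 13) 1 else (?s3(16 := int v')) 13)
          = ?s3(16 := int v', 13 := s 13 + ?x v')" by (auto simp: fun_eq_iff)
        ultimately have "bigstep I b (check_prog Sub, ?s3(16 := int v')) (return_pmf (?s3(16 := int v', 13 := s 13 + ?x v')))"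
          by simp
        then show "bigstep I b (block [check_prog Sub], ?s3(16 := int v')) (return_pmf (?s3(16 := int v', 13 := s 13 + ?x v')))"
          by (rule block_single)
      qed
      then have "bigstep I b (IfPos 17 Skip ?B, ?s2) (map_pmf (\<lambda>v'. ?s3(16 := int v', 13 := s 13 + ?x v')) (walk v))"
        by (intro bigstep_IfPos[OF b2]) (simp add: r0)
      then have "bigstep I b (block (IfPos 17 Skip ?B # ?R), ?s2) (map_pmf (\<lambda>v'. s(13 := s 13 + ?x v')) (walk v))"
      proof (rule block_map_return)
        fix v' assume bb: "bounded_regs b (?s3(16 := int v', 13 := s 13 + ?x v'))"
        show "bigstep I b (block ?R, ?s3(16 := int v', 13 := s 13 + ?x v')) (return_pmf (s(13 := s 13 + ?x v')))"
          apply (intro block_Const block_Nil bb; assumption?)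
          using z r0 b_facts(3) by auto
      qed
      then show ?thesis using r0 by (simp add: pmf.map_comp comp_def)
    qed
  qed
  have tk: "bigstep I b (WhilePos 18 tick_prog, ?s1(16 := int v0, 17 := int m, 18 := int T))
     (map_pmf (\<lambda>(v, r). ?s1(16 := int v, 17 := int r, 18 := 0)) (iter (\<lambda>_. tick j) T (v0, m)))"
    by (rule bigstep_ticks[OF r1 v0]) (use j in auto)
  let ?W = "WhilePos 18 tick_prog # IfPos 17 Skip ?B # ?R"
  have main: "bigstep I b (block ?W, ?s1(16 := int v0, 17 := int m, 18 := int T))
    (bind_pmf (iter (\<lambda>_. tick j) T (v0, m)) (\<lambda>a. map_pmf (\<lambda>x. s(13 := s 13 + x)) (?q a)))"
  proof (rule block_map[OF tk])
    fix a assume a: "a \<in> set_pmf (iter (\<lambda>_. tick j) T (v0, m))"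
    obtain v r where vr: "a = (v, r)" by (cases a)
    have "v < n" "r \<le> m" using iter_tick_invariant[OF v0 order_refl a] vr by auto
    from rest[OF this] show "bigstep I b (block (IfPos 17 Skip ?B # ?R),
        case a of (v, r) \<Rightarrow> ?s1(16 := int v, 17 := int r, 18 := 0)) (map_pmf (\<lambda>x. s(13 := s 13 + x)) (?q a))"
      unfolding vr prod.case .
  qed
  have eq: "bind_pmf (iter (\<lambda>_. tick j) T (v0, m)) (\<lambda>a. map_pmf (\<lambda>x. s(13 := s 13 + x)) (?q a)) =
    map_pmf (\<lambda>x. s(13 := s 13 + x)) (trial j (Suc i mod n))"
    unfolding trial_def map_bind_pmf v0_def[symmetric] ..
  show ?thesis
    unfolding trial_prog_def
    apply (rule block_Arith[where v = "int (Suc i div n)", OF ready_bounded[OF s]])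
    subgoal using i s' q by simp
    subgoal using q1 by simp
    apply (rule block_Arith[where v = "int (Suc i div n) * int n"], assumption)
    subgoal using s' by simp
    subgoal using q2 by simp
    apply (rule block_Arith[where v = "int v0"], assumption)
    subgoal using q3 i by simp
    subgoal using v0 b_facts(2) by simp
    apply (rule block_det[OF bigstep_copy], assumption)
    subgoal using s' by simp
    apply (rule block_det[OF bigstep_copy], assumption)
    subgoal using s' by simp
    apply (rule block_det[OF bigstep_copy], assumption)
    subgoal using s' by simp
    subgoal
      apply (rule back_subst[where P = "\<lambda>t. bigstep I b (block ?W, t) _", OF main[unfolded eq]])
      using s' by (auto simp: fun_eq_iff)
    done
qed

lemma set_pmf_trial:
  assumes "x \<in> set_pmf (trial j v0)"
  shows "\<bar>x\<bar> \<le> 1"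
proof -
  let ?q = "\<lambda>(v, r). if r > 0 then return_pmf 0
      else map_pmf (\<lambda>v'. of_bool (v = v0) - of_bool (v' = v0)) (walk v)"
  have q: "\<bar>x\<bar> \<le> 1" if "x \<in> set_pmf (?q vr)" for vr :: "nat \<times> nat"
    using that by (cases vr) (auto split: if_splits)
  show ?thesis using assms unfolding trial_def set_bind_pmf by (elim UN_E) (rule q)
qed

lemma bigstep_total:
  assumes s: "ready s" and j: "s 11 = int j" "int j \<le> b"
    and z: "s 13 = 0" "s 15 = 0" "s 16 = 0" "s 17 = 0" "s 18 = 0"
  shows "bigstep I b (WhilePos 14 (block [trial_prog, Arith Sub 14 14 2]), s(14 := int NN))
    (map_pmf (\<lambda>acc. s(13 := acc, 14 := 0)) (total j))"
proof -
  define S where "S i acc = s(13 := acc, 14 := int i)" for i :: nat and acc :: int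
  \<comment> \<open>Each trial changes the accumulator by at most 1, so the loop counter bounds how
    far it can still move.\<close>
  define V where "V i acc \<longleftrightarrow> \<bar>acc\<bar> + int i \<le> int NN" for i and acc :: int
  let ?f = "\<lambda>i acc. map_pmf (\<lambda>x. acc + x) (trial j (Suc i mod n))"
  have rd: "ready (S i acc)" if "V i acc" "i \<le> NN" for i acc
    unfolding S_def using that b_sum by (intro ready_upd s) (auto simp: V_def)
  have "bigstep I b (WhilePos 14 (block [trial_prog, Arith Sub 14 14 2]), S NN 0)
     (map_pmf (S 0) (iter ?f NN 0))"
  proof (rule bigstep_for[where V = V and ?k0.0 = NN])
    fix i acc assume V: "V (Suc i) acc" and i: "Suc i \<le> NN"
    let ?s = "S (Suc i) acc"
    have tr: "bigstep I b (trial_prog, ?s) (map_pmf (\<lambda>x. ?s(13 := ?s 13 + x)) (trial j (Suc i mod n)))"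
      by (rule bigstep_trial[OF rd[OF V i] _ i]) (use V i b_sum j z in \<open>auto simp: S_def V_def\<close>)
    show "bigstep I b (block [trial_prog, Arith Sub 14 14 2], ?s) (map_pmf (S i) (?f i acc))"
      unfolding pmf.map_comp
    proof (rule block_map_return[OF tr])
      fix x assume bb: "bounded_regs b (?s(13 := ?s 13 + x))"
      show "bigstep I b (block [Arith Sub 14 14 2], ?s(13 := ?s 13 + x)) (return_pmf ((S i \<circ> (\<lambda>x. acc + x)) x))"
        apply (intro block_Arith[OF bb refl] block_Nil; assumption?)
        using i b_sum s[unfolded ready_def] by (auto simp: S_def)
    qed
  next
    fix i acc acc' assume "V (Suc i) acc" "acc' \<in> set_pmf (?f i acc)"
    then show "V i acc'" using set_pmf_trial by (fastforce simp: V_def)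
  next
    fix i acc assume "V i acc" "i \<le> NN"
    then show "bounded_regs b (S i acc)" using ready_bounded[OF rd] by blast
  qed (auto simp: S_def V_def)
  moreover have "S NN 0 = s(14 := int NN)" using z by (auto simp: S_def fun_eq_iff)
  moreover have "S 0 = (\<lambda>acc. s(13 := acc, 14 := 0))" by (rule ext) (simp add: S_def)
  ultimately show ?thesis by (simp add: total_def)
qed

lemma set_pmf_total:
  assumes "acc \<in> set_pmf (total j)"
  shows "\<bar>acc\<bar> \<le> int NN"
proof -
  have "\<bar>a'\<bar> + int k \<le> int NN" if "\<bar>a\<bar> + int (Suc k) \<le> int NN"
    "a' \<in> set_pmf (map_pmf (\<lambda>x. a + x) (trial j (Suc k mod n)))" for k a a'
    using that set_pmf_trial by fastforce
  from iter_invariant[where V = "\<lambda>k a. \<bar>a\<bar> + int k \<le> int NN", OF this _ assms[unfolded total_def]]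
  show ?thesis by simp
qed

lemma bigstep_main:
  assumes s: "ready s" and z: "\<And>x. 11 \<le> x \<Longrightarrow> s x = 0"
  shows "bigstep I b (main_prog, s) (map_pmf (\<lambda>c. s(0 := c, 1 := 2 ^ m - c, 12 := c)) (counting (2 ^ m - 1)))"
proof -
  define k0 :: nat where "k0 = 2 ^ m - 1"
  have k0: "int k0 = 2 ^ m - 1" "int k0 < b" using b_facts(4) by (simp_all add: k0_def of_nat_diff)
  note s' = s[unfolded ready_def]
  define S where "S j c = s(11 := int j, 12 := c)" for j :: nat and c :: int
  \<comment> \<open>At j = 0 this gives c \<le> 2 ^ m - 1, so the denominator 2 ^ m - c of the
    output is positive.\<close>
  define V where "V j c \<longleftrightarrow> 0 \<le> c \<and> c + int j \<le> int k0" for j and c :: int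
  let ?f = "\<lambda>j c. map_pmf (\<lambda>acc. c + of_bool (acc \<le> int thr)) (total (Suc j))"
  let ?T = "WhilePos 14 (block [trial_prog, Arith Sub 14 14 2])"
  let ?P = "block [copy 14 10, ?T, Arith Sub 13 13 9, IfPos 13 Skip (Arith Add 12 12 2), Const 13 0, Arith Sub 11 11 2]"
  have rd: "ready (S j c)" if "V j c" "j \<le> k0" for j c
    unfolding S_def using that k0 by (intro ready_upd s) (auto simp: V_def)
  have loop: "bigstep I b (WhilePos 11 ?P, S k0 0) (map_pmf (S 0) (iter ?f k0 0))"
  proof (rule bigstep_for[where V = V and ?k0.0 = k0])
    fix j c assume V: "V (Suc j) c" and j: "Suc j \<le> k0"
    let ?s = "S (Suc j) c"
    note r = rd[OF V j]
    have tt: "bigstep I b (?T, ?s(14 := int NN)) (map_pmf (\<lambda>acc. ?s(13 := acc, 14 := 0)) (total (Suc j)))"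
      by (rule bigstep_total[OF r]) (use z j k0 in \<open>auto simp: S_def\<close>)
    show "bigstep I b (?P, ?s) (map_pmf (S j) (?f j c))"
      unfolding pmf.map_comp
      apply (rule block_det[OF bigstep_copy[OF ready_bounded[OF r]]])
      subgoal using s' by (simp add: S_def)
      apply (rule block_map_return)
       apply (rule back_subst[where P = "\<lambda>t. bigstep I b (?T, t) _", OF tt])
      subgoal using s' by (simp add: S_def)
      subgoal premises prems for acc
      proof -
        have a: "\<bar>acc\<bar> \<le> int NN" using set_pmf_total[OF prems(2)] .
        let ?s2 = "?s(13 := acc - int thr, 14 := 0)"
        have d: "\<bar>acc - int thr\<bar> \<le> b" using a b_sum by simp
        have r2: "ready ?s2" using d b_facts(3) by (intro ready_upd r) auto
        note b2 = ready_bounded[OF r2]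
        let ?s3 = "?s2(12 := c + of_bool (acc \<le> int thr))"
        have fin: "bigstep I b (if 0 < ?s2 13 then Skip else Arith Add 12 12 2, ?s2) (return_pmf ?s3)"
        proof (cases "acc \<le> int thr")
          case True
          have "bigstep I b (Arith Add 12 12 2, ?s2) (return_pmf (?s2(12 := arith_val Add (?s2 12) (?s2 2))))"
            by (rule bigstep_Arith[OF b2]) (use V k0 s' in \<open>auto simp: S_def V_def\<close>)
          then show ?thesis using True s' by (simp add: S_def)
        next
          case False
          have "?s3 = ?s2" using False by (auto simp: fun_eq_iff S_def)
          then show ?thesis using False bigstep_Skip[OF b2] by simp
        qed
        show ?thesis
          apply (rule block_Arith[where v = "acc - int thr", OF prems(3)])
          subgoal using s' by (simp add: S_def)
          subgoal by (rule d)
          apply (rule block_det[where s' = ?s3])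
           apply (rule back_subst[where P = "\<lambda>t. bigstep I b (IfPos 13 Skip (Arith Add 12 12 2), t) _", OF bigstep_IfPos[OF b2 fin]])
          subgoal by (auto simp: fun_eq_iff)
          apply (intro block_Const block_Arith[OF _ refl] block_Nil; assumption?)
          using j k0 s' z b_facts(3) by (auto simp: S_def)
      qed
      done
  next
    fix j c c' assume "V (Suc j) c" "c' \<in> set_pmf (?f j c)"
    then show "V j c'" by (auto simp: V_def split: if_splits)
  next
    fix j c assume "V j c" "j \<le> k0"
    then show "bounded_regs b (S j c)" using ready_bounded[OF rd] by blast
  qed (auto simp: S_def V_def)
  have cnt: "0 \<le> c \<and> c \<le> int k0" if "c \<in> set_pmf (iter ?f k0 0)" for c
  proof -
    have "0 \<le> c' \<and> c' + int j \<le> int k0" if "0 \<le> c \<and> c + int (Suc j) \<le> int k0" "c' \<in> set_pmf (?f j c)" for j c c'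
      using that by auto
    from iter_invariant[where V = "\<lambda>j c. 0 \<le> c \<and> c + int j \<le> int k0", OF this _ that]
    show ?thesis by simp
  qed
  have "s(11 := int k0) = S k0 0" using z by (auto simp: S_def fun_eq_iff)
  then have loop': "bigstep I b (WhilePos 11 ?P, s(11 := int k0)) (map_pmf (S 0) (counting k0))"
    using loop by (simp add: counting_def)
  show ?thesis
    unfolding main_prog_def k0_def[symmetric]
    apply (rule block_Arith[where v = "int k0", OF ready_bounded[OF s]])
    subgoal using s' k0 by simp
    subgoal using k0 by simp
    apply (rule block_map_return[OF loop'])
    subgoal premises prems for c
      apply (rule block_det[OF bigstep_copy[OF prems(3)]])
      subgoal using s' by (simp add: S_def)
      apply (intro block_Arith[OF _ refl] block_Nil; assumption?)
      using cnt[of c] prems(2) k0 b_facts(4) s' z by (auto simp: S_def counting_def)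
    done
qed

end

section \<open>Computing the parameters\<close>

definition find_prog :: "prog \<Rightarrow> reg \<Rightarrow> prog" where
  "find_prog rd x = block [Const 26 1, WhilePos 26 (block [Arith Sub x x 2, rd, Arith Sub 26 2 26])]"

definition pow_prog :: "reg \<Rightarrow> reg \<Rightarrow> prog" where
  "pow_prog x y = block [Const y 1, copy 24 x, WhilePos 24 (block [Arith Add y y y, Arith Sub 24 24 2])]"

definition log_prog :: prog where
  "log_prog = block [Const 22 1, Arith Sub 26 0 22,
     WhilePos 26 (block [Arith Add 22 22 22, Arith Add 23 23 2, Arith Sub 26 0 22]), Const 26 0]"

text \<open>
  Registers 19 to 23 receive \<open>k\<close>, \<open>2 ^ k\<close>, \<open>g\<close>, \<open>2 ^ l\<close> and \<open>l\<close>, where \<open>k\<close>, \<open>g\<close> and \<open>l\<close> are the least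
  numbers with \<open>1 \<le> \<delta> * 2 ^ k\<close>, \<open>1 \<le> \<gamma> * 2 ^ g\<close> and \<open>n \<le> 2 ^ l\<close>. The number of rounds is
  \<open>m = a * 2 ^ k * l\<close>.
\<close>

definition parameter_prog :: "nat \<Rightarrow> prog" where
  "parameter_prog a = block [Const 2 1,
     find_prog (ReadDelta 26 19) 19, Arith Sub 19 28 19, pow_prog 19 20,
     find_prog (ReadGamma 26 21) 21, Arith Sub 21 28 21, log_prog,
     Const 3 (int a), Arith Mul 3 3 20, Arith Mul 3 3 23, pow_prog 3 4,
     Const 5 5, Arith Mul 5 5 3, Arith Add 6 5 5, pow_prog 6 7,
     Arith Mul 8 4 4, Arith Mul 9 4 8, Arith Mul 9 9 21, Arith Mul 10 9 4, Arith Mul 10 10 0,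
     Const 19 0, Const 20 0, Const 21 0, Const 22 0, Const 23 0]"

lemma bigstep_While_return:
  assumes "bounded_regs b s" "s x > 0" "bigstep I b (P, s) (return_pmf s')"
    "bigstep I b (WhilePos x P, s') \<mu>"
  shows "bigstep I b (WhilePos x P, s) \<mu>"
  using bigstep_While_continue[where p = "return_pmf ()" and g = "\<lambda>_. s'" and \<nu> = "\<lambda>_. \<mu>"] assms
  by (simp add: bind_return_pmf)

text \<open>The integer part of a * 2 ^ i is 0 for i < k and 1 for i = k, so the first digit 1 after
  the binary point stands at place - k. The position is decremented before a digit is read, which
  fits k > 0.\<close>

lemma bigstep_find:
  assumes s: "bounded_regs b s" "s 2 = 1" "s 26 = 0" "s x = 0" and x: "x \<noteq> 2" "x \<noteq> 26"
    and rd: "\<And>t. bounded_regs b t \<Longrightarrow> bigstep I b (rd, t) (return_pmf (t(26 := digit a (t x))))"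
    and a: "0 < a" "\<And>i. i < k \<Longrightarrow> a * 2 ^ i < 1" "1 \<le> a * 2 ^ k" "a * 2 ^ k < 2"
    and k: "0 < k" "int k \<le> b"
  shows "bigstep I b (find_prog rd x, s) (return_pmf (s(x := - int k)))"
proof -
  let ?P = "block [Arith Sub x x 2, rd, Arith Sub 26 2 26]"
  define S where "S i = s(x := - int i, 26 := of_bool (i < k))" for i
  have b1: "1 \<le> b" using k by simp
  have dig: "digit a (- int i) = of_bool (i = k)" if "i \<le> k" for i
  proof (cases "i = k")
    case True
    then have "\<lfloor>a * 2 ^ i\<rfloor> = 1" using a(3,4) by (simp add: floor_eq_iff)
    then show ?thesis using True by (simp add: digit_def)
  next
    case False
    then have "\<lfloor>a * 2 ^ i\<rfloor> = 0" using a(1) a(2)[of i] that by (simp add: floor_eq_iff)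
    then show ?thesis using False by (simp add: digit_def)
  qed
  have bnd: "bounded_regs b (S i)" if "i \<le> k" for i
    unfolding S_def using that k b1 by (intro bounded_regs_upd s) (simp_all add: of_bool_def)
  have body: "bigstep I b (?P, S i) (return_pmf (S (Suc i)))" if i: "i < k" for i
  proof -
    let ?t = "s(x := - int (Suc i), 26 := 1)"
    have t: "bounded_regs b ?t" using i k b1 by (intro bounded_regs_upd s) simp_all
    have rd': "bigstep I b (rd, ?t) (return_pmf (?t(26 := of_bool (Suc i = k))))"
      using rd[OF t] dig[of "Suc i"] i x by simp
    show ?thesis
      apply (rule block_Arith[where v = "- int (Suc i)", OF bnd])
      subgoal using i by simp
      subgoal using x s by (simp add: S_def)
      subgoal using i k by simp
      apply (rule block_det)
       apply (rule back_subst[where P = "\<lambda>t. bigstep I b (rd, t) _", OF rd'])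
      subgoal using i x by (auto simp: S_def fun_eq_iff)
      apply (rule block_Arith[where v = "of_bool (Suc i < k)"], assumption)
      subgoal using i x s by (simp add: of_bool_def)
      subgoal using b1 by (simp add: of_bool_def)
      apply (rule block_Nil, assumption)
      by (auto simp: S_def)
  qed
  have loop: "bigstep I b (WhilePos 26 ?P, S i) (return_pmf (S k))" if "i \<le> k" for i
    using that
  proof (induction rule: inc_induct)
    case base
    show ?case by (rule bigstep_While_stop[OF bnd]) (simp_all add: S_def)
  next
    case (step i)
    show ?case
      by (rule bigstep_While_return[OF bnd _ body[OF step.hyps(2)] step.IH]) (use step.hyps in \<open>simp_all add: S_def\<close>)
  qed
  have e1: "s(26 := 1) = S 0" using s k x by (auto simp: S_def fun_eq_iff)
  have e2: "S k = s(x := - int k)" using s x by (auto simp: S_def fun_eq_iff)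
  show ?thesis
    unfolding find_prog_def
    apply (rule block_Const[OF s(1)])
    subgoal using b1 by simp
    unfolding e1
    apply (rule block_single)
    using loop[of 0] unfolding e2 by simp
qed

lemma bigstep_pow:
  assumes s: "bounded_regs b s" "s 2 = 1" "s 28 = 0" "s 24 = 0" and xy: "y \<noteq> 2" "y \<noteq> 24" "y \<noteq> 28" "x \<noteq> y"
    and k: "s x = int k" "(2::int) ^ k \<le> b"
  shows "bigstep I b (pow_prog x y, s) (return_pmf (s(y := 2 ^ k)))"
proof -
  let ?P = "block [Arith Add y y y, Arith Sub 24 24 2]"
  define S where "S i u = s(24 := int i, y := 2 ^ (k - i))" for i and u :: unit
  have kb: "int k \<le> b" using k(2) by (smt (verit) of_nat_less_two_power)
  have le: "(2::int) ^ (k - i) \<le> b" for i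
    by (rule order_trans[OF power_increasing k(2)]) auto
  have b1: "1 \<le> b" using le[of k] by simp
  have bnd: "bounded_regs b (S i u)" if "i \<le> k" for i u
    unfolding S_def using that kb le by (intro bounded_regs_upd s) simp_all
  have cnt: "S i u 24 = int i" for i u using xy by (simp add: S_def)
  have "bigstep I b (WhilePos 24 ?P, S k ()) (map_pmf (S 0) (iter (\<lambda>_ _. return_pmf ()) k ()))"
  proof (rule bigstep_for[where V = "\<lambda>_ _. True" and ?k0.0 = k])
    fix i and u :: unit assume i: "Suc i \<le> k"
    have e: "(2::int) ^ (k - i) = 2 ^ (k - Suc i) + 2 ^ (k - Suc i)"
      using i by (metis Suc_diff_le diff_Suc_Suc mult_2 power_Suc)
    have "bigstep I b (?P, S (Suc i) u) (return_pmf (S i ()))"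
      apply (rule block_Arith[where v = "2 ^ (k - i)", OF bnd[OF i]])
      subgoal using e by (simp add: S_def)
      subgoal using le by simp
      apply (rule block_Arith[where v = "int i"], assumption)
      subgoal using xy s by (simp add: S_def)
      subgoal using i kb by simp
      apply (rule block_Nil, assumption)
      using xy by (simp add: S_def)
    then show "bigstep I b (?P, S (Suc i) u) (map_pmf (S i) (return_pmf ()))" by simp
  qed (use bnd cnt in auto)
  moreover have "iter (\<lambda>_ _. return_pmf ()) k () = return_pmf ()" for k
    by (induction k) (auto simp: bind_return_pmf)
  moreover have "S 0 () = s(y := 2 ^ k)" using s xy by (auto simp: S_def fun_eq_iff)
  moreover have "s(y := 1, 24 := int k) = S k ()" using xy by (auto simp: S_def fun_eq_iff)
  ultimately have *: "bigstep I b (WhilePos 24 ?P, s(y := 1, 24 := int k)) (return_pmf (s(y := 2 ^ k)))"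
    by simp
  show ?thesis
    unfolding pow_prog_def
    apply (rule block_Const[OF s(1)])
    subgoal using b1 by simp
    apply (rule block_det[OF bigstep_copy], assumption)
    subgoal using s xy by simp
    apply (rule block_single)
    using * xy k(1) by simp
qed

lemma bigstep_log:
  assumes s: "bounded_regs b s" "s 0 = int n" "s 2 = 1" "s 23 = 0" "s 26 = 0"
    and l: "\<And>i. i < l \<Longrightarrow> 2 ^ i < n" "n \<le> 2 ^ l" "(2::int) ^ l \<le> b"
  shows "bigstep I b (log_prog, s) (return_pmf (s(22 := 2 ^ l, 23 := int l)))"
proof -
  let ?P = "block [Arith Add 22 22 22, Arith Add 23 23 2, Arith Sub 26 0 22]"
  define S where "S i = s(22 := 2 ^ i, 23 := int i, 26 := int n - 2 ^ i)" for i
  have nb: "int n \<le> 2 ^ l" using l(2) by (metis of_nat_le_iff of_nat_numeral of_nat_power)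
  have lb: "int l \<le> b" using l(3) by (smt (verit) of_nat_less_two_power)
  have le: "(2::int) ^ i \<le> b" if "i \<le> l" for i
    by (rule order_trans[OF power_increasing l(3)]) (use that in auto)
  have ge: "(1::int) \<le> 2 ^ i" for i by simp
  have d: "\<bar>int n - 2 ^ i\<bar> \<le> b" if "i \<le> l" for i
    using le[OF that] ge[of i] nb l(3) by linarith
  have b1: "1 \<le> b" using le[of 0] by simp
  have bnd: "bounded_regs b (S i)" if "i \<le> l" for i
    unfolding S_def using that lb le d by (intro bounded_regs_upd s) simp_all
  have body: "bigstep I b (?P, S i) (return_pmf (S (Suc i)))" if i: "i < l" for i
    apply (rule block_Arith[where v = "2 ^ Suc i", OF bnd])
    subgoal using i by simp
    subgoal by (simp add: S_def)
    subgoal using le[of "Suc i"] i by simp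
    apply (rule block_Arith[where v = "int (Suc i)"], assumption)
    subgoal using s by (simp add: S_def)
    subgoal using i lb by simp
    apply (rule block_Arith[where v = "int n - 2 ^ Suc i"], assumption)
    subgoal using s by (simp add: S_def)
    subgoal using d[of "Suc i"] i by simp
    apply (rule block_Nil, assumption)
    by (simp add: S_def)
  have loop: "bigstep I b (WhilePos 26 ?P, S i) (return_pmf (S l))" if "i \<le> l" for i
    using that
  proof (induction rule: inc_induct)
    case base
    show ?case by (rule bigstep_While_stop[OF bnd]) (use nb in \<open>simp_all add: S_def\<close>)
  next
    case (step i)
    have "int (2 ^ i) < int n" using l(1)[OF step.hyps(2)] by (simp only: of_nat_less_iff)
    then show ?case
      by (intro bigstep_While_return[OF bnd _ body[OF step.hyps(2)] step.IH]) (use step.hyps in \<open>simp_all add: S_def\<close>)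
  qed
  have e1: "s(22 := 1, 26 := int n - 1) = S 0" using s by (auto simp: S_def fun_eq_iff)
  show ?thesis
    unfolding log_prog_def
    apply (rule block_Const[OF s(1)])
    subgoal using b1 by simp
    apply (rule block_Arith[where v = "int n - 1"], assumption)
    subgoal using s by simp
    subgoal using d[of 0] by simp
    unfolding e1
    apply (rule block_det[OF loop])
    subgoal by simp
    apply (rule block_Const, assumption)
    subgoal using b1 by simp
    apply (rule block_Nil, assumption)
    using s by (simp add: S_def)
qed

text \<open>The bounds in terms of \<open>b\<close> belong to the values the registers take on the
  way. With Z = 2 ^ m, the outcome is M = 5 * m, Z ^ 2 ticks, threshold Z ^ 3 * g and Z ^ 4 * g
  trials per start vertex: the threshold corresponds to a trace of 1 / Z.\<close>

lemma bigstep_parameter: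
  assumes I: "size_in I = n" "delta_in I = \<delta>" "gamma_in I = \<gamma>"
    and k: "0 < \<delta>" "\<And>i. i < k \<Longrightarrow> \<delta> * 2 ^ i < 1" "1 \<le> \<delta> * 2 ^ k" "\<delta> * 2 ^ k < 2" "0 < k"
    and g: "0 < \<gamma>" "\<And>i. i < g \<Longrightarrow> \<gamma> * 2 ^ i < 1" "1 \<le> \<gamma> * 2 ^ g" "\<gamma> * 2 ^ g < 2" "0 < g"
    and l: "\<And>i. i < l \<Longrightarrow> 2 ^ i < n" "n \<le> 2 ^ l"
    and m: "m = a * 2 ^ k * l"
    and b: "int g \<le> b" "(2::int) ^ k \<le> b" "(2::int) ^ l \<le> b" "int a \<le> b" "int (a * 2 ^ k) \<le> b"
      "5 \<le> b" "(2::int) ^ (10 * m) \<le> b" "int (2 ^ m * (2 ^ m * 2 ^ m)) \<le> b"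
      "int (2 ^ m * (2 ^ m * 2 ^ m) * g) \<le> b" "int (2 ^ m * (2 ^ m * 2 ^ m) * g * 2 ^ m) \<le> b"
      "int (2 ^ m * (2 ^ m * 2 ^ m) * g * 2 ^ m * n) \<le> b"
  shows "bigstep I b (parameter_prog a, init I) (return_pmf ((\<lambda>_. 0)
    (0 := int n, 2 := 1, 3 := int m, 4 := 2 ^ m, 5 := int (5 * m), 6 := int (10 * m), 7 := 2 ^ (10 * m),
     8 := int (2 ^ m * 2 ^ m), 9 := int (2 ^ m * (2 ^ m * 2 ^ m) * g),
     10 := int (2 ^ m * (2 ^ m * 2 ^ m) * g * 2 ^ m * n))))"
proof -
  have nb: "int n \<le> b" using l(2) b(3) by (metis of_nat_le_iff of_nat_numeral of_nat_power order_trans)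
  have kb: "int k \<le> b" using b(2) by (smt (verit) of_nat_less_two_power)
  have mb: "int (10 * m) \<le> b" using b(7) by (metis less_imp_le of_nat_less_two_power of_nat_numeral of_nat_power order_trans)
  have zb: "(2::int) ^ m \<le> b"
    by (rule order_trans[OF power_increasing b(7)]) auto
  have z2: "(2::int) ^ m * 2 ^ m \<le> b"
  proof -
    have "(2::int) ^ m * 2 ^ m = 2 ^ (2 * m)" by (simp add: power_add mult_2)
    also have "\<dots> \<le> 2 ^ (10 * m)" by (rule power_increasing) auto
    finally show ?thesis using b(7) by (rule order_trans)
  qed
  have i0: "bounded_regs b (init I)" using nb b(6) by (auto simp: bounded_regs_def init_def I)
  note R = bigstep_ReadDelta[of b _ I 26 19, unfolded I] bigstep_ReadGamma[of b _ I 26 21, unfolded I]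
  have b1: "1 \<le> b" using b(6) by simp
  let ?z = "(\<lambda>_. 0) :: state"
  have i: "init I = ?z(0 := int n)" by (simp add: init_def I)
  show ?thesis
    unfolding parameter_prog_def i
    apply (rule block_Const[OF i0[unfolded i]])
    subgoal using b1 by simp
    apply (rule block_det[OF bigstep_find[where a = \<delta> and k = k]], assumption)
    subgoal by simp
    subgoal by simp
    subgoal by simp
    subgoal by simp
    subgoal by simp
    subgoal using R(1) b1 by blast
    subgoal by (rule k)
    subgoal by (rule k)
    subgoal by (rule k)
    subgoal by (rule k)
    subgoal by (rule k)
    subgoal by (rule kb)
    apply (rule block_Arith[where v = "int k"], assumption)
    subgoal by simp
    subgoal using kb by simp
    apply (rule block_det[OF bigstep_pow[where k = k]], assumption)
    subgoal by simp
    subgoal by simp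
    subgoal by simp
    subgoal by simp
    subgoal by simp
    subgoal by simp
    subgoal by simp
    subgoal by simp
    subgoal by (rule b)
    apply (rule block_det[OF bigstep_find[where a = \<gamma> and k = g]], assumption)
    subgoal by simp
    subgoal by simp
    subgoal by simp
    subgoal by simp
    subgoal by simp
    subgoal using R(2) b1 by blast
    subgoal by (rule g)
    subgoal by (rule g)
    subgoal by (rule g)
    subgoal by (rule g)
    subgoal by (rule g)
    subgoal by (rule b)
    apply (rule block_Arith[where v = "int g"], assumption)
    subgoal by simp
    subgoal using b(1) by simp
    apply (rule block_det[OF bigstep_log[where n = n and l = l]], assumption)
    subgoal by simp
    subgoal by simp
    subgoal by simp
    subgoal by simp
    subgoal by (rule l)
    subgoal by (rule l)
    subgoal by (rule b)
    apply (rule block_Const, assumption)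
    subgoal using b(4) by simp
    apply (rule block_Arith[where v = "int (a * 2 ^ k)"], assumption)
    subgoal by simp
    subgoal using b(5) by simp
    apply (rule block_Arith[where v = "int m"], assumption)
    subgoal by (simp add: m)
    subgoal using mb by simp
    apply (rule block_det[OF bigstep_pow[where k = m]], assumption)
    subgoal by simp
    subgoal by simp
    subgoal by simp
    subgoal by simp
    subgoal by simp
    subgoal by simp
    subgoal by simp
    subgoal by simp
    subgoal by (rule zb)
    apply (rule block_Const, assumption)
    subgoal using b(6) by simp
    apply (rule block_Arith[where v = "int (5 * m)"], assumption)
    subgoal by simp
    subgoal using mb by simp
    apply (rule block_Arith[where v = "int (10 * m)"], assumption)
    subgoal by simp
    subgoal using mb by simp
    apply (rule block_det[OF bigstep_pow[where k = "10 * m"]], assumption)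
    subgoal by simp
    subgoal by simp
    subgoal by simp
    subgoal by simp
    subgoal by simp
    subgoal by simp
    subgoal by simp
    subgoal by simp
    subgoal by (rule b)
    apply (rule block_Arith[where v = "int (2 ^ m * 2 ^ m)"], assumption)
    subgoal by simp
    subgoal using z2 by simp
    apply (rule block_Arith[where v = "int (2 ^ m * (2 ^ m * 2 ^ m))"], assumption)
    subgoal by simp
    subgoal using b(8) by simp
    apply (rule block_Arith[where v = "int (2 ^ m * (2 ^ m * 2 ^ m) * g)"], assumption)
    subgoal by simp
    subgoal using b(9) by simp
    apply (rule block_Arith[where v = "int (2 ^ m * (2 ^ m * 2 ^ m) * g * 2 ^ m)"], assumption)
    subgoal by simp
    subgoal using b(10) by simp
    apply (rule block_Arith[where v = "int (2 ^ m * (2 ^ m * 2 ^ m) * g * 2 ^ m * n)"], assumption)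
    subgoal by simp
    subgoal using b(11) by simp
    apply (intro block_Const block_Nil; assumption?)
    using b1 by simp_all
qed

section \<open>Traces and real eigenvalues\<close>

definition trace :: "'a::comm_ring_1 mat \<Rightarrow> 'a" where
  "trace A = (\<Sum>i<dim_row A. A $$ (i, i))"

lemma trace_mult_commute:
  assumes "A \<in> carrier_mat n n" "B \<in> carrier_mat n n"
  shows "trace (A * B) = trace (B * A)"
proof -
  have "trace (A * B) = (\<Sum>i<n. \<Sum>j<n. A $$ (i, j) * B $$ (j, i))"
    using assms by (simp add: trace_def scalar_prod_def atLeast0LessThan)
  also have "\<dots> = (\<Sum>j<n. \<Sum>i<n. B $$ (j, i) * A $$ (i, j))"
    by (subst sum.swap) (simp add: mult.commute)
  also have "\<dots> = trace (B * A)"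
    using assms by (simp add: trace_def scalar_prod_def atLeast0LessThan)
  finally show ?thesis .
qed

text \<open>The Hermitian form of \<open>A\<close> at an eigenvector equals \<open>e\<close> times
  the squared norm, and symmetry makes it its own conjugate.\<close>

lemma real_symmetric_eigenvalue_real:
  fixes A :: "real mat" and e :: complex
  assumes A: "A \<in> carrier_mat n n" and sym: "\<And>i j. i < n \<Longrightarrow> j < n \<Longrightarrow> A $$ (i, j) = A $$ (j, i)"
    and ev: "eigenvalue (map_mat of_real A) e"
  shows "Im e = 0"
proof -
  let ?C = "map_mat of_real A :: complex mat"
  obtain z where z: "z \<in> carrier_vec n" "z \<noteq> 0\<^sub>v n" "?C *\<^sub>v z = e \<cdot>\<^sub>v z"
    using ev A unfolding eigenvalue_def eigenvector_def by auto
  have row: "(\<Sum>j<n. of_real (A $$ (i, j)) * z $ j) = e * z $ i" if "i < n" for i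
  proof -
    have "(?C *\<^sub>v z) $ i = (e \<cdot>\<^sub>v z) $ i" using z(3) by simp
    then show ?thesis
      using that A z(1) by (simp add: scalar_prod_def atLeast0LessThan)
  qed
  define X where "X = (\<Sum>i<n. \<Sum>j<n. cnj (z $ i) * of_real (A $$ (i, j)) * z $ j)"
  define N where "N = (\<Sum>i<n. (cmod (z $ i))\<^sup>2)"
  have X1: "X = e * of_real N"
  proof -
    have "X = (\<Sum>i<n. cnj (z $ i) * (\<Sum>j<n. of_real (A $$ (i, j)) * z $ j))"
      by (simp add: X_def sum_distrib_left mult.assoc)
    also have "\<dots> = (\<Sum>i<n. e * of_real ((cmod (z $ i))\<^sup>2))"
    proof (intro sum.cong refl)
      fix i assume "i \<in> {..<n}"
      then have "cnj (z $ i) * (\<Sum>j<n. of_real (A $$ (i, j)) * z $ j) = cnj (z $ i) * (e * z $ i)"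
        using row by simp
      also have "\<dots> = e * (z $ i * cnj (z $ i))" by (simp add: mult_ac)
      finally show "cnj (z $ i) * (\<Sum>j<n. of_real (A $$ (i, j)) * z $ j) = e * of_real ((cmod (z $ i))\<^sup>2)"
        by (simp only: complex_norm_square)
    qed
    finally show ?thesis by (simp add: N_def sum_distrib_left)
  qed
  have X2: "cnj X = X"
  proof -
    have "cnj X = (\<Sum>i<n. \<Sum>j<n. z $ i * of_real (A $$ (i, j)) * cnj (z $ j))"
      by (simp add: X_def)
    also have "\<dots> = (\<Sum>j<n. \<Sum>i<n. z $ i * of_real (A $$ (i, j)) * cnj (z $ j))"
      by (rule sum.swap)
    also have "\<dots> = X"
      unfolding X_def by (intro sum.cong refl) (simp add: sym mult_ac)
    finally show ?thesis .
  qed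
  obtain k where k: "k < n" "z $ k \<noteq> 0" using z(1,2) by (metis carrier_vecD eq_vecI index_zero_vec)
  have "0 < N" unfolding N_def using k by (intro sum_pos2[of _ k]) auto
  moreover have "Im X = 0" using X2 by (simp add: complex_eq_iff)
  ultimately show ?thesis unfolding X1 by simp
qed

text \<open>All complex roots are real, so the complex factorization descends to the reals
  coefficient by coefficient. The list of real roots is what a Schur decomposition over the reals
  requires.\<close>

lemma real_symmetric_char_poly_splits:
  fixes A :: "real mat"
  assumes A: "A \<in> carrier_mat n n" and sym: "\<And>i j. i < n \<Longrightarrow> j < n \<Longrightarrow> A $$ (i, j) = A $$ (j, i)"
  obtains es where "char_poly A = (\<Prod>e\<leftarrow>es. [:- e, 1:])" "length es = n"
proof -
  let ?C = "map_mat of_real A :: complex mat"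
  have C: "?C \<in> carrier_mat n n" using A by simp
  obtain as where as: "char_poly ?C = (\<Prod>a\<leftarrow>as. [:- a, 1:])" "length as = n"
    using char_poly_factorized[OF C] by blast
  have real: "of_real (Re a) = a" if "a \<in> set as" for a
  proof -
    have "poly (char_poly ?C) a = 0" unfolding as(1) poly_prod_list using that
      by (auto simp: prod_list_zero_iff)
    then have "eigenvalue ?C a" using eigenvalue_root_char_poly[OF C] by simp
    then have "Im a = 0" using real_symmetric_eigenvalue_real[OF A] sym by blast
    then show ?thesis by (simp add: complex_eq_iff)
  qed
  have prod: "map_poly of_real (\<Prod>e\<leftarrow>xs. [:- Re e, 1:]) = (\<Prod>a\<leftarrow>xs. [:- a, 1:])"
    if "set xs \<subseteq> set as" for xs
    using that
  proof (induction xs)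
    case Nil
    then show ?case by simp
  next
    case (Cons a xs)
    have 1: "map_poly of_real [:- Re a, 1:] = [:- a, 1:]"
      using real[of a] Cons.prems by (simp add: map_poly_pCons)
    have 2: "map_poly (of_real :: real \<Rightarrow> complex) (p * q) = map_poly of_real p * map_poly of_real q" for p q
      by (rule poly_eqI) (simp add: coeff_map_poly coeff_mult)
    have "map_poly of_real (\<Prod>e\<leftarrow>xs. [:- Re e, 1:]) = (\<Prod>a\<leftarrow>xs. [:- a, 1:])"
      using Cons by simp
    then show ?case by (simp only: list.map prod_list.Cons 1 2)
  qed
  have "map_poly of_real (char_poly A) = char_poly ?C"
    by (rule of_real_hom.char_poly_hom[OF A, symmetric])
  also have "\<dots> = map_poly of_real (\<Prod>e\<leftarrow>as. [:- Re e, 1:])"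
    unfolding as(1) by (rule prod[symmetric]) simp
  finally have eq: "map_poly (of_real :: real \<Rightarrow> complex) (char_poly A) = map_poly of_real (\<Prod>e\<leftarrow>as. [:- Re e, 1:])" .
  have "char_poly A = (\<Prod>e\<leftarrow>as. [:- Re e, 1:])"
  proof (rule poly_eqI)
    fix i
    have "coeff (map_poly (of_real :: real \<Rightarrow> complex) (char_poly A)) i
      = coeff (map_poly of_real (\<Prod>e\<leftarrow>as. [:- Re e, 1:])) i" unfolding eq ..
    then show "coeff (char_poly A) i = coeff (\<Prod>e\<leftarrow>as. [:- Re e, 1:]) i"
      by (simp only: coeff_map_poly of_real_0 of_real_eq_iff)
  qed
  then show ?thesis using that[of "map Re as"] as(2) by (simp add: comp_def)
qed

section \<open>The truncated negative binomial filter\<close>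

text \<open>
  \<open>filter_val p l t r\<close> tends to \<open>l * (p / (p + (1 - p) * l)) ^ r\<close> as \<open>t\<close> grows: it is the value at the
  eigenvalue \<open>l\<close> of the walk that is cut off after \<open>t\<close> ticks, and counts 0 if it is cut off.
\<close>

fun filter_mat :: "real \<Rightarrow> real mat \<Rightarrow> nat \<Rightarrow> nat \<Rightarrow> real mat" where
  "filter_mat p L t 0 = L"
| "filter_mat p L 0 (Suc r) = 0\<^sub>m (dim_row L) (dim_row L)"
| "filter_mat p L (Suc t) (Suc r) =
     p \<cdot>\<^sub>m filter_mat p L t r + (1 - p) \<cdot>\<^sub>m (filter_mat p L t (Suc r) - L * filter_mat p L t (Suc r))"

fun filter_val :: "real \<Rightarrow> real \<Rightarrow> nat \<Rightarrow> nat \<Rightarrow> real" where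
  "filter_val p l t 0 = l"
| "filter_val p l 0 (Suc r) = 0"
| "filter_val p l (Suc t) (Suc r) = p * filter_val p l t r + (1 - p) * ((1 - l) * filter_val p l t (Suc r))"

lemma filter_mat_carrier: "L \<in> carrier_mat n n \<Longrightarrow> filter_mat p L t r \<in> carrier_mat n n"
  by (induction p L t r rule: filter_mat.induct) auto

text \<open>\<open>filter_mat\<close> is a polynomial in \<open>L\<close>, built by products with
  \<open>L\<close> on the left, so the inner factors Q * P cancel.\<close>

lemma filter_mat_conjugate:
  assumes P: "P \<in> carrier_mat n n" and Q: "Q \<in> carrier_mat n n" and B: "B \<in> carrier_mat n n"
    and inv: "Q * P = 1\<^sub>m n"
  shows "filter_mat p (P * B * Q) t r = P * filter_mat p B t r * Q"
proof (induction t arbitrary: r)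
  case 0
  then show ?case using assms by (cases r) auto
next
  case (Suc t)
  show ?case
  proof (cases r)
    case 0
    then show ?thesis by simp
  next
    case r: (Suc r')
    let ?X = "filter_mat p B t r'" and ?Y = "filter_mat p B t (Suc r')"
    have X: "?X \<in> carrier_mat n n" and Y: "?Y \<in> carrier_mat n n"
      using filter_mat_carrier[OF B] by auto
    note c = P Q B X Y
    have 1: "P * B * Q * (P * ?Y * Q) = P * (B * ?Y) * Q"
    proof -
      have "P * B * Q * (P * ?Y * Q) = P * (B * ((Q * P) * (?Y * Q)))"
        using c by (simp add: assoc_mult_mat[of _ n n _ n _ n])
      also have "\<dots> = P * (B * (?Y * Q))" using c inv by simp
      finally show ?thesis using c by (simp add: assoc_mult_mat[of _ n n _ n _ n])
    qed
    have 2: "P * (p \<cdot>\<^sub>m ?X + (1 - p) \<cdot>\<^sub>m (?Y - B * ?Y)) * Q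
      = p \<cdot>\<^sub>m (P * ?X * Q) + (1 - p) \<cdot>\<^sub>m (P * ?Y * Q - P * (B * ?Y) * Q)"
    proof -
      have BY: "B * ?Y \<in> carrier_mat n n" using c by simp
      have "P * (p \<cdot>\<^sub>m ?X + (1 - p) \<cdot>\<^sub>m (?Y - B * ?Y))
        = P * (p \<cdot>\<^sub>m ?X) + P * ((1 - p) \<cdot>\<^sub>m (?Y - B * ?Y))"
        by (rule mult_add_distrib_mat[of _ n n _ n]) (use c BY in \<open>auto intro: minus_carrier_mat\<close>)
      also have "P * (p \<cdot>\<^sub>m ?X) = p \<cdot>\<^sub>m (P * ?X)"
        by (rule mult_smult_distrib[of _ n n _ n]) (use c in auto)
      also have "P * ((1 - p) \<cdot>\<^sub>m (?Y - B * ?Y)) = (1 - p) \<cdot>\<^sub>m (P * (?Y - B * ?Y))"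
        by (rule mult_smult_distrib[of _ n n _ n]) (use c BY in \<open>auto intro: minus_carrier_mat\<close>)
      also have "P * (?Y - B * ?Y) = P * ?Y - P * (B * ?Y)"
        by (rule mult_minus_distrib_mat[of _ n n _ n]) (use c BY in auto)
      finally have *: "P * (p \<cdot>\<^sub>m ?X + (1 - p) \<cdot>\<^sub>m (?Y - B * ?Y)) =
        p \<cdot>\<^sub>m (P * ?X) + (1 - p) \<cdot>\<^sub>m (P * ?Y - P * (B * ?Y))" .
      have PX: "P * ?X \<in> carrier_mat n n" "P * ?Y \<in> carrier_mat n n" "P * (B * ?Y) \<in> carrier_mat n n"
        using c BY by auto
      have "(p \<cdot>\<^sub>m (P * ?X) + (1 - p) \<cdot>\<^sub>m (P * ?Y - P * (B * ?Y))) * Q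
        = (p \<cdot>\<^sub>m (P * ?X)) * Q + ((1 - p) \<cdot>\<^sub>m (P * ?Y - P * (B * ?Y))) * Q"
        by (rule add_mult_distrib_mat[of _ n n _ _ n]) (use c PX in \<open>auto intro: minus_carrier_mat\<close>)
      also have "(p \<cdot>\<^sub>m (P * ?X)) * Q = p \<cdot>\<^sub>m (P * ?X * Q)"
        by (rule mult_smult_assoc_mat[of _ n n _ n]) (use c PX in auto)
      also have "((1 - p) \<cdot>\<^sub>m (P * ?Y - P * (B * ?Y))) * Q = (1 - p) \<cdot>\<^sub>m ((P * ?Y - P * (B * ?Y)) * Q)"
        by (rule mult_smult_assoc_mat[of _ n n _ n]) (use c PX in \<open>auto intro: minus_carrier_mat\<close>)
      also have "(P * ?Y - P * (B * ?Y)) * Q = P * ?Y * Q - P * (B * ?Y) * Q"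
        by (rule minus_mult_distrib_mat[of _ n n _ _ n]) (use c PX in auto)
      finally show ?thesis unfolding * .
    qed
    show ?thesis unfolding r filter_mat.simps Suc.IH 1 2 ..
  qed
qed

text \<open>On the diagonal, a product of upper triangular matrices multiplies entry by entry, so
  the matrix recursion restricts to the scalar one.\<close>

lemma filter_mat_upper_triangular:
  assumes B: "B \<in> carrier_mat n n" and tri: "upper_triangular B"
  shows "upper_triangular (filter_mat p B t r) \<and>
    (\<forall>i<n. filter_mat p B t r $$ (i, i) = filter_val p (B $$ (i, i)) t r)"
proof (induction t arbitrary: r)
  case 0
  then show ?case using assms by (cases r) auto
next
  case (Suc t)
  show ?case
  proof (cases r)
    case 0
    then show ?thesis using tri by simp
  next
    case r: (Suc r')
    let ?X = "filter_mat p B t r'" and ?Y = "filter_mat p B t (Suc r')"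
    have X: "?X \<in> carrier_mat n n" and Y: "?Y \<in> carrier_mat n n"
      using filter_mat_carrier[OF B] by auto
    have trX: "?X $$ (i, j) = 0" "?Y $$ (i, j) = 0" "B $$ (i, j) = 0" if "j < i" "i < n" for i j
      using Suc[of r'] Suc[of "Suc r'"] tri that X Y B by auto
    have BY: "(B * ?Y) $$ (i, j) = (\<Sum>k<n. B $$ (i, k) * ?Y $$ (k, j))" if "i < n" "j < n" for i j
      using that B Y by (simp add: scalar_prod_def atLeast0LessThan)
    have lower: "(B * ?Y) $$ (i, j) = 0" if "j < i" "i < n" for i j
    proof -
      have "B $$ (i, k) * ?Y $$ (k, j) = 0" if "k < n" for k
        using that \<open>j < i\<close> \<open>i < n\<close> trX(3)[of k i] trX(2)[of j k] by (cases "k < i") auto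
      then show ?thesis using that by (subst BY) (auto intro: sum.neutral)
    qed
    have diag: "(B * ?Y) $$ (i, i) = B $$ (i, i) * ?Y $$ (i, i)" if "i < n" for i
    proof -
      have "B $$ (i, k) * ?Y $$ (k, i) = 0" if "k \<in> {..<n} - {i}" for k
        using that \<open>i < n\<close> trX(3)[of k i] trX(2)[of i k] by (cases "k < i") auto
      then have "(\<Sum>k\<in>{..<n} - {i}. B $$ (i, k) * ?Y $$ (k, i)) = 0" by (rule sum.neutral[OF ballI])
      then show ?thesis
        using BY[of i i] that by (simp add: sum.remove[of "{..<n}" i])
    qed
    have "upper_triangular (filter_mat p B (Suc t) (Suc r'))"
      using X Y B lower trX by (intro upper_triangularI) (simp_all del: index_mult_mat(1))
    moreover have "\<forall>i<n. filter_mat p B (Suc t) (Suc r') $$ (i, i) = filter_val p (B $$ (i, i)) (Suc t) (Suc r')"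
      using X Y B diag Suc[of r'] Suc[of "Suc r'"] by (simp add: algebra_simps del: index_mult_mat(1))
    ultimately show ?thesis using r by simp
  qed
qed

text \<open>Triangularization is enough: the trace is invariant under conjugation and reads only the
  diagonal, which lists the roots with multiplicity.\<close>

lemma trace_filter_mat:
  fixes L :: "real mat"
  assumes L: "L \<in> carrier_mat n n" and es: "char_poly L = (\<Prod>e\<leftarrow>es. [:- e, 1:])"
  shows "trace (filter_mat p L t r) = (\<Sum>e\<leftarrow>es. filter_val p e t r)"
proof -
  obtain B P Q where S: "schur_decomposition L es = (B, P, Q)" by (cases "schur_decomposition L es")
  note sd = schur_decomposition[OF L es S]
  have c: "L \<in> carrier_mat n n" "B \<in> carrier_mat n n" "P \<in> carrier_mat n n" "Q \<in> carrier_mat n n"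
    "Q * P = 1\<^sub>m n" "L = P * B * Q"
    using sd L unfolding similar_mat_wit_def Let_def by auto
  let ?F = "filter_mat p B t r"
  have F: "?F \<in> carrier_mat n n" by (rule filter_mat_carrier[OF c(2)])
  have "trace (filter_mat p L t r) = trace (P * ?F * Q)"
    using filter_mat_conjugate[OF c(3,4,2,5)] c(6) by simp
  also have "\<dots> = trace (Q * (P * ?F))"
    by (rule trace_mult_commute[of _ n]) (use c F in auto)
  also have "Q * (P * ?F) = ?F"
    using c F assoc_mult_mat[of Q n n P n ?F n] by (metis left_mult_one_mat)
  also have "trace ?F = (\<Sum>i<n. filter_val p (B $$ (i, i)) t r)"
    using filter_mat_upper_triangular[of B n] sd c(2) F by (auto simp: trace_def)
  also have "\<dots> = (\<Sum>e\<leftarrow>diag_mat B. filter_val p e t r)"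
    using c(2) by (simp add: diag_mat_def comp_def interv_sum_list_conv_sum_set_nat atLeast0LessThan)
  finally show ?thesis using sd by simp
qed

text \<open>\<open>x\<close> solves x = p + (1 - p) * (1 - l) * x, so l * x ^ r obeys the recursion
  exactly and the error obeys it too. The weight 2 ^ r makes the error contract: an ended round
  halves the weight, so a tick multiplies the bound by p / 2 + (1 - p) = 1 - p / 2.\<close>

lemma filter_val_error:
  assumes p: "0 < p" "p \<le> 1" and l: "\<bar>1 - l\<bar> \<le> 1"
  defines "x \<equiv> p / (p + (1 - p) * l)"
  shows "\<bar>filter_val p l t r - l * x ^ r\<bar> \<le> 2 * 2 ^ r * (1 - p / 2) ^ t"
proof -
  have l': "0 \<le> l" "l \<le> 2" using l by auto
  have den: "p \<le> p + (1 - p) * l" using p l' by simp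
  then have x: "0 \<le> x" "x \<le> 1" using p by (auto simp: x_def divide_simps)
  have rec: "x = p + (1 - p) * (1 - l) * x"
  proof -
    have "x * (p + (1 - p) * l) = p" using den p by (simp add: x_def)
    then show ?thesis by (simp add: algebra_simps)
  qed
  have base: "\<bar>l * x ^ r\<bar> \<le> 2" for r
    using l' x mult_mono[of l 2 "x ^ r" 1] by (simp add: abs_mult power_le_one)
  show ?thesis
  proof (induction t arbitrary: r)
    case 0
    have "2 \<le> (2::real) * 2 ^ r" by simp
    then show ?case using base[of r] p by (cases r) (auto intro: order_trans)
  next
    case (Suc t)
    show ?case
    proof (cases r)
      case 0
      then show ?thesis using p by simp
    next
      case r: (Suc r')
      let ?e = "(1 - p / 2) ^ t"
      let ?d1 = "filter_val p l t r' - l * x ^ r'"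
      let ?d2 = "filter_val p l t (Suc r') - l * x ^ Suc r'"
      have "l * x ^ Suc r' = l * x ^ r' * (p + (1 - p) * (1 - l) * x)"
        using rec by simp
      then have "filter_val p l (Suc t) r - l * x ^ r = p * ?d1 + (1 - p) * ((1 - l) * ?d2)"
        unfolding r by (simp add: algebra_simps)
      also have "\<bar>\<dots>\<bar> \<le> p * \<bar>?d1\<bar> + (1 - p) * (\<bar>1 - l\<bar> * \<bar>?d2\<bar>)"
        using p abs_triangle_ineq[of "p * ?d1" "(1 - p) * ((1 - l) * ?d2)"] by (simp add: abs_mult)
      also have "\<dots> \<le> p * (2 * 2 ^ r' * ?e) + (1 - p) * (1 * (2 * 2 ^ Suc r' * ?e))"
        using p l Suc.IH[of r'] Suc.IH[of "Suc r'"] by (intro add_mono mult_left_mono mult_mono) auto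
      also have "\<dots> = 2 * 2 ^ r * (1 - p / 2) ^ Suc t"
        unfolding r by (simp add: algebra_simps)
      finally show ?thesis .
    qed
  qed
qed

section \<open>The random walk and the normalized Laplacian\<close>

definition transition :: "nat \<Rightarrow> (nat \<Rightarrow> nat \<Rightarrow> real) \<Rightarrow> nat \<Rightarrow> nat \<Rightarrow> real" where
  "transition n w i j =
     (if weighted_degree n w i = 0 then of_bool (i = j) else w i j / weighted_degree n w i)"

lemma sum_of_bool_mult:
  fixes f :: "nat \<Rightarrow> real"
  assumes "i < n"
  shows "(\<Sum>j<n. of_bool (i = j) * f j) = f i"
proof -
  have "(\<Sum>j<n. of_bool (i = j) * f j) = (\<Sum>j<n. if i = j then f j else 0)"
    by (intro sum.cong) auto
  then show ?thesis using assms by simp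
qed

locale graph =
  fixes n :: nat and E :: "(nat \<times> nat) set" and w :: "nat \<Rightarrow> nat \<Rightarrow> real"
  assumes graph: "weighted_graph n E w"
begin

abbreviation "d \<equiv> weighted_degree n w"
abbreviation "L \<equiv> normalized_laplacian n E w"
abbreviation "T \<equiv> transition n w"

text \<open>The degrees made invertible: an isolated vertex gets the value 1, which is harmless
  because its row and column of \<open>L\<close> vanish.\<close>

definition e :: "nat \<Rightarrow> real" where "e i = (if d i = 0 then 1 else d i)"

lemma w_sym: "i < n \<Longrightarrow> j < n \<Longrightarrow> w i j = w j i"
  using graph by (auto simp: weighted_graph_def)

lemma w_nonneg: "i < n \<Longrightarrow> j < n \<Longrightarrow> 0 \<le> w i j"
  using graph unfolding weighted_graph_def by (metis less_eq_real_def)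

lemma w_edge: "i < n \<Longrightarrow> j < n \<Longrightarrow> (i, j) \<in> E \<longleftrightarrow> w i j \<noteq> 0"
  using graph unfolding weighted_graph_def by (metis less_irrefl)

lemma d_nonneg: "i < n \<Longrightarrow> 0 \<le> d i"
  unfolding weighted_degree_def by (intro sum_nonneg w_nonneg) auto

lemma w_le_d: "i < n \<Longrightarrow> j < n \<Longrightarrow> w i j \<le> d i"
  unfolding weighted_degree_def by (rule member_le_sum) (auto intro: w_nonneg)

lemma d_zero: "i < n \<Longrightarrow> j < n \<Longrightarrow> d i = 0 \<Longrightarrow> w i j = 0"
  using w_le_d[of i j] w_nonneg[of i j] by simp

lemma e_pos: "i < n \<Longrightarrow> 0 < e i"
  using d_nonneg[of i] by (auto simp: e_def)

lemma T_nonneg: "i < n \<Longrightarrow> j < n \<Longrightarrow> 0 \<le> T i j"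
  using w_nonneg d_nonneg by (simp add: transition_def)

lemma T_sum: "i < n \<Longrightarrow> (\<Sum>j<n. T i j) = 1"
  using sum_of_bool_mult[of i n "\<lambda>_. 1"]
  by (cases "d i = 0") (simp_all add: transition_def sum_divide_distrib[symmetric] weighted_degree_def[symmetric])

lemma L_carrier: "L \<in> carrier_mat n n"
  by (simp add: normalized_laplacian_def)

text \<open>Entrywise form of L = D^(1/2) (1 - T) D^(-1/2), where D is the diagonal matrix of the
  \<open>e i\<close>.\<close>

lemma L_entry:
  assumes ij: "i < n" "j < n"
  shows "L $$ (i, j) = of_bool (i = j) - sqrt (e i) * T i j / sqrt (e j)"
proof (cases "d i = 0")
  case True
  then show ?thesis using ij d_zero[of i j] w_edge[of i j]
    by (auto simp: normalized_laplacian_def transition_def e_def)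
next
  case di: False
  then have di': "d i > 0" using d_nonneg[OF ij(1)] by simp
  have q: "sqrt (d i) * (w i j / d i) = w i j / sqrt (d i)"
    using di' by (simp add: real_div_sqrt field_simps)
  show ?thesis
  proof (cases "w i j = 0")
    case True
    then show ?thesis using ij di w_edge[of i j]
      by (auto simp: normalized_laplacian_def transition_def)
  next
    case wij: False
    then have dj: "d j \<noteq> 0" using d_zero[of j i] w_sym[of i j] ij by auto
    show ?thesis
    proof (cases "i = j")
      case True
      then show ?thesis using ij di di' by (simp add: normalized_laplacian_def transition_def e_def)
    next
      case False
      then show ?thesis using ij di dj wij w_edge[of i j] q
        by (simp add: normalized_laplacian_def transition_def e_def real_sqrt_mult)
    qed
  qed
qed

lemma L_sym:
  assumes "i < n" "j < n" shows "L $$ (i, j) = L $$ (j, i)"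
proof -
  have "(i, j) \<in> E \<longleftrightarrow> (j, i) \<in> E" using w_edge w_sym assms by auto
  then show ?thesis using assms w_sym[of i j] by (auto simp: normalized_laplacian_def mult.commute)
qed

section \<open>Bounds on the spectrum from the averaging property of the walk\<close>

lemma eigenvalue_transition:
  assumes "eigenvalue L l"
  shows "\<exists>y. (\<forall>i<n. (\<Sum>j<n. T i j * y j) = (1 - l) * y i) \<and> (\<exists>i<n. y i \<noteq> 0)"
proof -
  obtain x where x: "x \<in> carrier_vec n" "x \<noteq> 0\<^sub>v n" "L *\<^sub>v x = l \<cdot>\<^sub>v x"
    using assms L_carrier unfolding eigenvalue_def eigenvector_def by auto
  define y where "y i = x $ i / sqrt (e i)" for i
  have xy: "x $ i = sqrt (e i) * y i" if "i < n" for i using e_pos[OF that] by (simp add: y_def)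
  have "(\<Sum>j<n. T i j * y j) = (1 - l) * y i" if i: "i < n" for i
  proof -
    have "(\<Sum>j<n. L $$ (i, j) * x $ j) = l * x $ i"
    proof -
      have "(L *\<^sub>v x) $ i = (l \<cdot>\<^sub>v x) $ i" using x(3) by simp
      then show ?thesis using i L_carrier x(1) by (simp add: scalar_prod_def atLeast0LessThan)
    qed
    also have "(\<Sum>j<n. L $$ (i, j) * x $ j) = (\<Sum>j<n. of_bool (i = j) * x $ j - sqrt (e i) * (T i j * y j))"
    proof (intro sum.cong refl)
      fix j assume "j \<in> {..<n}"
      then have j: "j < n" by simp
      show "L $$ (i, j) * x $ j = of_bool (i = j) * x $ j - sqrt (e i) * (T i j * y j)"
        using e_pos[OF j] by (simp add: L_entry[OF i j] xy[OF j] left_diff_distrib)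
    qed
    also have "\<dots> = x $ i - sqrt (e i) * (\<Sum>j<n. T i j * y j)"
      using i by (simp add: sum_subtractf sum_distrib_left[symmetric] sum_of_bool_mult)
    finally have "sqrt (e i) * (\<Sum>j<n. T i j * y j) = sqrt (e i) * ((1 - l) * y i)"
      using xy[OF i] by (simp add: algebra_simps)
    then show ?thesis using e_pos[OF i] by simp
  qed
  moreover have "\<exists>i<n. y i \<noteq> 0"
  proof -
    obtain k where "k < n" "x $ k \<noteq> 0" using x(1,2) by (metis carrier_vecD eq_vecI index_zero_vec)
    then show ?thesis using xy by force
  qed
  ultimately show ?thesis by blast
qed

text \<open>At a vertex where the rescaled eigenvector has maximal modulus, its average over the
  neighbours cannot have a larger one.\<close>

lemma eigenvalue_bound:
  assumes "eigenvalue L l" shows "\<bar>1 - l\<bar> \<le> 1"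
proof -
  obtain y where y: "\<And>i. i < n \<Longrightarrow> (\<Sum>j<n. T i j * y j) = (1 - l) * y i" "\<exists>i<n. y i \<noteq> 0"
    using eigenvalue_transition[OF assms] by blast
  define Y where "Y = Max ((\<lambda>i. \<bar>y i\<bar>) ` {..<n})"
  have ne: "(\<lambda>i. \<bar>y i\<bar>) ` {..<n} \<noteq> {}" using y(2) by auto
  have Y: "\<bar>y i\<bar> \<le> Y" if "i < n" for i unfolding Y_def using that by (intro Max_ge) auto
  obtain i where i: "i < n" "Y = \<bar>y i\<bar>" using Max_in[OF _ ne] unfolding Y_def by auto
  have pos: "0 < Y" using y(2) Y by (metis abs_le_zero_iff leI order_trans)
  have "\<bar>1 - l\<bar> * Y = \<bar>\<Sum>j<n. T i j * y j\<bar>" using y(1)[OF i(1)] i(2) by (simp add: abs_mult)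
  also have "\<dots> \<le> (\<Sum>j<n. \<bar>T i j * y j\<bar>)" by (rule sum_abs)
  also have "\<dots> \<le> (\<Sum>j<n. T i j * Y)"
    by (intro sum_mono) (use T_nonneg[OF i(1)] Y in \<open>auto simp: abs_mult intro: mult_left_mono\<close>)
  also have "\<dots> = 1 * Y" using T_sum[OF i(1)] by (simp add: sum_distrib_right[symmetric])
  finally show ?thesis using pos by simp
qed

text \<open>
  The values of the normalized eigenfunction leave a gap of length \<open>1 / n\<close> between 0 and its
  maximum. The edges across the gap carry the whole flow out of the upper level set.
\<close>

lemma eigenvalue_gap:
  assumes ev: "eigenvalue L l" and l: "l \<noteq> 0"
    and a: "0 < a" "\<And>i j. i < n \<Longrightarrow> j < n \<Longrightarrow> w i j \<noteq> 0 \<Longrightarrow> a \<le> w i j \<and> w i j \<le> c"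
  shows "a / (real n ^ 3 * c) \<le> l"
proof -
  obtain y where y: "\<And>i. i < n \<Longrightarrow> (\<Sum>j<n. T i j * y j) = (1 - l) * y i" "\<exists>i<n. y i \<noteq> 0"
    using eigenvalue_transition[OF ev] by blast
  \<comment> \<open>Passing to - y if necessary makes the maximum positive, so that dividing by it
    preserves the order.\<close>
  obtain f where f: "\<And>i. i < n \<Longrightarrow> (\<Sum>j<n. T i j * f j) = (1 - l) * f i" "\<exists>i<n. 0 < f i"
  proof (cases "\<exists>i<n. 0 < y i")
    case True
    then show ?thesis using that[of y] y by blast
  next
    case False
    then have "\<exists>i<n. 0 < - y i" using y(2) by (metis linorder_neqE_linordered_idom neg_0_less_iff_less)
    then show ?thesis using that[of "\<lambda>i. - y i"] y(1) by (simp add: sum_negf)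
  qed
  define Y where "Y = Max (f ` {..<n})"
  have ne: "f ` {..<n} \<noteq> {}" using f(2) by auto
  have Y: "f i \<le> Y" if "i < n" for i unfolding Y_def using that by (intro Max_ge) auto
  obtain i0 where i0: "i0 < n" "Y = f i0" using Max_in[OF _ ne] unfolding Y_def by auto
  have pos: "0 < Y" using f(2) Y by (meson less_le_trans)
  have n0: "0 < n" using i0 by simp
  define h where "h i = f i / Y" for i
  have h1: "h i \<le> 1" if "i < n" for i using Y[OF that] pos by (simp add: h_def)
  have h0: "h i0 = 1" using i0 pos by (simp add: h_def)
  have flow: "(\<Sum>j<n. w i j * (h i - h j)) = l * d i * h i" and iso: "d i = 0 \<Longrightarrow> h i = 0" if i: "i < n" for i
  proof -
    have hT: "(\<Sum>j<n. T i j * h j) = (1 - l) * h i"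
      using f(1)[OF i] by (simp add: h_def sum_divide_distrib[symmetric])
    show "d i = 0 \<Longrightarrow> h i = 0"
      using hT i l sum_of_bool_mult[of i n h] by (simp add: transition_def algebra_simps)
    show "(\<Sum>j<n. w i j * (h i - h j)) = l * d i * h i"
    proof (cases "d i = 0")
      case True
      then show ?thesis using d_zero[OF i] by simp
    next
      case False
      have "(\<Sum>j<n. w i j * h j) = d i * (\<Sum>j<n. T i j * h j)"
        using False by (simp add: transition_def sum_distrib_left)
      then have *: "(\<Sum>j<n. w i j * h j) = d i * ((1 - l) * h i)" using hT by simp
      have "(\<Sum>j<n. w i j * (h i - h j)) = (\<Sum>j<n. w i j) * h i - (\<Sum>j<n. w i j * h j)"
        by (simp add: right_diff_distrib sum_subtractf sum_distrib_right)
      then show ?thesis unfolding * weighted_degree_def[symmetric] by (simp add: algebra_simps)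
    qed
  qed
  \<comment> \<open>Pigeonhole on the n levels of width 1 / n below the maximum 1: the n - 1
    vertices other than \<open>i0\<close> miss one of them. Negative values are put into level 0 by
    \<open>nat\<close>.\<close>
  have "\<exists>k<n. \<forall>i<n. i \<noteq> i0 \<longrightarrow> nat \<lfloor>real n * h i\<rfloor> \<noteq> k"
  proof (rule ccontr)
    assume "\<not> ?thesis"
    then have "{..<n} \<subseteq> (\<lambda>i. nat \<lfloor>real n * h i\<rfloor>) ` ({..<n} - {i0})" by blast
    then have "card {..<n} \<le> card ({..<n} - {i0})" by (meson card_image_le card_mono finite_Diff finite_imageI finite_lessThan le_trans)
    then show False using i0(1) by simp
  qed
  then obtain k where k: "k < n" "\<And>i. i < n \<Longrightarrow> i \<noteq> i0 \<Longrightarrow> nat \<lfloor>real n * h i\<rfloor> \<noteq> k" by blast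
  define S where "S = {i. i < n \<and> real k + 1 \<le> real n * h i}"
  have Sn: "S \<subseteq> {..<n}" "finite S" by (auto simp: S_def intro: finite_subset[of _ "{..<n}"])
  have i0S: "i0 \<in> S" using i0 h0 k(1) by (simp add: S_def)
  have low: "real n * h i \<le> real k" if "i < n" "i \<notin> S" for i
  proof (rule ccontr)
    assume "\<not> ?thesis"
    then have "real k < real n * h i" "real n * h i < real k + 1" using that by (auto simp: S_def)
    then have "\<lfloor>real n * h i\<rfloor> = int k" by (simp add: floor_eq_iff)
    then show False using k(2)[of i] that i0S by auto
  qed
  have hS: "0 < h i" if "i \<in> S" for i
  proof -
    have "real k + 1 \<le> real n * h i" using that by (simp add: S_def)
    then have "0 < real n * h i" by linarith
    then show ?thesis using n0 by (simp add: zero_less_mult_iff)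
  qed
  \<comment> \<open>The flow inside \<open>S\<close> is antisymmetric and cancels; only the edges
    leaving \<open>S\<close> remain.\<close>
  have cut: "(\<Sum>i\<in>S. l * d i * h i) = (\<Sum>i\<in>S. \<Sum>j\<in>{..<n} - S. w i j * (h i - h j))"
  proof -
    let ?X = "\<Sum>i\<in>S. \<Sum>j\<in>S. w i j * (h i - h j)"
    have "?X = (\<Sum>j\<in>S. \<Sum>i\<in>S. w i j * (h i - h j))" by (rule sum.swap)
    also have "\<dots> = - ?X"
      unfolding sum_negf[symmetric] using Sn w_sym
      by (intro sum.cong refl) (auto simp: subset_iff algebra_simps)
    finally have X: "?X = 0" by simp
    have "(\<Sum>i\<in>S. l * d i * h i) = (\<Sum>i\<in>S. \<Sum>j<n. w i j * (h i - h j))"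
      using Sn flow by (intro sum.cong) auto
    also have "\<dots> = (\<Sum>i\<in>S. (\<Sum>j\<in>{..<n} - S. w i j * (h i - h j)) + (\<Sum>j\<in>S. w i j * (h i - h j)))"
      using Sn by (intro sum.cong refl sum.subset_diff) auto
    finally show ?thesis using X by (simp add: sum.distrib)
  qed
  have dS: "0 < d i" if "i \<in> S" for i
    using iso[of i] hS[OF that] d_nonneg[of i] Sn that by (cases "d i = 0") auto
  have D: "0 < (\<Sum>i\<in>S. d i * h i)" using dS hS i0S Sn by (intro sum_pos) auto
  have gap: "1 / real n \<le> h i - h j" if "i \<in> S" "j < n" "j \<notin> S" for i j
  proof -
    have "1 \<le> real n * h i - real n * h j" using low[OF that(2,3)] that(1) by (auto simp: S_def)
    then show ?thesis using n0 by (simp add: field_simps)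
  qed
  have terms: "0 \<le> w i j * (h i - h j)" if "i \<in> S" "j \<in> {..<n} - S" for i j
  proof (rule mult_nonneg_nonneg)
    show "0 \<le> w i j" using w_nonneg[of i j] that Sn by auto
    have "0 \<le> 1 / real n" by simp
    also have "\<dots> \<le> h i - h j" using gap[of i j] that by auto
    finally show "0 \<le> h i - h j" .
  qed
  have lD: "l * (\<Sum>i\<in>S. d i * h i) = (\<Sum>i\<in>S. \<Sum>j\<in>{..<n} - S. w i j * (h i - h j))"
    using cut by (simp add: sum_distrib_left mult.assoc)
  \<comment> \<open>The left side of \<open>lD\<close> is non-zero, so some edge leaves
    \<open>S\<close>; by \<open>gap\<close> it alone carries at least a / n.\<close>
  have "\<exists>i\<in>S. \<exists>j\<in>{..<n} - S. w i j \<noteq> 0"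
  proof (rule ccontr)
    assume "\<not> ?thesis"
    then have "(\<Sum>i\<in>S. \<Sum>j\<in>{..<n} - S. w i j * (h i - h j)) = 0" by simp
    then show False using lD l D by simp
  qed
  then obtain i j where ij: "i \<in> S" "j \<in> {..<n} - S" "w i j \<noteq> 0" by blast
  then have inj: "i < n" "j < n" using Sn by auto
  note aw = a(2)[OF inj ij(3)]
  have "a * (1 / real n) \<le> w i j * (h i - h j)"
    using aw a(1) gap[of i j] ij n0 by (intro mult_mono) auto
  also have "\<dots> \<le> (\<Sum>j\<in>{..<n} - S. w i j * (h i - h j))"
    using ij terms by (intro member_le_sum[where f = "\<lambda>j. w i j * (h i - h j)"]) auto
  also have "\<dots> \<le> (\<Sum>i\<in>S. \<Sum>j\<in>{..<n} - S. w i j * (h i - h j))"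
    using ij terms Sn by (intro member_le_sum[where f = "\<lambda>i. \<Sum>j\<in>{..<n} - S. w i j * (h i - h j)"] sum_nonneg) auto
  finally have lower: "a / real n \<le> l * (\<Sum>i\<in>S. d i * h i)" using lD by simp
  have c0: "0 < c" using aw a(1) by simp
  have dc: "d i \<le> real n * c" if "i < n" for i
  proof -
    have "d i \<le> (\<Sum>j<n. c)" unfolding weighted_degree_def
      using a(2)[OF that] c0 by (intro sum_mono) force
    then show ?thesis by simp
  qed
  have "(\<Sum>i\<in>S. d i * h i) \<le> (\<Sum>i\<in>S. real n * c)"
  proof (intro sum_mono)
    fix i assume i: "i \<in> S"
    then have "d i * h i \<le> d i * 1" using h1[of i] dS[of i] Sn by (intro mult_left_mono) auto
    then show "d i * h i \<le> real n * c" using dc[of i] i Sn by auto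
  qed
  also have "\<dots> \<le> real n * (real n * c)"
    using card_mono[OF _ Sn(1)] c0 by (simp add: mult_right_mono)
  finally have upper: "(\<Sum>i\<in>S. d i * h i) \<le> real n * (real n * c)" .
  have l0: "0 < l"
  proof -
    have "0 < l * (\<Sum>i\<in>S. d i * h i)" using lower a(1) n0 by (meson divide_pos_pos less_le_trans of_nat_0_less_iff)
    then show ?thesis using D by (simp add: zero_less_mult_iff)
  qed
  have "a / real n \<le> l * (real n * (real n * c))"
    by (rule order_trans[OF lower mult_left_mono[OF upper less_imp_le[OF l0]]])
  then show ?thesis using n0 c0 by (simp add: field_simps power3_eq_cube)
qed

section \<open>Value of the killed walk\<close>

text \<open>Expected outcome of a trial with exact transition probabilities, at vertex
  \<open>v\<close> with \<open>t\<close> ticks and \<open>r\<close> rounds left, by conditioning on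
  the next tick. The base cases are an entry of 1 - T and the value 0 of a walk that is cut
  off.\<close>

fun walk_val :: "real \<Rightarrow> nat \<Rightarrow> nat \<Rightarrow> nat \<Rightarrow> nat \<Rightarrow> real" where
  "walk_val p v0 t 0 v = of_bool (v = v0) - T v v0"
| "walk_val p v0 0 (Suc r) v = 0"
| "walk_val p v0 (Suc t) (Suc r) v =
     p * walk_val p v0 t r v + (1 - p) * (\<Sum>u<n. T v u * walk_val p v0 t (Suc r) u)"

lemma L_entry_scaled:
  assumes "v < n" "v0 < n"
  shows "L $$ (v, v0) * sqrt (e v0) = (of_bool (v = v0) - T v v0) * sqrt (e v)"
  unfolding L_entry[OF assms] using e_pos[OF assms(2)]
  by (cases "v = v0") (simp_all add: left_diff_distrib)

text \<open>The walk acts through 1 - T and the filter through \<open>L\<close>, its conjugate by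
  D^(1/2); hence the two scaling factors. They cancel at v = v0, where the trace looks, but the
  induction passes through all v.\<close>

lemma walk_val_filter_mat:
  "v < n \<Longrightarrow> v0 < n \<Longrightarrow> walk_val p v0 t r v * sqrt (e v) = filter_mat p L t r $$ (v, v0) * sqrt (e v0)"
proof (induction t arbitrary: r v)
  case 0
  show ?case
  proof (cases r)
    case 0
    then show ?thesis using L_entry_scaled "0.prems" by simp
  next
    case (Suc r') then show ?thesis using "0.prems" L_carrier by simp
  qed
next
  case (Suc t)
  show ?case
  proof (cases r)
    case 0
    then show ?thesis using L_entry_scaled Suc.prems by simp
  next
    case r: (Suc r')
    let ?X = "filter_mat p L t r'" and ?Y = "filter_mat p L t (Suc r')"
    have X: "?X \<in> carrier_mat n n" and Y: "?Y \<in> carrier_mat n n"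
      using filter_mat_carrier[OF L_carrier] by auto
    note v = Suc.prems
    have LYe: "(L * ?Y) $$ (v, v0) = (\<Sum>u<n. L $$ (v, u) * ?Y $$ (u, v0))"
      using v L_carrier Y by (simp add: scalar_prod_def atLeast0LessThan)
    have "(L * ?Y) $$ (v, v0) * sqrt (e v0) = (\<Sum>u<n. of_bool (v = u) * (?Y $$ (u, v0) * sqrt (e v0))
        - sqrt (e v) * (T v u * walk_val p v0 t (Suc r') u))"
      unfolding LYe sum_distrib_right
    proof (intro sum.cong refl)
      fix u assume "u \<in> {..<n}"
      then have u: "u < n" by simp
      let ?y = "walk_val p v0 t (Suc r') u"
      have Yw: "?Y $$ (u, v0) * sqrt (e v0) = ?y * sqrt (e u)"
        by (rule Suc.IH[OF u v(2), symmetric])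
      have "L $$ (v, u) * ?Y $$ (u, v0) * sqrt (e v0) = L $$ (v, u) * (?y * sqrt (e u))"
        by (simp only: mult.assoc Yw)
      also have "\<dots> = of_bool (v = u) * (?y * sqrt (e u)) - sqrt (e v) * (T v u * ?y)"
        unfolding L_entry[OF v(1) u] using e_pos[OF u] by (simp add: left_diff_distrib)
      finally show "L $$ (v, u) * ?Y $$ (u, v0) * sqrt (e v0) = of_bool (v = u) * (?Y $$ (u, v0) * sqrt (e v0))
        - sqrt (e v) * (T v u * ?y)"
        by (simp only: Yw)
    qed
    also have "\<dots> = ?Y $$ (v, v0) * sqrt (e v0) - sqrt (e v) * (\<Sum>u<n. T v u * walk_val p v0 t (Suc r') u)"
      using v by (simp add: sum_subtractf sum_distrib_left[symmetric] sum_of_bool_mult)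
    finally have LY: "(L * ?Y) $$ (v, v0) * sqrt (e v0)
      = ?Y $$ (v, v0) * sqrt (e v0) - sqrt (e v) * (\<Sum>u<n. T v u * walk_val p v0 t (Suc r') u)" .
    have "filter_mat p L (Suc t) r $$ (v, v0) = p * ?X $$ (v, v0) + (1 - p) * (?Y $$ (v, v0) - (L * ?Y) $$ (v, v0))"
      using X Y L_carrier v unfolding r by (simp del: index_mult_mat(1))
    then have "filter_mat p L (Suc t) r $$ (v, v0) * sqrt (e v0)
      = p * (?X $$ (v, v0) * sqrt (e v0)) + (1 - p) * (?Y $$ (v, v0) * sqrt (e v0) - (L * ?Y) $$ (v, v0) * sqrt (e v0))"
      by (simp only: distrib_right left_diff_distrib mult.assoc)
    also have "\<dots> = p * (walk_val p v0 t r' v * sqrt (e v))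
        + (1 - p) * (sqrt (e v) * (\<Sum>u<n. T v u * walk_val p v0 t (Suc r') u))"
      unfolding LY by (simp only: Suc.IH[OF v, of r'] diff_diff_eq2 add_diff_cancel_left')
    also have "\<dots> = walk_val p v0 (Suc t) r v * sqrt (e v)"
      unfolding r by (simp add: algebra_simps)
    finally show ?thesis by simp
  qed
qed

lemma sum_walk_val:
  obtains es where "length es = n" "char_poly L = (\<Prod>l\<leftarrow>es. [:- l, 1:])"
    "\<And>l. l \<in> set es \<longleftrightarrow> eigenvalue L l"
    "\<And>p t r. (\<Sum>v<n. walk_val p v t r v) = (\<Sum>l\<leftarrow>es. filter_val p l t r)"
proof -
  obtain es where es: "char_poly L = (\<Prod>l\<leftarrow>es. [:- l, 1:])" "length es = n"
    using real_symmetric_char_poly_splits[OF L_carrier L_sym] by blast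
  have "l \<in> set es \<longleftrightarrow> eigenvalue L l" for l
    unfolding eigenvalue_root_char_poly[OF L_carrier] es(1) poly_prod_list
    by (auto simp: prod_list_zero_iff)
  moreover have "(\<Sum>v<n. walk_val p v t r v) = (\<Sum>l\<leftarrow>es. filter_val p l t r)" for p t r
  proof -
    have "walk_val p v t r v = filter_mat p L t r $$ (v, v)" if "v < n" for v
      using walk_val_filter_mat[OF that that, of p t r] e_pos[OF that] by simp
    then have "(\<Sum>v<n. walk_val p v t r v) = trace (filter_mat p L t r)"
      using filter_mat_carrier[OF L_carrier, of p t r] by (simp add: trace_def)
    then show ?thesis using trace_filter_mat[OF L_carrier es(1)] by simp
  qed
  ultimately show ?thesis using that es by blast
qed

end

section \<open>Expectations of finitely supported distributions\<close>

abbreviation expect :: "'a pmf \<Rightarrow> ('a \<Rightarrow> real) \<Rightarrow> real" where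
  "expect p f \<equiv> measure_pmf.expectation p f"

lemma expect_sum:
  "finite (set_pmf p) \<Longrightarrow> expect p f = (\<Sum>x\<in>set_pmf p. pmf p x * f x)"
  by (subst integral_measure_pmf[of "set_pmf p"]) auto

lemma expect_bind:
  assumes "finite (set_pmf p)" "\<And>x. x \<in> set_pmf p \<Longrightarrow> finite (set_pmf (q x))"
  shows "expect (bind_pmf p q) f = expect p (\<lambda>x. expect (q x) f)"
  using pmf_expectation_bind[of "set_pmf p" q p f] assms by (simp add: expect_sum)

lemma expect_mono:
  assumes "finite (set_pmf p)" "\<And>x. x \<in> set_pmf p \<Longrightarrow> f x \<le> g x"
  shows "expect p f \<le> expect p g"
  using assms by (auto simp: expect_sum intro!: sum_mono mult_left_mono)

lemma expect_abs_le:
  assumes "finite (set_pmf p)" "\<And>x. x \<in> set_pmf p \<Longrightarrow> \<bar>f x\<bar> \<le> B"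
  shows "\<bar>expect p f\<bar> \<le> B"
proof -
  have "expect p f \<le> expect p (\<lambda>_. B)" using assms by (intro expect_mono) (auto dest: abs_le_D1)
  moreover have "expect p (\<lambda>_. - B) \<le> expect p f"
  proof (rule expect_mono[OF assms(1)])
    fix x assume "x \<in> set_pmf p"
    from assms(2)[OF this] show "- B \<le> f x" by linarith
  qed
  ultimately show ?thesis by simp
qed

lemma expect_cong: "(\<And>x. x \<in> set_pmf p \<Longrightarrow> f x = g x) \<Longrightarrow> expect p f = expect p g"
  by (rule integral_cong_AE) (auto simp: AE_measure_pmf_iff)

lemma expect_diff:
  "finite (set_pmf p) \<Longrightarrow> expect p (\<lambda>x. f x - g x) = expect p f - expect p g"
  by (simp add: expect_sum right_diff_distrib sum_subtractf)

lemma expect_if: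
  "expect p (\<lambda>x. if P x then a else b) = measure_pmf.prob p {x. P x} * a + (1 - measure_pmf.prob p {x. P x}) * b"
proof -
  define S where "S = {x. P x}"
  have "expect p (\<lambda>x. if P x then a else b) = expect p (\<lambda>x. b + (a - b) * indicator S x)"
    by (intro expect_cong) (auto simp: S_def indicator_def)
  also have "\<dots> = expect p (\<lambda>x. b) + expect p (\<lambda>x. (a - b) * indicator S x)"
    by (rule Bochner_Integration.integral_add) (auto simp: integrable_real_indicator measure_pmf.emeasure_eq_measure)
  also have "\<dots> = b + (a - b) * measure_pmf.prob p S" by simp
  finally show ?thesis by (simp add: S_def algebra_simps)
qed

section \<open>Uniform bits\<close>

lemma finite_bits: "finite (set_pmf (bits k u))"
  unfolding bits_def by (rule finite_set_pmf_iter) auto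

lemma pmf_bits: "pmf (bits k u) z = (if u * 2 ^ k \<le> z \<and> z < (u + 1) * 2 ^ k then 1 / 2 ^ k else 0)"
proof (induction k arbitrary: u)
  case 0
  then show ?case by (auto simp: bits_def pmf_return indicator_def)
next
  case (Suc k)
  have "pmf (bits (Suc k) u) z = 1 / 2 * pmf (bits k (2 * u + 1)) z + 1 / 2 * pmf (bits k (2 * u)) z"
    by (simp add: bits_def pmf_bind bind_map_pmf)
  also have "\<dots> = (if u * 2 ^ Suc k \<le> z \<and> z < (u + 1) * 2 ^ Suc k then 1 / 2 ^ Suc k else 0)"
    unfolding Suc by (auto simp: algebra_simps)
  finally show ?case .
qed

lemma prob_bits:
  assumes "0 \<le> x" "x \<le> 2 ^ k"
  shows "measure_pmf.prob (bits k 0) {z. z < x} = of_int x / 2 ^ k"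
proof -
  have "bits k 0 = pmf_of_set {0..<2 ^ k}"
    by (intro pmf_eqI) (auto simp: pmf_bits pmf_of_set indicator_def)
  then have "measure_pmf.prob (bits k 0) {z. z < x} = real (card ({0..<2 ^ k} \<inter> {z. z < x})) / 2 ^ k"
    by (simp add: measure_pmf_of_set)
  also have "{0..<2 ^ k} \<inter> {z. z < x} = {0..<x}" using assms by auto
  finally show ?thesis using assms by simp
qed

section \<open>Accuracy of the sampled walk\<close>

text \<open>\<open>a\<close> bounds the non-zero weights from below, and \<open>a_pos\<close> says
  that M digits after the point resolve it, so truncation never turns an edge into a
  non-edge.\<close>

locale sampled_walk = estimator I b n m M T thr NN + graph n E w
  for I b n m M T thr NN E w +
  fixes a :: real
  assumes weight: "weight_in I = w"
    and a_pos: "1 \<le> a * 2 ^ M"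
    and weight_ge: "\<And>i j. i < n \<Longrightarrow> j < n \<Longrightarrow> w i j \<noteq> 0 \<Longrightarrow> a \<le> w i j"
begin

text \<open>The first term comes from rounding the bias to a multiple of 2 ^ (- 2 * M), the second
  from truncating the weights. A move tosses \<open>n\<close> coins, and a wrong coin shifts the
  value of a function bounded by 1 by at most 2; this gives \<open>walk_err\<close>.\<close>

definition coin_err :: real where "coin_err = 1 / 2 ^ (2 * M) + real n / (2 ^ M * a)"
definition walk_err :: real where "walk_err = 2 * real n * coin_err"

lemma a0: "0 < a"
proof (rule ccontr)
  assume "\<not> ?thesis"
  then have "a * 2 ^ M \<le> 0" by (simp add: mult_nonpos_nonneg)
  then show False using a_pos by simp
qed

lemma coin_err_nonneg: "0 \<le> coin_err"
  unfolding coin_err_def using a0 by simp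

lemma walk_err_nonneg: "0 \<le> walk_err"
  unfolding walk_err_def using coin_err_nonneg by simp

definition tail :: "nat \<Rightarrow> nat \<Rightarrow> real" where "tail v u = (\<Sum>x\<in>{u..<n}. w v x)"

definition keep_prob :: "nat \<Rightarrow> nat \<Rightarrow> real" where
  "keep_prob v u = measure_pmf.prob (bits (2 * M) 0) {x. x * trunc_total v u < trunc_weight v u * 2 ^ (2 * M)}"

lemma tail_Suc: "u < n \<Longrightarrow> tail v u = w v u + tail v (Suc u)"
  unfolding tail_def by (simp add: sum.atLeast_Suc_lessThan)

lemma tail_nonneg: "v < n \<Longrightarrow> 0 \<le> tail v u"
  unfolding tail_def by (intro sum_nonneg w_nonneg) auto

lemma tail_total:
  assumes "v < n"
  shows "of_int (trunc_total v u) \<le> tail v u * 2 ^ M" "tail v u * 2 ^ M \<le> of_int (trunc_total v u) + real n"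
proof -
  have "real_of_int (trunc_total v u) = (\<Sum>x\<in>{u..<n}. of_int \<lfloor>w v x * 2 ^ M\<rfloor>)"
    by (simp add: trunc_total_def trunc_weight_def weight)
  also have "\<dots> \<le> (\<Sum>x\<in>{u..<n}. w v x * 2 ^ M)" by (intro sum_mono) simp
  finally show "of_int (trunc_total v u) \<le> tail v u * 2 ^ M" by (simp add: tail_def sum_distrib_right)
  have "tail v u * 2 ^ M = (\<Sum>x\<in>{u..<n}. w v x * 2 ^ M)" by (simp add: tail_def sum_distrib_right)
  also have "\<dots> \<le> (\<Sum>x\<in>{u..<n}. of_int \<lfloor>w v x * 2 ^ M\<rfloor> + 1)"
    by (intro sum_mono) linarith
  also have "\<dots> = of_int (trunc_total v u) + real (n - u)"
    by (simp add: trunc_total_def trunc_weight_def weight sum.distrib)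
  finally show "tail v u * 2 ^ M \<le> of_int (trunc_total v u) + real n" by simp
qed

lemma keep_prob_error:
  assumes v: "v < n" and u: "u < n"
  shows "\<bar>keep_prob v u - w v u / tail v u\<bar> \<le> coin_err"
proof (cases "w v u = 0")
  case True
  have "{x. x * trunc_total v u < 0} \<inter> set_pmf (bits (2 * M) 0) = {}"
    using trunc_total_bounds(1)[OF v u] set_pmf_bits[of _ "2 * M" 0]
    by (fastforce simp: mult_less_0_iff)
  then have "measure_pmf.prob (bits (2 * M) 0) {x. x * trunc_total v u < 0} = 0"
    by (subst measure_Int_set_pmf[symmetric]) simp
  then show ?thesis using True coin_err_nonneg by (simp add: keep_prob_def trunc_weight_def weight)
next
  case False
  let ?val = "trunc_weight v u" and ?tot = "trunc_total v u" and ?Q = "2 ^ (2 * M) :: int"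
  let ?W = "tail v u"
  have wa: "a \<le> w v u" by (rule weight_ge[OF v u False])
  have "a * 2 ^ M \<le> w v u * 2 ^ M" using wa by (rule mult_right_mono) simp
  then have "1 \<le> w v u * 2 ^ M" using a_pos by (rule order_trans[rotated])
  then have val1: "1 \<le> ?val" by (simp add: trunc_weight_def weight)
  have valtot: "?val \<le> ?tot"
  proof (cases "Suc u < n")
    case True
    then show ?thesis using trunc_total_bounds(1)[OF v True] trunc_total_bounds(2)[OF v u] by simp
  next
    case F: False
    then have "Suc u = n" using u by simp
    then show ?thesis using trunc_total_bounds(2)[OF v u] by (simp add: trunc_total_def)
  qed
  have tot0: "0 < ?tot" using val1 valtot by simp
  have Wa: "a \<le> ?W" using wa tail_Suc[OF u, of v] tail_nonneg[OF v, of "Suc u"] by simp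
  \<comment> \<open>An integer lies below a real number iff it lies below its ceiling, so the actual
    bias is X / 2 ^ (2 * M).\<close>
  define X where "X = \<lceil>real_of_int (?val * ?Q) / real_of_int ?tot\<rceil>"
  have frac: "real_of_int (?val * ?Q) / real_of_int ?tot \<le> real_of_int ?Q"
    using valtot tot0 val1 by (simp add: divide_simps)
  have "0 \<le> real_of_int (?val * ?Q) / real_of_int ?tot"
    using val1 tot0 by (intro divide_nonneg_pos) auto
  then have X0: "0 \<le> X" unfolding X_def by linarith
  have XQ: "X \<le> ?Q" unfolding X_def using frac by (simp only: ceiling_le_iff)
  have set: "{x. x * ?tot < ?val * ?Q} = {x. x < X}"
  proof -
    have "x * ?tot < ?val * ?Q \<longleftrightarrow> x < X" for x
    proof -
      have "x * ?tot < ?val * ?Q \<longleftrightarrow> real_of_int x * real_of_int ?tot < real_of_int (?val * ?Q)"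
        by (simp only: of_int_mult[symmetric] of_int_less_iff)
      also have "\<dots> \<longleftrightarrow> real_of_int x < real_of_int (?val * ?Q) / real_of_int ?tot"
        using tot0 by (simp add: pos_less_divide_eq)
      finally show ?thesis unfolding X_def by (simp only: less_ceiling_iff)
    qed
    then show ?thesis by simp
  qed
  have kp: "keep_prob v u = real_of_int X / 2 ^ (2 * M)"
    unfolding keep_prob_def set by (rule prob_bits[OF X0 XQ])
  have e1: "\<bar>keep_prob v u - of_int ?val / of_int ?tot\<bar> \<le> 1 / 2 ^ (2 * M)"
  proof -
    define z where "z = real_of_int (?val * ?Q) / real_of_int ?tot"
    have "z \<le> of_int X" "of_int X \<le> z + 1" unfolding X_def z_def[symmetric] by linarith+
    then have "\<bar>of_int X - z\<bar> / 2 ^ (2 * M) \<le> 1 / 2 ^ (2 * M)" by (intro divide_right_mono) auto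
    moreover have "keep_prob v u - of_int ?val / of_int ?tot = (of_int X - z) / 2 ^ (2 * M)"
      unfolding kp z_def by (simp add: diff_divide_distrib)
    ultimately show ?thesis by simp
  qed
  have e2: "\<bar>of_int ?val / of_int ?tot - w v u / ?W\<bar> \<le> real n / (2 ^ M * a)"
  proof -
    define vr tr where "vr = real_of_int ?val" and "tr = real_of_int ?tot"
    define d where "d = w v u * 2 ^ M - vr"
    define F where "F = ?W * 2 ^ M - tr"
    have d: "0 \<le> d" "d \<le> 1" unfolding d_def vr_def trunc_weight_def weight by linarith+
    have F: "0 \<le> F" "F \<le> real n" unfolding F_def tr_def using tail_total[OF v, of u] by simp_all
    have tr: "0 < tr" "1 \<le> vr" "vr \<le> tr" unfolding tr_def vr_def using tot0 val1 valtot by simp_all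
    have W0: "0 < ?W" using Wa a0 by simp
    have "vr / tr - w v u / ?W = (vr * (?W * 2 ^ M) - (w v u * 2 ^ M) * tr) / (tr * ?W * 2 ^ M)"
      using tr W0 by (simp add: divide_simps) (simp add: algebra_simps)
    \<comment> \<open>Truncation takes \<open>d\<close> \<le> 1 from the weight and \<open>F\<close>
      \<le> n from the total; the product of \<open>vr\<close> and \<open>tr\<close> cancels and
      only these losses remain.\<close>
    also have "vr * (?W * 2 ^ M) - (w v u * 2 ^ M) * tr = vr * F - d * tr"
      by (simp add: F_def d_def algebra_simps)
    also have "(vr * F - d * tr) / (tr * ?W * 2 ^ M) = (vr / tr * F - d) / (?W * 2 ^ M)"
      using tr by (simp add: divide_simps)
    finally have eq: "vr / tr - w v u / ?W = (vr / tr * F - d) / (?W * 2 ^ M)" .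
    have n1: "1 \<le> real n" using n_pos by simp
    have "0 \<le> vr / tr * F" "vr / tr * F \<le> 1 * F" using tr F by (simp, intro mult_right_mono, auto)
    then have "\<bar>vr / tr * F - d\<bar> \<le> real n" using d F n1 by linarith
    then have "\<bar>vr / tr * F - d\<bar> / (?W * 2 ^ M) \<le> real n / (?W * 2 ^ M)"
      using W0 by (intro divide_right_mono) auto
    also have "\<dots> \<le> real n / (2 ^ M * a)"
      using Wa a0 W0 by (intro divide_left_mono) (auto simp: mult.commute)
    finally show ?thesis using W0 unfolding vr_def[symmetric] tr_def[symmetric] eq by (simp add: abs_mult)
  qed
  show ?thesis using e1 e2 unfolding coin_err_def by linarith
qed

text \<open>
  The conditional expectation of \<open>f\<close> under exact reservoir sampling when the vertices below \<open>u\<close>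
  are still to be processed and \<open>c\<close> is the current choice.
\<close>

definition cont :: "nat \<Rightarrow> (nat \<Rightarrow> real) \<Rightarrow> nat \<Rightarrow> nat \<Rightarrow> real" where
  "cont v f u c = (if tail v 0 = 0 then f c
     else (tail v u * f c + (\<Sum>x<u. w v x * f x)) / tail v 0)"

lemma tail_split: "u \<le> n \<Longrightarrow> tail v 0 = tail v u + (\<Sum>x<u. w v x)"
proof -
  assume "u \<le> n"
  then have "{0..<n} = {u..<n} \<union> {..<u}" by auto
  then show ?thesis by (simp add: tail_def sum.union_disjoint[of "{u..<n}" "{..<u}", symmetric] Int_def)
qed

lemma cont_bound:
  assumes v: "v < n" and u: "u \<le> n" and f: "\<And>x. x < n \<Longrightarrow> \<bar>f x\<bar> \<le> 1" and c: "c < n"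
  shows "\<bar>cont v f u c\<bar> \<le> 1"
proof (cases "tail v 0 = 0")
  case True then show ?thesis using f c by (simp add: cont_def)
next
  case False
  then have pos: "0 < tail v 0" using tail_nonneg[OF v, of 0] by simp
  have "\<bar>tail v u * f c + (\<Sum>x<u. w v x * f x)\<bar> \<le> \<bar>tail v u * f c\<bar> + \<bar>\<Sum>x<u. w v x * f x\<bar>"
    by (rule abs_triangle_ineq)
  also have "\<dots> \<le> \<bar>tail v u * f c\<bar> + (\<Sum>x<u. \<bar>w v x * f x\<bar>)" by (intro add_left_mono sum_abs)
  also have "\<dots> \<le> tail v u * 1 + (\<Sum>x<u. w v x * 1)"
  proof (intro add_mono sum_mono)
    show "\<bar>tail v u * f c\<bar> \<le> tail v u * 1"
      unfolding abs_mult using tail_nonneg[OF v, of u] f[OF c] by (intro mult_mono) auto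
    fix x assume "x \<in> {..<u}"
    then have x: "x < n" using u by simp
    show "\<bar>w v x * f x\<bar> \<le> w v x * 1"
      unfolding abs_mult using w_nonneg[OF v x] f[OF x] by (intro mult_mono) auto
  qed
  also have "\<dots> = tail v 0" using tail_split[OF u, of v] by simp
  finally show ?thesis using False pos by (simp add: cont_def abs_div)
qed

text \<open>With the exact bias q = w v u / tail v u, a toss preserves the conditional expectation:
  q * tail v u is the weight of \<open>u\<close>, and (1 - q) * tail v u is the weight beyond
  \<open>u\<close>, for which the old choice stands.\<close>

lemma cont_Suc:
  assumes v: "v < n" and u: "u < n"
  shows "cont v f (Suc u) c = w v u / tail v u * cont v f u u + (1 - w v u / tail v u) * cont v f u c"
proof -
  have "0 \<le> (\<Sum>x<u. w v x)" by (intro sum_nonneg w_nonneg[OF v]) (use u in auto)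
  then have ineq: "0 \<le> tail v (Suc u)" "0 \<le> w v u" "tail v u = w v u + tail v (Suc u)" "tail v u \<le> tail v 0"
    using tail_Suc[OF u, of v] tail_nonneg[OF v, of "Suc u"] w_nonneg[OF v u]
      tail_split[OF less_imp_le[OF u], of v] by simp_all
  show ?thesis
  proof (cases "tail v 0 = 0 \<or> tail v u = 0")
    \<comment> \<open>No weight has been seen up to and including \<open>u\<close>; the quotient 0 /
      0 = 0 then stands for a coin that keeps the current choice.\<close>
    case True
    then have "tail v u = 0" using ineq by linarith
    then have z: "w v u = 0" "tail v (Suc u) = 0" "tail v u = 0" using ineq by linarith+
    show ?thesis by (simp add: cont_def z)
  next
    case False
    have gen: "((W - q * W) * y + (S + q * W * z)) / W0 = q * ((W * z + S) / W0) + (1 - q) * ((W * y + S) / W0)"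
      for W W0 q S y z :: real
    proof -
      have num: "(W - q * W) * y + (S + q * W * z) = q * (W * z + S) + (1 - q) * (W * y + S)"
        by (simp add: algebra_simps)
      show ?thesis unfolding num by (simp only: times_divide_eq_right add_divide_distrib[symmetric])
    qed
    define q where "q = w v u / tail v u"
    have q: "w v u = q * tail v u" "tail v (Suc u) = tail v u - q * tail v u"
      using False tail_Suc[OF u, of v] by (simp_all add: q_def)
    have "cont v f (Suc u) c = (tail v (Suc u) * f c + ((\<Sum>x<u. w v x * f x) + w v u * f u)) / tail v 0"
      using False by (simp add: cont_def add.assoc)
    also have "\<dots> = q * ((tail v u * f u + (\<Sum>x<u. w v x * f x)) / tail v 0)
        + (1 - q) * ((tail v u * f c + (\<Sum>x<u. w v x * f x)) / tail v 0)"
      unfolding q by (rule gen)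
    finally show ?thesis using False unfolding cont_def q_def[symmetric] by simp
  qed
qed

lemma finite_reservoir: "finite (set_pmf (reservoir v u c))"
  unfolding reservoir_def using finite_bits by simp

lemma finite_walk: "finite (set_pmf (walk v))"
  unfolding walk_def by (intro finite_set_pmf_iter finite_reservoir)

text \<open>Exact coins are replaced by sampled ones one at a time: the difference splits into the
  two inductive errors, averaged by the coin, and the error of the bias times a difference of two
  values of \<open>cont\<close>, at most 2 in modulus.\<close>

lemma reservoir_error:
  assumes v: "v < n" and f: "\<And>x. x < n \<Longrightarrow> \<bar>f x\<bar> \<le> 1" and "u \<le> n" "c < n"
  shows "\<bar>expect (iter (reservoir v) u c) f - cont v f u c\<bar> \<le> 2 * real u * coin_err"
  using assms(3,4)
proof (induction u arbitrary: c)
  case 0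
  have "cont v f 0 c = f c" by (simp add: cont_def)
  then show ?case by simp
next
  case (Suc u)
  then have u: "u < n" by simp
  let ?e = "\<lambda>c. expect (iter (reservoir v) u c) f" and ?h = "cont v f u"
  let ?q = "w v u / tail v u" and ?k = "keep_prob v u"
  have k: "0 \<le> ?k" "?k \<le> 1" by (simp_all add: keep_prob_def)
  have hb: "\<bar>?h x\<bar> \<le> 1" if "x < n" for x
    using u by (intro cont_bound[where f = f, OF v _ f that]) auto
  have "expect (iter (reservoir v) (Suc u) c) f = expect (reservoir v u c) ?e"
    by (simp, rule expect_bind) (auto intro: finite_reservoir finite_set_pmf_iter)
  also have "\<dots> = expect (bits (2 * M) 0) (\<lambda>x. if x * trunc_total v u < trunc_weight v u * 2 ^ (2 * M) then ?e u else ?e c)"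
    unfolding reservoir_def[of v u c] integral_map_pmf by (rule expect_cong) simp
  also have "\<dots> = ?k * ?e u + (1 - ?k) * ?e c"
    unfolding expect_if keep_prob_def ..
  finally have "expect (iter (reservoir v) (Suc u) c) f - cont v f (Suc u) c
    = ?k * (?e u - ?h u) + (1 - ?k) * (?e c - ?h c) + (?k - ?q) * (?h u - ?h c)"
    unfolding cont_Suc[OF v u] by (simp add: algebra_simps)
  also have "\<bar>\<dots>\<bar> \<le> ?k * (2 * real u * coin_err) + (1 - ?k) * (2 * real u * coin_err) + coin_err * 2"
  proof -
    have "\<bar>?k * (?e u - ?h u)\<bar> \<le> ?k * (2 * real u * coin_err)"
      unfolding abs_mult using k Suc.IH[of u] u by (simp add: mult_left_mono)
    moreover have "\<bar>(1 - ?k) * (?e c - ?h c)\<bar> \<le> (1 - ?k) * (2 * real u * coin_err)"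
      unfolding abs_mult using k Suc.IH[of c] u Suc.prems by (simp add: mult_left_mono)
    moreover have "\<bar>(?k - ?q) * (?h u - ?h c)\<bar> \<le> coin_err * 2"
      unfolding abs_mult
    proof (rule mult_mono)
      show "\<bar>?h u - ?h c\<bar> \<le> 2"
        using hb[OF u] hb[OF Suc.prems(2)] by simp
    qed (use keep_prob_error[OF v u] coin_err_nonneg in auto)
    ultimately show ?thesis by linarith
  qed
  also have "\<dots> = 2 * real (Suc u) * coin_err" by (simp add: algebra_simps)
  finally show ?case .
qed

text \<open>The bound is uniform over all test functions of modulus at most 1, because the induction
  over ticks inserts the value of the remaining run for \<open>f\<close>.\<close>

lemma walk_error:
  assumes v: "v < n" and f: "\<And>x. x < n \<Longrightarrow> \<bar>f x\<bar> \<le> 1"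
  shows "\<bar>expect (walk v) f - (\<Sum>u<n. transition n w v u * f u)\<bar> \<le> walk_err"
proof -
  have t0: "tail v 0 = weighted_degree n w v" by (simp add: tail_def weighted_degree_def atLeast0LessThan)
  have "cont v f n v = (\<Sum>u<n. transition n w v u * f u)"
  proof (cases "tail v 0 = 0")
    case True
    then show ?thesis using sum_of_bool_mult[OF v, of f] by (simp add: cont_def transition_def t0)
  next
    case False
    moreover have "tail v n = 0" by (simp add: tail_def)
    ultimately show ?thesis by (simp add: cont_def transition_def t0 sum_divide_distrib)
  qed
  then show ?thesis using reservoir_error[where f = f, OF v f order_refl v] by (simp add: walk_def walk_err_def)
qed

section \<open>From the error of one move to the error of a trial\<close>

lemma finite_tick: "finite (set_pmf (tick j vr))"
  unfolding tick_def using finite_bits finite_walk by (auto split: prod.splits)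

lemma finite_trial: "finite (set_pmf (trial j v0))"
  unfolding trial_def using finite_walk
  by (auto split: prod.splits intro!: finite_set_pmf_iter finite_tick)

definition final :: "nat \<Rightarrow> nat \<times> nat \<Rightarrow> real" where
  "final v0 = (\<lambda>(v, r). if r > 0 then 0 else expect (walk v) (\<lambda>v'. of_bool (v = v0) - of_bool (v' = v0)))"

lemma final_bound: "\<bar>final v0 vr\<bar> \<le> 1"
proof -
  have "\<bar>expect (walk v) (\<lambda>v'. of_bool (v = v0) - of_bool (v' = v0))\<bar> \<le> 1" for v
    by (rule expect_abs_le[OF finite_walk]) auto
  then show ?thesis by (simp add: final_def case_prod_beta)
qed

text \<open>Averaging does not amplify errors, since the transition probabilities are nonnegative
  with row sums 1, so each tick adds at most one \<open>walk_err\<close>; the extra 1 accounts for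
  the move after the last round.\<close>

lemma tick_error:
  assumes j: "j \<le> 2 ^ m" and v0: "v0 < n" and "v < n"
  shows "\<bar>expect (iter (\<lambda>_. tick j) t (v, r)) (final v0) - walk_val (real j / 2 ^ m) v0 t r v\<bar>
    \<le> (real t + 1) * walk_err"
  using assms(3)
proof (induction t arbitrary: v r)
  case 0
  show ?case
  proof (cases r)
    case 0
    have "final v0 (v, 0) = of_bool (v = v0) - expect (walk v) (\<lambda>v'. of_bool (v' = v0))"
      unfolding final_def using expect_diff[OF finite_walk, of v "\<lambda>_. of_bool (v = v0)" "\<lambda>v'. of_bool (v' = v0)"] by simp
    moreover have "(\<Sum>u<n. transition n w v u * of_bool (u = v0)) = transition n w v v0"
    proof -
      have "(\<Sum>u<n. transition n w v u * of_bool (u = v0)) = (\<Sum>u<n. of_bool (v0 = u) * transition n w v u)"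
        by (intro sum.cong refl) auto
      then show ?thesis using sum_of_bool_mult[OF v0, of "transition n w v"] by simp
    qed
    ultimately show ?thesis using 0 walk_error[OF "0.prems", of "\<lambda>v'. of_bool (v' = v0)"] by simp
  next
    case (Suc r')
    then show ?thesis using walk_err_nonneg by (simp add: final_def)
  qed
next
  case (Suc t)
  let ?e = "\<lambda>vr. expect (iter (\<lambda>_. tick j) t vr) (final v0)"
  let ?p = "real j / 2 ^ m"
  have jr: "real j \<le> 2 ^ m" using j by (metis of_nat_le_iff of_nat_numeral of_nat_power)
  have jz: "int j \<le> 2 ^ m" using j by (metis of_nat_le_iff of_nat_numeral of_nat_power)
  have p: "0 \<le> ?p" "?p \<le> 1" using jr by simp_all
  have exp: "expect (iter (\<lambda>_. tick j) (Suc t) (v, r)) (final v0) = expect (tick j (v, r)) ?e"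
    by (simp, rule expect_bind) (auto intro: finite_tick finite_set_pmf_iter)
  show ?case
  proof (cases r)
    case 0
    have "expect (tick j (v, r)) ?e = ?e (v, 0)" by (simp add: tick_def 0)
    moreover have "walk_val ?p v0 t 0 v = walk_val ?p v0 (Suc t) r v" by (cases t) (simp_all add: 0)
    moreover have "(real t + 1) * walk_err \<le> (real (Suc t) + 1) * walk_err"
      using walk_err_nonneg by (intro mult_right_mono) auto
    ultimately show ?thesis using Suc.IH[OF Suc.prems, of 0] exp by simp
  next
    case r: (Suc r')
    have r0: "r \<noteq> 0" using r by simp
    define A where "A = expect (walk v) (\<lambda>u. ?e (u, r))"
    define B where "B = (\<Sum>u<n. transition n w v u * walk_val ?p v0 t r u)"
    have e1: "\<bar>?e vr\<bar> \<le> 1" for vr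
      by (intro expect_abs_le finite_set_pmf_iter finite_tick final_bound)
    have "expect (tick j (v, r)) ?e = expect (bits m 0) (\<lambda>x. if x < int j then ?e (v, r') else A)"
    proof -
      have "expect (tick j (v, r)) ?e = expect (bits m 0) (\<lambda>x. expect (if x < int j then return_pmf (v, r - 1)
         else map_pmf (\<lambda>v'. (v', r)) (walk v)) ?e)"
      proof -
        have tk: "tick j (v, r) = bind_pmf (bits m 0) (\<lambda>x. if x < int j then return_pmf (v, r - 1)
         else map_pmf (\<lambda>v'. (v', r)) (walk v))" using r0 by (simp add: tick_def)
        show ?thesis unfolding tk by (rule expect_bind) (auto simp: finite_bits finite_walk)
      qed
      also have "\<dots> = expect (bits m 0) (\<lambda>x. if x < int j then ?e (v, r') else A)"
        by (intro expect_cong) (simp add: r A_def)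
      finally show ?thesis .
    qed
    also have "\<dots> = ?p * ?e (v, r') + (1 - ?p) * A"
      unfolding expect_if prob_bits[OF of_nat_0_le_iff jz] by simp
    finally have E: "expect (iter (\<lambda>_. tick j) (Suc t) (v, r)) (final v0) = ?p * ?e (v, r') + (1 - ?p) * A"
      unfolding exp .
    have Wv: "walk_val ?p v0 (Suc t) r v = ?p * walk_val ?p v0 t r' v + (1 - ?p) * B"
      by (simp add: r B_def)
    have eq: "expect (iter (\<lambda>_. tick j) (Suc t) (v, r)) (final v0) - walk_val ?p v0 (Suc t) r v
      = ?p * (?e (v, r') - walk_val ?p v0 t r' v) + (1 - ?p) * (A - B)"
      by (simp only: E Wv right_diff_distrib add_diff_add)
    have AB: "\<bar>A - B\<bar> \<le> walk_err + (real t + 1) * walk_err"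
    proof -
      have "\<bar>A - (\<Sum>u<n. transition n w v u * ?e (u, r))\<bar> \<le> walk_err"
        unfolding A_def by (rule walk_error[where f = "\<lambda>u. ?e (u, r)", OF Suc.prems]) (rule e1)
      moreover have "\<bar>(\<Sum>u<n. transition n w v u * ?e (u, r)) - B\<bar> \<le> (real t + 1) * walk_err"
      proof -
        have "\<bar>(\<Sum>u<n. transition n w v u * ?e (u, r)) - B\<bar>
          = \<bar>\<Sum>u<n. transition n w v u * (?e (u, r) - walk_val ?p v0 t r u)\<bar>"
          by (simp add: B_def sum_subtractf right_diff_distrib)
        also have "\<dots> \<le> (\<Sum>u<n. \<bar>transition n w v u * (?e (u, r) - walk_val ?p v0 t r u)\<bar>)"
          by (rule sum_abs)
        also have "\<dots> \<le> (\<Sum>u<n. transition n w v u * ((real t + 1) * walk_err))"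
          unfolding abs_mult using T_nonneg[OF Suc.prems] Suc.IH by (intro sum_mono mult_mono) auto
        also have "\<dots> = (real t + 1) * walk_err"
          using T_sum[OF Suc.prems] by (simp add: sum_distrib_right[symmetric])
        finally show ?thesis .
      qed
      ultimately show ?thesis by linarith
    qed
    have "\<bar>?p * (?e (v, r') - walk_val ?p v0 t r' v) + (1 - ?p) * (A - B)\<bar>
      \<le> ?p * ((real t + 1) * walk_err) + (1 - ?p) * (walk_err + (real t + 1) * walk_err)"
    proof -
      have "\<bar>?p * (?e (v, r') - walk_val ?p v0 t r' v)\<bar> \<le> ?p * ((real t + 1) * walk_err)"
        unfolding abs_mult abs_of_nonneg[OF p(1)] using p Suc.IH[OF Suc.prems] by (intro mult_left_mono)
      moreover have "\<bar>(1 - ?p) * (A - B)\<bar> \<le> (1 - ?p) * (walk_err + (real t + 1) * walk_err)"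
        using p AB by (simp only: abs_mult) (intro mult_mono, auto)
      ultimately show ?thesis by linarith
    qed
    also have "\<dots> = (real t + 1) * walk_err + (1 - ?p) * walk_err" by (simp add: algebra_simps)
    also have "\<dots> \<le> (real (Suc t) + 1) * walk_err"
      using p walk_err_nonneg mult_right_mono[of "1 - ?p" 1 walk_err] by (simp add: algebra_simps)
    finally show ?thesis unfolding eq .
  qed
qed

definition mean :: "nat \<Rightarrow> nat \<Rightarrow> real" where "mean j v0 = expect (trial j v0) real_of_int"

lemma mean_error:
  assumes "j \<le> 2 ^ m" "v0 < n"
  shows "\<bar>mean j v0 - walk_val (real j / 2 ^ m) v0 T m v0\<bar> \<le> (real T + 1) * walk_err"
proof -
  have "mean j v0 = expect (iter (\<lambda>_. tick j) T (v0, m)) (final v0)"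
    unfolding mean_def trial_def
    by (subst expect_bind) (auto simp: final_def case_prod_beta intro!: finite_set_pmf_iter finite_tick finite_walk expect_cong)
  then show ?thesis using tick_error[OF assms(1,2,2)] by simp
qed

section \<open>Concentration\<close>

text \<open>For negative y, exp (- y) is at least 1 - y, and (1 - y) * (1 + y + y ^ 2) = 1 - y ^ 3
  is at least 1; cancelling 1 - y gives the claim.\<close>

lemma exp_le_quadratic:
  fixes y :: real assumes "\<bar>y\<bar> \<le> 1" shows "exp y \<le> 1 + y + y\<^sup>2"
proof (cases "0 \<le> y")
  case True then show ?thesis using assms exp_bound[of y] by simp
next
  case False
  have "(1 - y) * exp y \<le> exp (- y) * exp y"
    using exp_ge_add_one_self[of "- y"] by (intro mult_right_mono) auto
  also have "\<dots> = 1" by (simp add: exp_minus)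
  also have "1 \<le> (1 - y) * (1 + y + y\<^sup>2)"
  proof -
    have "(1 - y) * (1 + y + y\<^sup>2) = 1 - y * y\<^sup>2" by (simp add: algebra_simps power2_eq_square)
    then show ?thesis using False by (simp add: mult_nonpos_nonneg)
  qed
  finally show ?thesis using False by simp
qed

text \<open>After the quadratic bound only the mean matters, as outcomes have square at most
  1.\<close>

lemma trial_mgf:
  assumes "\<bar>\<theta>\<bar> \<le> 1"
  shows "expect (trial j v0) (\<lambda>x. exp (\<theta> * of_int x)) \<le> exp (\<theta> * mean j v0 + \<theta>\<^sup>2)"
proof -
  have "expect (trial j v0) (\<lambda>x. exp (\<theta> * of_int x)) \<le> expect (trial j v0) (\<lambda>x. (1 + \<theta>\<^sup>2) + \<theta> * of_int x)"
  proof (rule expect_mono[OF finite_trial])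
    fix x assume x: "x \<in> set_pmf (trial j v0)"
    have x1: "\<bar>real_of_int x\<bar> \<le> 1" using set_pmf_trial[OF x] by linarith
    then have "\<bar>\<theta> * of_int x\<bar> \<le> 1" using assms by (simp add: abs_mult mult_le_one)
    from exp_le_quadratic[OF this]
    have "exp (\<theta> * of_int x) \<le> 1 + \<theta> * of_int x + \<theta>\<^sup>2 * (of_int x)\<^sup>2" by (simp add: power_mult_distrib)
    also have "\<dots> \<le> 1 + \<theta> * of_int x + \<theta>\<^sup>2 * 1"
      using x1 by (intro add_left_mono mult_left_mono) (auto simp: abs_square_le_1)
    finally show "exp (\<theta> * of_int x) \<le> (1 + \<theta>\<^sup>2) + \<theta> * of_int x" by simp
  qed
  also have "\<dots> = 1 + (\<theta> * mean j v0 + \<theta>\<^sup>2)"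
    by (subst Bochner_Integration.integral_add) (auto simp: mean_def intro: integrable_measure_pmf_finite finite_trial)
  also have "\<dots> \<le> exp (\<theta> * mean j v0 + \<theta>\<^sup>2)" by (rule exp_ge_add_one_self)
  finally show ?thesis .
qed

lemma finite_total: "finite (set_pmf (total j))"
  unfolding total_def by (intro finite_set_pmf_iter) (simp add: finite_trial)

lemma total_mgf:
  assumes "\<bar>\<theta>\<bar> \<le> 1"
  shows "expect (total j) (\<lambda>x. exp (\<theta> * of_int x)) \<le> exp (\<Sum>i<NN. \<theta> * mean j (Suc i mod n) + \<theta>\<^sup>2)"
proof -
  let ?f = "\<lambda>i acc. map_pmf (\<lambda>x. acc + x) (trial j (Suc i mod n))"
  have "expect (iter ?f k acc) (\<lambda>x. exp (\<theta> * of_int x))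
      \<le> exp (\<theta> * of_int acc) * exp (\<Sum>i<k. \<theta> * mean j (Suc i mod n) + \<theta>\<^sup>2)" for k acc
  proof (induction k arbitrary: acc)
    case 0
    then show ?case by simp
  next
    case (Suc k)
    let ?S = "exp (\<Sum>i<k. \<theta> * mean j (Suc i mod n) + \<theta>\<^sup>2)"
    have fin: "finite (set_pmf (iter ?f k a))" for a by (intro finite_set_pmf_iter) (simp add: finite_trial)
    have "expect (iter ?f (Suc k) acc) (\<lambda>x. exp (\<theta> * of_int x))
      = expect (?f k acc) (\<lambda>a. expect (iter ?f k a) (\<lambda>x. exp (\<theta> * of_int x)))"
      unfolding iter.simps by (rule expect_bind) (auto simp: finite_trial fin)
    also have "\<dots> \<le> expect (?f k acc) (\<lambda>a. exp (\<theta> * of_int a) * ?S)"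
    proof (rule expect_mono)
      show "expect (iter ?f k a) (\<lambda>x. exp (\<theta> * of_int x)) \<le> exp (\<theta> * of_int a) * ?S" for a
        by (rule Suc.IH)
    qed (simp add: finite_trial)
    also have "\<dots> = exp (\<theta> * of_int acc) * ?S * expect (trial j (Suc k mod n)) (\<lambda>x. exp (\<theta> * of_int x))"
      by (simp add: distrib_left exp_add mult_ac)
    also have "\<dots> \<le> exp (\<theta> * of_int acc) * ?S * exp (\<theta> * mean j (Suc k mod n) + \<theta>\<^sup>2)"
      by (intro mult_left_mono trial_mgf assms) auto
    finally show ?case by (simp add: exp_add mult_ac)
  qed
  from this[of NN 0] show ?thesis by (simp add: total_def)
qed

lemma sum_mod_periodic: "(\<Sum>i<k * n. g (Suc i mod n)) = real k * (\<Sum>v<n. g v)" for g :: "nat \<Rightarrow> real"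
proof -
  obtain n' where n': "n = Suc n'" using n_pos by (cases n) auto
  have one: "(\<Sum>i<n. g (Suc i mod n)) = (\<Sum>v<n. g v)"
  proof -
    have "(\<Sum>i<n. g (Suc i mod n)) = (\<Sum>i<n'. g (Suc i)) + g 0"
      unfolding n' by simp
    then show ?thesis unfolding n' by (subst (2) sum.lessThan_Suc_shift) simp
  qed
  show ?thesis
  proof (induction k)
    case 0 show ?case by simp
  next
    case (Suc k)
    have split: "(\<Sum>i<p + q. h i) = (\<Sum>i<p. h i) + (\<Sum>i<q. h (p + i))" for p q and h :: "nat \<Rightarrow> real"
      by (induction q) auto
    have "(\<Sum>i<Suc k * n. g (Suc i mod n)) = (\<Sum>i<k * n. g (Suc i mod n)) + (\<Sum>i<n. g (Suc (k * n + i) mod n))"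
      using split[of "\<lambda>i. g (Suc i mod n)" "k * n" n] by (simp add: add.commute)
    also have "(\<Sum>i<n. g (Suc (k * n + i) mod n)) = (\<Sum>i<n. g (Suc i mod n))"
      by (intro sum.cong refl) (metis add_Suc_right mod_mult_self3)
    finally show ?case using Suc one by (simp add: algebra_simps)
  qed
qed

lemma prob_exp_bound:
  fixes p :: "int pmf"
  assumes "finite (set_pmf p)" "\<And>x. x \<in> A \<Longrightarrow> 0 \<le> g x"
  shows "measure_pmf.prob p A \<le> expect p (\<lambda>x. exp (g x))"
proof -
  have "measure_pmf.prob p A = expect p (indicator A)" by simp
  also have "\<dots> \<le> expect p (\<lambda>x. exp (g x))"
    by (rule expect_mono[OF assms(1)]) (use assms(2) in \<open>auto simp: indicator_def\<close>)
  finally show ?thesis .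
qed

text \<open>Exponential Markov inequality for both tails at once: positive \<theta> serves for upper
  sets, negative \<theta> for lower ones. Since every start vertex is used \<open>N\<close> times,
  the means add up to \<open>N\<close> times the estimated trace.\<close>

lemma total_tail:
  assumes NN: "NN = N * n" and \<theta>: "\<bar>\<theta>\<bar> \<le> 1"
    and A: "\<And>x. x \<in> A \<Longrightarrow> \<theta> * y \<le> \<theta> * of_int x"
  shows "measure_pmf.prob (total j) A \<le> exp (real N * (\<theta> * ((\<Sum>v<n. mean j v)) + real n * \<theta>\<^sup>2) - \<theta> * y)"
proof -
  have "measure_pmf.prob (total j) A \<le> expect (total j) (\<lambda>x. exp (\<theta> * of_int x - \<theta> * y))"
    by (rule prob_exp_bound[OF finite_total]) (use A in simp)
  also have "\<dots> = exp (- \<theta> * y) * expect (total j) (\<lambda>x. exp (\<theta> * of_int x))"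
    by (simp add: exp_diff exp_minus field_simps)
  also have "\<dots> \<le> exp (- \<theta> * y) * exp (\<Sum>i<NN. \<theta> * mean j (Suc i mod n) + \<theta>\<^sup>2)"
    by (intro mult_left_mono total_mgf \<theta>) simp
  also have "(\<Sum>i<NN. \<theta> * mean j (Suc i mod n) + \<theta>\<^sup>2) = real N * (\<theta> * (\<Sum>v<n. mean j v) + real n * \<theta>\<^sup>2)"
    unfolding NN using sum_mod_periodic[of "mean j" N]
    by (simp add: sum.distrib sum_distrib_left[symmetric] algebra_simps)
  finally show ?thesis by (simp add: exp_add[symmetric])
qed

text \<open>A union bound over the tests. Each test only has to keep its outcome between
  \<open>lo j\<close> and \<open>hi j\<close>, so a test that may go either way gets 0 and 1 and
  cannot fail.\<close>

lemma counting_bound: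
  assumes fail: "\<And>j. j < k \<Longrightarrow> measure_pmf.prob (total (Suc j)) {acc. \<not> (lo j \<le> of_bool (acc \<le> int thr) \<and> of_bool (acc \<le> int thr) \<le> hi j)} \<le> \<epsilon>"
  shows "measure_pmf.prob (counting k) {c. \<not> ((\<Sum>j<k. lo j) \<le> c \<and> c \<le> (\<Sum>j<k. hi j))} \<le> real k * \<epsilon>"
proof -
  let ?f = "\<lambda>j c. map_pmf (\<lambda>acc. c + of_bool (acc \<le> int thr)) (total (Suc j))"
  have "measure_pmf.prob (iter ?f i c0) {c. \<not> (c0 + (\<Sum>j<i. lo j) \<le> c \<and> c \<le> c0 + (\<Sum>j<i. hi j))} \<le> real i * \<epsilon>"
    if "i \<le> k" for i c0
    using that
  proof (induction i arbitrary: c0)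
    case 0
    then show ?case by (simp add: indicator_def)
  next
    case (Suc i)
    let ?B = "\<lambda>c0. {c. \<not> (c0 + (\<Sum>j<i. lo j) \<le> c \<and> c \<le> c0 + (\<Sum>j<i. hi j))}"
    let ?B' = "{c. \<not> (c0 + (\<Sum>j<Suc i. lo j) \<le> c \<and> c \<le> c0 + (\<Sum>j<Suc i. hi j))}"
    let ?G = "{acc. \<not> (lo i \<le> of_bool (acc \<le> int thr) \<and> of_bool (acc \<le> int thr) \<le> hi i)}"
    let ?c = "\<lambda>acc. c0 + of_bool (acc \<le> int thr)"
    have fin: "finite (set_pmf (iter ?f i a))" for a by (intro finite_set_pmf_iter) (simp add: finite_total)
    have "measure_pmf.prob (iter ?f (Suc i) c0) ?B' = expect (iter ?f (Suc i) c0) (indicator ?B')" by simp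
    also have "\<dots> = expect (?f i c0) (\<lambda>a. expect (iter ?f i a) (indicator ?B'))"
      unfolding iter.simps by (rule expect_bind) (auto simp: finite_total fin)
    also have "\<dots> = expect (total (Suc i)) (\<lambda>acc. measure_pmf.prob (iter ?f i (?c acc)) ?B')" by simp
    \<comment> \<open>A bad count needs a failure of the present test, charged by the indicator, or
      one among the remaining \<open>i\<close> tests.\<close>
    also have "\<dots> \<le> expect (total (Suc i)) (\<lambda>acc. indicator ?G acc + real i * \<epsilon>)"
    proof (rule expect_mono[OF finite_total])
      fix acc
      have \<epsilon>: "0 \<le> \<epsilon>" using fail[of i] Suc.prems by (meson Suc_le_lessD measure_nonneg order_trans)
      show "measure_pmf.prob (iter ?f i (?c acc)) ?B' \<le> indicator ?G acc + real i * \<epsilon>"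
      proof (cases "acc \<in> ?G")
        case True
        have "measure_pmf.prob (iter ?f i (?c acc)) ?B' \<le> 1" by simp
        also have "\<dots> \<le> indicator ?G acc + real i * \<epsilon>"
          using True \<epsilon> by (simp only: indicator_simps) simp
        finally show ?thesis .
      next
        case False
        have "?B' \<subseteq> ?B (?c acc)" using False by auto
        then have "measure_pmf.prob (iter ?f i (?c acc)) ?B' \<le> measure_pmf.prob (iter ?f i (?c acc)) (?B (?c acc))"
          by (intro measure_pmf.finite_measure_mono) auto
        also have "\<dots> \<le> real i * \<epsilon>" using Suc.prems by (intro Suc.IH) simp
        finally have le: "measure_pmf.prob (iter ?f i (?c acc)) ?B' \<le> real i * \<epsilon>" .
        have "indicator ?G acc = (0::real)" using False by (rule indicator_simps)
        then show ?thesis using le by (simp only: add_0_left)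
      qed
    qed
    also have "\<dots> = measure_pmf.prob (total (Suc i)) ?G + real i * \<epsilon>"
      by (subst Bochner_Integration.integral_add) (auto intro: integrable_measure_pmf_finite finite_total)
    also have "\<dots> \<le> \<epsilon> + real i * \<epsilon>" using fail[of i] Suc.prems by simp
    finally show ?case by (simp add: algebra_simps)
  qed
  from this[of k 0] show ?thesis by (simp add: counting_def)
qed

end

section \<open>Thresholds\<close>

lemma power_ge_two:
  fixes q :: real assumes "0 \<le> q" "1 \<le> real K * q" shows "2 \<le> (1 + q) ^ K"
proof -
  have "1 + real K * q \<le> (1 + q) ^ K" using assms by (intro Bernoulli_inequality) auto
  then show ?thesis using assms by linarith
qed

text \<open>Multiplied by (1 + q) ^ K, which is at least 2 by Bernoulli's inequality, the left side
  becomes (1 - q ^ 2) ^ K, at most 1.\<close>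

lemma power_le_half:
  fixes q :: real assumes "0 \<le> q" "q \<le> 1" "1 \<le> real K * q" shows "(1 - q) ^ K \<le> 1 / 2"
proof -
  have "(1 - q) ^ K * 2 \<le> (1 - q) ^ K * (1 + q) ^ K"
    using assms power_ge_two[OF assms(1,3)] by (intro mult_left_mono) auto
  also have "\<dots> = (1 - q\<^sup>2) ^ K"
    by (simp add: power_mult_distrib[symmetric] power2_eq_square algebra_simps)
  also have "\<dots> \<le> 1" using assms by (intro power_le_one) (auto simp: power_le_one)
  finally show ?thesis by simp
qed

lemma four_mult_le_power: "6 \<le> m \<Longrightarrow> 4 * m \<le> (2::nat) ^ (m - 1)"
proof (induction m rule: nat_induct_at_least)
  case base then show ?case by simp
next
  case (Suc m)
  have "2 ^ (Suc m - 1) = 2 * (2::nat) ^ (m - 1)"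
    using Suc.hyps by (cases m) auto
  then show ?case using Suc by simp
qed

text \<open>
  With \<open>y = p / (1 - p)\<close>, the factor \<open>p / (p + (1 - p) * l)\<close> equals \<open>y / (y + l)\<close>, which is \<open>1 / 2\<close>
  at \<open>y = l\<close>; its \<open>m\<close>-th power separates the values of \<open>y\<close> below and above \<open>l\<close>.
\<close>

lemma filter_factor_le:
  fixes \<mu> l \<beta> :: real
  assumes "0 < j" "j < z" "0 < \<mu>" "\<mu> \<le> l" "0 \<le> \<beta>" "\<beta> \<le> 1"
    and y: "j \<le> (1 - \<beta>) * \<mu> * (z - j)"
  defines "p \<equiv> j / z"
  shows "p / (p + (1 - p) * l) \<le> (1 - \<beta> / 2) / 2"
proof -
  have eq: "p / (p + (1 - p) * l) = j / (j + (z - j) * l)"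
    using assms by (simp add: p_def field_simps)
  have den: "0 < j + (z - j) * l" using assms by (intro add_pos_pos mult_pos_pos) auto
  have "\<mu> * (z - j) \<le> l * (z - j)" using assms by (intro mult_right_mono) auto
  then have l: "\<mu> * (z - j) \<le> (z - j) * l" by (simp add: mult.commute)
  have b: "0 \<le> 1 - \<beta> / 2" using assms by simp
  have "j * (1 + \<beta> / 2) \<le> (1 - \<beta>) * \<mu> * (z - j) * (1 + \<beta> / 2)"
    using y assms by (intro mult_right_mono) auto
  also have "\<dots> = (\<mu> * (z - j)) * ((1 - \<beta>) * (1 + \<beta> / 2))" by (simp only: mult_ac)
  also have "\<dots> \<le> (\<mu> * (z - j)) * (1 - \<beta> / 2)"
    using assms by (intro mult_left_mono) (auto simp: algebra_simps)
  also have "\<dots> \<le> ((z - j) * l) * (1 - \<beta> / 2)" by (rule mult_right_mono[OF l b])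
  finally have "j * (1 + \<beta> / 2) \<le> ((z - j) * l) * (1 - \<beta> / 2)" .
  moreover have "(1 - h) * (j + X) = 2 * j - j * (1 + h) + X * (1 - h)" for h X by (simp add: algebra_simps)
  ultimately have "2 * j \<le> (1 - \<beta> / 2) * (j + (z - j) * l)" by simp
  then show ?thesis unfolding eq using den by (simp add: divide_le_eq)
qed

text \<open>The factor is j / (j + X) with X = (z - j) * \<mu>, where X \<le> j / (1 + \<beta>); the
  constant 1 / 4 is small enough for 1 + \<beta> / 4 \<le> (1 - \<beta> / 4) * (1 +
  \<beta>).\<close>

lemma filter_factor_ge:
  fixes \<mu> \<beta> :: real
  assumes "0 < j" "j < z" "0 < \<mu>" "0 \<le> \<beta>" "\<beta> \<le> 1"
    and y: "(1 + \<beta>) * \<mu> * (z - j) \<le> j"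
  defines "p \<equiv> j / z"
  shows "(1 + \<beta> / 4) / 2 \<le> p / (p + (1 - p) * \<mu>)"
proof -
  have eq: "p / (p + (1 - p) * \<mu>) = j / (j + (z - j) * \<mu>)"
    using assms by (simp add: p_def field_simps)
  have den: "0 < j + (z - j) * \<mu>" using assms by (intro add_pos_pos mult_pos_pos) auto
  have b2: "\<beta> * \<beta> \<le> \<beta> * 1" using assms by (intro mult_left_mono) auto
  have "(1 - h) * (1 + \<beta>) = 1 + \<beta> - h - h * \<beta>" for h by (simp add: algebra_simps)
  from this[of "\<beta> / 4"] have "1 + \<beta> / 4 \<le> (1 - \<beta> / 4) * (1 + \<beta>)" using b2 assms by simp
  then have "(1 + \<beta> / 4) * ((z - j) * \<mu>) \<le> ((1 - \<beta> / 4) * (1 + \<beta>)) * ((z - j) * \<mu>)"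
    using assms by (intro mult_right_mono mult_nonneg_nonneg) auto
  also have "\<dots> = (1 - \<beta> / 4) * ((1 + \<beta>) * \<mu> * (z - j))" by (simp only: mult_ac)
  also have "\<dots> \<le> (1 - \<beta> / 4) * j" using y assms by (intro mult_left_mono) auto
  finally have "(1 + \<beta> / 4) * ((z - j) * \<mu>) \<le> (1 - \<beta> / 4) * j" .
  moreover have "(1 + h) * (j + X) = 2 * j - (1 - h) * j + (1 + h) * X" for h X by (simp add: algebra_simps)
  ultimately have "(1 + \<beta> / 4) * (j + (z - j) * \<mu>) \<le> 2 * j" by simp
  then show ?thesis unfolding eq using den by (simp add: le_divide_eq)
qed

lemma sum_list_le_const:
  fixes f :: "'a \<Rightarrow> real"
  shows "(\<And>x. x \<in> set xs \<Longrightarrow> f x \<le> B) \<Longrightarrow> (\<Sum>x\<leftarrow>xs. f x) \<le> real (length xs) * B"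
  by (induction xs) (auto simp: algebra_simps intro: add_mono)

lemma sum_list_diff_le:
  fixes f g :: "'a \<Rightarrow> real"
  shows "(\<And>x. x \<in> set xs \<Longrightarrow> \<bar>f x - g x\<bar> \<le> B) \<Longrightarrow>
    \<bar>(\<Sum>x\<leftarrow>xs. f x) - (\<Sum>x\<leftarrow>xs. g x)\<bar> \<le> real (length xs) * B"
proof (induction xs)
  case Nil then show ?case by simp
next
  case (Cons a xs)
  have "\<bar>f a - g a\<bar> \<le> B" "\<bar>(\<Sum>x\<leftarrow>xs. f x) - (\<Sum>x\<leftarrow>xs. g x)\<bar> \<le> real (length xs) * B"
    using Cons by auto
  then show ?case by (simp add: algebra_simps)
qed

lemma member_le_sum_list:
  fixes f :: "'a \<Rightarrow> real"
  shows "a \<in> set xs \<Longrightarrow> (\<And>x. x \<in> set xs \<Longrightarrow> 0 \<le> f x) \<Longrightarrow> f a \<le> (\<Sum>x\<leftarrow>xs. f x)"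
proof (induction xs)
  case Nil then show ?case by simp
next
  case (Cons b xs)
  have "0 \<le> (\<Sum>x\<leftarrow>xs. f x)" using Cons.prems(2) by (intro sum_list_nonneg) auto
  then show ?case using Cons.IH Cons.prems by (cases "a = b") fastforce+
qed

text \<open>As j / (z - j) increases with j, both conditions hold on initial segments: c itself
  satisfies the upper one and c + 1 violates the lower one. So c / (z - c) lies between (1 -
  \<beta>) * \<mu> and (1 + \<beta>) * \<mu> except for the step from c to c + 1 in the lower bound,
  which \<open>big\<close> makes cost at most another \<beta> * \<mu>.\<close>

lemma count_accuracy:
  fixes \<mu> \<beta> :: real and z c :: int and k :: nat
  assumes z: "z = int k + 1" and \<mu>: "0 < \<mu>" "\<mu> \<le> 2" and \<beta>: "0 < \<beta>" "\<beta> \<le> 1 / 4" and big: "21 \<le> 2 * \<beta> * \<mu> * of_int z"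
    and lo: "(\<Sum>j<k. of_bool (real (Suc j) \<le> (1 - \<beta>) * \<mu> * (of_int z - real (Suc j)))) \<le> c"
    and hi: "c \<le> (\<Sum>j<k. of_bool (real (Suc j) < (1 + \<beta>) * \<mu> * (of_int z - real (Suc j))))"
  shows "mult_approx (2 * \<beta>) (of_int c / of_int (z - c)) \<mu>"
proof -
  let ?lo = "\<lambda>j. real j \<le> (1 - \<beta>) * \<mu> * (of_int z - real j)"
  let ?hi = "\<lambda>j. real j < (1 + \<beta>) * \<mu> * (of_int z - real j)"
  have "0 \<le> (\<Sum>j<k. of_bool (?lo (Suc j)) :: int)" by (intro sum_nonneg) auto
  then have c0: "0 \<le> c" using lo by linarith
  have "(\<Sum>j<k. of_bool (?hi (Suc j)) :: int) \<le> (\<Sum>j<k. 1)" by (intro sum_mono) auto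
  then have ck: "c \<le> int k" using hi by simp
  obtain q where q: "c = int q" using c0 by (metis nonneg_int_cases)
  have qk: "q \<le> k" using ck q by simp
  have zq: "0 < of_int z - real q" using qk z by simp
  have up: "real q < (1 + \<beta>) * \<mu> * (of_int z - real q)"
  proof (cases "q = 0")
    case True
    then show ?thesis using \<mu> \<beta> z by simp
  next
    case False
    show ?thesis
    proof (rule ccontr)
      assume n: "\<not> ?thesis"
      have "of_bool (?hi (Suc j)) \<le> (of_bool (Suc j < q) :: int)" if "j < k" for j
      proof (cases "Suc j < q")
        case F: False
        have "(1 + \<beta>) * \<mu> * (of_int z - real (Suc j)) \<le> (1 + \<beta>) * \<mu> * (of_int z - real q)"
          using F \<mu> \<beta> by (intro mult_left_mono) auto
        then have "\<not> ?hi (Suc j)" using n F by simp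
        then show ?thesis by simp
      qed simp
      then have "(\<Sum>j<k. of_bool (?hi (Suc j)) :: int) \<le> (\<Sum>j<k. of_bool (Suc j < q))" by (intro sum_mono) auto
      also have "\<dots> = int (card {j. j < k \<and> Suc j < q})"
        by (simp add: of_bool_def sum.If_cases Int_def)
      also have "{j. j < k \<and> Suc j < q} = {..<q - 1}" using qk by auto
      finally show False using hi q False by simp
    qed
  qed
  have up2: "(1 + \<beta>) * \<mu> \<le> 5 / 2" using \<mu> \<beta> mult_mono[of "1 + \<beta>" "5 / 4" \<mu> 2] by simp
  \<comment> \<open>The bound \<mu> \<le> 2 keeps the count away from z: q < 5 / 2 * (z - q). With
    21 = 2 * 3 * 7 / 2 this yields \<open>big2\<close>.\<close>
  have z7: "of_int z < 7 / 2 * (of_int z - real q)"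
  proof -
    have "(1 + \<beta>) * \<mu> * (of_int z - real q) \<le> 5 / 2 * (of_int z - real q)"
      using up2 zq by (intro mult_right_mono) auto
    then show ?thesis using up by simp
  qed
  have big2: "3 \<le> \<beta> * \<mu> * (of_int z - real q)"
  proof -
    have "\<beta> * \<mu> * of_int z \<le> \<beta> * \<mu> * (7 / 2 * (of_int z - real q))"
      using z7 \<mu> \<beta> by (intro mult_left_mono) auto
    moreover have "\<beta> * \<mu> * (7 / 2 * (of_int z - real q)) = 7 / 2 * (\<beta> * \<mu> * (of_int z - real q))"
      by (simp only: mult_ac)
    ultimately show ?thesis using big by linarith
  qed
  \<comment> \<open>The index q + 1 must still be one of the tested ones.\<close>
  have q1: "q < k"
  proof (rule ccontr)
    assume "\<not> ?thesis"
    then have "of_int z - real q = 1" using qk z by simp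
    moreover have "\<beta> * \<mu> \<le> 1 / 4 * 2" using \<mu> \<beta> by (intro mult_mono) auto
    ultimately show False using big2 by simp
  qed
  have low: "(1 - \<beta>) * \<mu> * (of_int z - real (Suc q)) < real (Suc q)"
  proof (rule ccontr)
    assume n: "\<not> ?thesis"
    have "(of_bool (j < Suc q) :: int) \<le> of_bool (?lo (Suc j))" if "j < k" for j
    proof (cases "j < Suc q")
      case True
      have "(1 - \<beta>) * \<mu> * (of_int z - real (Suc q)) \<le> (1 - \<beta>) * \<mu> * (of_int z - real (Suc j))"
        using True \<mu> \<beta> by (intro mult_left_mono) auto
      then have "?lo (Suc j)" using n True by simp
      then show ?thesis by simp
    qed simp
    then have "(\<Sum>j<k. of_bool (j < Suc q) :: int) \<le> (\<Sum>j<k. of_bool (?lo (Suc j)))" by (intro sum_mono) auto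
    moreover have "(\<Sum>j<k. of_bool (j < Suc q) :: int) = int (card {j. j < k \<and> j < Suc q})"
      by (simp add: of_bool_def sum.If_cases Int_def)
    moreover have "{j. j < k \<and> j < Suc q} = {..<Suc q}" using q1 by auto
    ultimately show False using lo q by simp
  qed
  have "(1 - \<beta>) * \<mu> \<le> 1 * 2" using \<mu> \<beta> by (intro mult_mono) auto
  moreover have "(1 - \<beta>) * \<mu> * (of_int z - real (Suc q)) = (1 - \<beta>) * \<mu> * (of_int z - real q) - (1 - \<beta>) * \<mu>"
    by (simp add: algebra_simps)
  \<comment> \<open>Here 3 = 1 + 2: one for passing from q to q + 1 on the right, and (1 - \<beta>)
    * \<mu> \<le> 2 for the same change on the left.\<close>
  ultimately have "(1 - \<beta>) * \<mu> * (of_int z - real q) - 3 < real q" using low by simp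
  then have low2: "(1 - 2 * \<beta>) * \<mu> * (of_int z - real q) < real q"
    using big2 by (simp add: algebra_simps)
  have "(1 - 2 * \<beta>) * \<mu> < real q / (of_int z - real q)" using low2 zq by (simp add: less_divide_eq)
  moreover have "real q / (of_int z - real q) < (1 + \<beta>) * \<mu>" using up zq by (simp add: divide_less_eq)
  moreover have "0 < \<beta> * \<mu>" using \<mu> \<beta> by simp
  ultimately show ?thesis using \<mu> by (simp add: mult_approx_def q abs_le_iff algebra_simps)
qed

section \<open>Choice of the constants and failure probability\<close>

context sampled_walk
begin

text \<open>With Z = 2 ^ m, \<open>S j\<close> is at most 1 / (2 * Z) below the window around \<mu>
  and at least 2 / Z above it, while inexact coins and the cut-off shift it by at most 1 / (8 * Z).
  So a test against 1 / Z can err only through a fluctuation of order 1 / Z. The exponent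
  \<open>s\<close> is such that 2 ^ s dominates 4 * n, 1 / a and 2 / \<mu>.\<close>

lemma counting_accurate:
  assumes par: "M = 5 * m" "T = 2 ^ m * 2 ^ m" "thr = 2 ^ m * (2 ^ m * 2 ^ m) * g" "NN = thr * 2 ^ m * n"
    and m: "m = 8 * 2 ^ k * s" and k: "1 \<le> k" and s: "4 \<le> s"
    and n: "4 * real n \<le> 2 ^ s" and a: "1 \<le> a * 2 ^ s"
    and g: "1 \<le> g" "1 / 2 ^ g \<le> \<gamma>"
    and \<mu>: "smallest_nonzero_eigenvalue L \<mu>" "2 \<le> \<mu> * 2 ^ s"
  shows "1 - \<gamma> \<le> measure_pmf.prob (counting (2 ^ m - 1)) {c. mult_approx (1 / 2 ^ k) (of_int c / of_int (2 ^ m - c)) \<mu>}"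
proof -
  define Z where "Z = (2::real) ^ m"
  define D where "D = (2::real) ^ k"
  \<comment> \<open>Half the target accuracy, because \<open>count_accuracy\<close> loses a factor
    2.\<close>
  define \<beta> where "\<beta> = 1 / (2 * D)"
  define N where "N = thr * 2 ^ m"
  have mD: "real m = 8 * D * real s" by (simp add: m D_def)
  have D2: "2 \<le> D" unfolding D_def using k power_increasing[of 1 k "2::real"] by simp
  have \<beta>: "0 < \<beta>" "\<beta> \<le> 1 / 4" using D2 by (auto simp: \<beta>_def field_simps)
  have ms: "16 * s \<le> m" unfolding m using k power_increasing[of 1 k "2::nat"] by simp
  have m64: "64 \<le> m" using ms s by simp
  have Zs: "2 ^ (16 * s) \<le> Z" unfolding Z_def by (rule power_increasing[OF ms]) simp
  have s1: "(1::real) \<le> 2 ^ s" by simp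
  have n1: "1 \<le> real n" using n_pos by simp
  have nn: "real n \<le> 2 ^ s" using n n1 by linarith
  have Z16: "(2 ^ s) ^ 16 \<le> Z" using Zs by (simp add: power_mult[symmetric] mult.commute)
  have s16: "16 \<le> (2::real) ^ s" using power_increasing[OF s, of "2::real"] by simp
  have Z1: "1 \<le> Z" by (simp add: Z_def)
  have Z8: "(2 ^ s) ^ j \<le> Z" if "j \<le> 16" for j
    by (rule order_trans[OF power_increasing[OF that s1] Z16])
  have \<mu>e: "eigenvalue L \<mu>" "\<mu> \<noteq> 0" "\<And>l. eigenvalue L l \<Longrightarrow> l \<noteq> 0 \<Longrightarrow> \<mu> \<le> l"
    using \<mu>(1) by (auto simp: smallest_nonzero_eigenvalue_def)
  have \<mu>0: "0 < \<mu>" using \<mu>(2) by (metis less_le_trans zero_less_mult_pos2 zero_less_numeral zero_less_power)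
  have \<mu>2: "\<mu> \<le> 2" using eigenvalue_bound[OF \<mu>e(1)] by simp
  obtain es where es: "length es = n" "\<And>l. l \<in> set es \<longleftrightarrow> eigenvalue L l"
    "\<And>p t r. (\<Sum>v<n. walk_val p v t r v) = (\<Sum>l\<leftarrow>es. filter_val p l t r)"
    by (rule sum_walk_val) blast
  have l: "\<bar>1 - l\<bar> \<le> 1" "0 \<le> l" "l \<le> 2" if "l \<in> set es" for l
    using eigenvalue_bound[of l] es(2) that by auto
  define x where "x j l = (real j / Z) / (real j / Z + (1 - real j / Z) * l)" for j l
  define S where "S j = (\<Sum>l\<leftarrow>es. l * x j l ^ m)" for j
  define S' where "S' j = (\<Sum>v<n. mean j v)" for j
  have jZ: "real j < Z" if "j < 2 ^ m" for j
    unfolding Z_def using that by (metis of_nat_less_iff of_nat_numeral of_nat_power)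

  \<comment> \<open>A coin errs by about 1 / Z ^ 5 up to powers of 2 ^ s; Z ^ 2 ticks leave 1 / Z ^
    3, and Z \<ge> (2 ^ s) ^ 16 absorbs the rest. Hence the choice M = 5 * m.\<close>
  have walk: "real n * ((real T + 1) * walk_err) \<le> 1 / (16 * Z)"
  proof -
    have "1 * 1 \<le> Z * Z" using Z1 by (intro mult_mono) auto
    moreover have "real T = Z * Z" by (simp add: par Z_def)
    ultimately have e1: "real T + 1 \<le> 2 * Z ^ 2" by (simp add: power2_eq_square)
    have a1: "1 / a \<le> 2 ^ s" using a a0 by (simp add: divide_le_eq mult.commute)
    have "coin_err = 1 / 2 ^ (2 * M) + real n / (2 ^ M * a)" by (rule coin_err_def)
    also have "\<dots> = 1 / Z ^ 10 + real n * (1 / a) / Z ^ 5"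
      by (simp add: par(1) Z_def power_mult[symmetric] mult.commute)
    also have "\<dots> \<le> 1 / Z ^ 5 + real n * 2 ^ s / Z ^ 5"
      using a1 Z1 n1 power_increasing[of 5 10 Z] by (intro add_mono divide_right_mono mult_left_mono divide_left_mono) auto
    also have "\<dots> \<le> 2 ^ s * 2 ^ s / Z ^ 5"
    proof -
      have "real n * 2 ^ s \<le> (2 ^ s * 2 ^ s) / 4" using mult_right_mono[OF n, of "2 ^ s"] by simp
      moreover have "1 * 1 \<le> (2::real) ^ s * 2 ^ s" using s1 by (intro mult_mono) auto
      moreover have "(16::real) * 16 \<le> 2 ^ s * 2 ^ s" by (intro mult_mono s16) auto
      ultimately have "1 + real n * 2 ^ s \<le> 2 ^ s * 2 ^ s" by linarith
      then show ?thesis using Z1 by (simp add: add_divide_distrib[symmetric] divide_right_mono)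
    qed
    finally have c: "coin_err \<le> 2 ^ s * 2 ^ s / Z ^ 5" .
    have "walk_err \<le> 2 * 2 ^ s * (2 ^ s * 2 ^ s / Z ^ 5)"
      unfolding walk_err_def using c nn coin_err_nonneg by (intro mult_mono) auto
    then have "real n * ((real T + 1) * walk_err) \<le> 2 ^ s * ((2 * Z ^ 2) * (2 * 2 ^ s * (2 ^ s * 2 ^ s / Z ^ 5)))"
      using nn e1 walk_err_nonneg Z1 by (intro mult_mono mult_nonneg_nonneg) auto
    also have "\<dots> = 4 * (2 ^ s) ^ 4 / Z ^ 3"
      using Z1 by (simp add: power2_eq_square power3_eq_cube field_simps eval_nat_numeral)
    also have "\<dots> \<le> 1 / (16 * Z)"
    proof -
      have "4 * (2 ^ s) ^ 4 * 16 \<le> (2 ^ s) ^ 2 * (2 ^ s) ^ 4 * (1::real)"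
        using mult_mono[OF s16 s16] by (simp add: power2_eq_square)
      also have "\<dots> = (2 ^ s) ^ 6" by (simp add: power_add[symmetric])
      also have "\<dots> \<le> Z * Z" using Z8[of 6] Z1 mult_mono[of "(2 ^ s) ^ 6" Z 1 Z] by simp
      finally have "4 * (2 ^ s) ^ 4 * (16 * Z) \<le> Z * Z * Z" using Z1 mult_right_mono[of "4 * (2 ^ s) ^ 4 * 16" "Z * Z" Z] by simp
      then show ?thesis using Z1 by (simp add: divide_simps power3_eq_cube mult.assoc)
    qed
    finally show ?thesis .
  qed

  \<comment> \<open>Since p \<ge> 1 / Z, the contraction rate 1 - p / 2 at least halves the error in
    every block of 2 * Z ticks; Z / 2 blocks fit into \<open>T\<close>, and 4 * m of them are
    enough.\<close>
  have trunc: "real n * (2 * 2 ^ m * (1 - real j / Z / 2) ^ T) \<le> 1 / (16 * Z)" if j: "0 < j" "j < 2 ^ m" for j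
  proof -
    define q where "q = 1 / (2 * Z)"
    have "real (2 * 2 ^ m) * q = 1" by (simp add: q_def Z_def)
    then have "1 \<le> real (2 * 2 ^ m) * q" by (rule eq_refl[OF sym])
    moreover have "0 \<le> q" "q \<le> 1" using Z1 by (simp_all add: q_def divide_le_eq)
    ultimately have q: "0 \<le> q" "q \<le> 1" "1 \<le> real (2 * 2 ^ m) * q" by simp_all
    have "1 / Z \<le> real j / Z" using j Z1 by (intro divide_right_mono) auto
    then have "1 - real j / Z / 2 \<le> 1 - q" by (simp add: q_def)
    moreover have pos: "0 \<le> 1 - real j / Z / 2" using jZ[OF j(2)] Z1 by (simp add: divide_le_eq)
    ultimately have "(1 - real j / Z / 2) ^ T \<le> (1 - q) ^ T" by (rule power_mono)
    also have "(1 - q) ^ T = ((1 - q) ^ (2 * 2 ^ m)) ^ (2 ^ (m - 1))"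
    proof -
      have "(2::nat) ^ m = 2 * 2 ^ (m - 1)" using m64 by (cases m) auto
      then have "T = (2 * 2 ^ m) * 2 ^ (m - 1)" unfolding par(2) by (metis mult.commute mult.left_commute)
      then show ?thesis by (simp only: power_mult)
    qed
    also have "\<dots> \<le> (1 / 2) ^ (2 ^ (m - 1))"
      using power_le_half[OF q] q by (intro power_mono zero_le_power) auto
    also have "\<dots> \<le> (1 / 2) ^ (4 * m)"
      using four_mult_le_power[of m] m64 by (intro power_decreasing) auto
    also have "\<dots> = 1 / Z ^ 4" by (simp add: Z_def power_mult[symmetric] power_one_over mult.commute)
    finally have e: "(1 - real j / Z / 2) ^ T \<le> 1 / Z ^ 4" .
    have "2 * Z * (1 - real j / Z / 2) ^ T \<le> 2 * Z * (1 / Z ^ 4)"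
      using e Z1 by (intro mult_left_mono) auto
    then have "2 * 2 ^ m * (1 - real j / Z / 2) ^ T \<le> 2 * Z * (1 / Z ^ 4)"
      by (simp only: Z_def)
    then have "real n * (2 * 2 ^ m * (1 - real j / Z / 2) ^ T) \<le> 2 ^ s * (2 * Z * (1 / Z ^ 4))"
      using nn pos by (intro mult_mono[OF nn]) auto
    also have "\<dots> = 2 * 2 ^ s / Z ^ 3" using Z1 by (simp add: field_simps eval_nat_numeral)
    also have "\<dots> \<le> 1 / (16 * Z)"
    proof -
      have "2 * 2 ^ s * 16 \<le> 2 ^ s * (2 ^ s * (2::real) ^ s)" using s16 mult_mono[OF s16 s16] by (simp add: mult_le_cancel_left)
      also have "\<dots> = (2 ^ s) ^ 3" by (simp add: power3_eq_cube)
      also have "\<dots> \<le> Z * Z" using Z8[of 3] Z1 mult_mono[of "(2 ^ s) ^ 3" Z 1 Z] by simp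
      finally have "2 * 2 ^ s * (16 * Z) \<le> Z * Z * Z" using Z1 mult_right_mono[of "2 * 2 ^ s * 16" "Z * Z" Z] by simp
      then show ?thesis using Z1 by (simp add: divide_simps power3_eq_cube mult.assoc)
    qed
    finally show ?thesis .
  qed

  have acc: "\<bar>S' j - S j\<bar> \<le> 1 / (8 * Z)" if j: "0 < j" "j < 2 ^ m" for j
  proof -
    let ?p = "real j / Z"
    have p: "0 < ?p" "?p \<le> 1" using j jZ[OF j(2)] Z1 by (simp_all add: divide_le_eq)
    have "\<bar>S' j - (\<Sum>v<n. walk_val ?p v T m v)\<bar> \<le> (\<Sum>v<n. \<bar>mean j v - walk_val ?p v T m v\<bar>)"
      unfolding S'_def sum_subtractf[symmetric] by (rule sum_abs)
    also have "\<dots> \<le> (\<Sum>v<n. (real T + 1) * walk_err)"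
      using mean_error[of j] j by (intro sum_mono) (auto simp: Z_def)
    finally have 1: "\<bar>S' j - (\<Sum>v<n. walk_val ?p v T m v)\<bar> \<le> 1 / (16 * Z)" using walk by simp
    have "\<bar>(\<Sum>l\<leftarrow>es. filter_val ?p l T m) - S j\<bar> \<le> real (length es) * (2 * 2 ^ m * (1 - ?p / 2) ^ T)"
      unfolding S_def x_def
    proof (rule sum_list_diff_le)
      fix l' assume "l' \<in> set es"
      from filter_val_error[OF p l(1)[OF this], of T m]
      show "\<bar>filter_val ?p l' T m - l' * (?p / (?p + (1 - ?p) * l')) ^ m\<bar> \<le> 2 * 2 ^ m * (1 - ?p / 2) ^ T" .
    qed
    also have "\<dots> \<le> 1 / (16 * Z)" using trunc[OF j] es(1) by simp
    finally show ?thesis using 1 es(3)[of ?p T m] by simp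
  qed

  have x0: "0 \<le> x j l" if "j < 2 ^ m" "0 \<le> l" for j l
    unfolding x_def using jZ[OF that(1)] that(2) Z1 by (intro divide_nonneg_nonneg add_nonneg_nonneg mult_nonneg_nonneg) (auto simp: divide_le_eq)

  have small: "S j \<le> 1 / (2 * Z)" if j: "0 < j" "j < 2 ^ m" and y: "real j \<le> (1 - \<beta>) * \<mu> * (Z - real j)" for j
  proof -
    have "l * x j l ^ m \<le> 2 * ((1 - \<beta> / 2) / 2) ^ m" if le: "l \<in> set es" for l
    proof (cases "l = 0")
      case True then show ?thesis using \<beta> by simp
    next
      case False
      then have "\<mu> \<le> l" using \<mu>e(3) es(2) le by blast
      then have "x j l \<le> (1 - \<beta> / 2) / 2" unfolding x_def
        using j jZ[OF j(2)] \<mu>0 \<beta> y by (intro filter_factor_le[of "real j" Z \<mu>]) auto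
      then have "x j l ^ m \<le> ((1 - \<beta> / 2) / 2) ^ m" using x0[OF j(2) l(2)[OF le]] by (intro power_mono)
      then show ?thesis using l[OF le] x0[OF j(2) l(2)[OF le]] by (intro mult_mono) auto
    qed
    then have "S j \<le> real (length es) * (2 * ((1 - \<beta> / 2) / 2) ^ m)"
      unfolding S_def by (rule sum_list_le_const)
    also have "\<dots> = 2 * real n * (1 - \<beta> / 2) ^ m / Z" by (simp add: es Z_def power_divide)
    \<comment> \<open>As \<beta> / 2 = 1 / (4 * D), every 4 * 2 ^ k factors halve; the 2 * s
      halvings beat the 2 * n from summing over the spectrum.\<close>
    also have "(1 - \<beta> / 2) ^ m \<le> (1 / 2) ^ (2 * s)"
    proof -
      have "m = (4 * 2 ^ k) * (2 * s)" by (simp add: m)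
      then have "(1 - \<beta> / 2) ^ m = ((1 - \<beta> / 2) ^ (4 * 2 ^ k)) ^ (2 * s)" by (simp only: power_mult)
      also have "\<dots> \<le> (1 / 2) ^ (2 * s)"
        using \<beta> D2 by (intro power_mono power_le_half zero_le_power) (auto simp: \<beta>_def D_def)
      finally show ?thesis .
    qed
    also have "2 * real n * (1 / 2) ^ (2 * s) / Z \<le> 1 / (2 * Z)"
    proof -
      have "4 * real n \<le> 2 ^ s * 2 ^ s" using n s1 mult_mono[of "4 * real n" "2 ^ s" 1 "2 ^ s"] by simp
      then have "2 * real n * (1 / 2) ^ (2 * s) \<le> 1 / 2"
        by (simp add: power_one_over power_add[symmetric] mult_2[symmetric] divide_simps)
      then show ?thesis using Z1 by (simp add: divide_simps)
    qed
    finally show ?thesis using n1 Z1 by (simp add: divide_right_mono mult_left_mono)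
  qed

  have large: "2 / Z \<le> S j" if j: "0 < j" "j < 2 ^ m" and y: "(1 + \<beta>) * \<mu> * (Z - real j) \<le> real j" for j
  proof -
    have "(1 + \<beta> / 4) / 2 \<le> x j \<mu>" unfolding x_def
      using j jZ[OF j(2)] \<mu>0 \<beta> y by (intro filter_factor_ge) auto
    then have "((1 + \<beta> / 4) / 2) ^ m \<le> x j \<mu> ^ m" using \<beta> by (intro power_mono) auto
    then have 1: "\<mu> * ((1 + \<beta> / 4) / 2) ^ m \<le> \<mu> * x j \<mu> ^ m" using \<mu>0 by (intro mult_left_mono) auto
    have "\<mu> * x j \<mu> ^ m \<le> S j"
      unfolding S_def by (rule member_le_sum_list) (use es(2) \<mu>e(1) x0[OF j(2)] l(2) in auto)
    then have 2: "\<mu> * (1 + \<beta> / 4) ^ m / Z \<le> S j" using 1 by (simp add: power_divide Z_def)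
    \<comment> \<open>As \<beta> / 4 = 1 / (8 * D), every 8 * 2 ^ k factors double; the
      \<open>s\<close> doublings make up for a \<mu> as small as 2 / 2 ^ s. This fixes the 8 in
      m.\<close>
    have "m = (8 * 2 ^ k) * s" by (simp add: m)
    then have "(1 + \<beta> / 4) ^ m = ((1 + \<beta> / 4) ^ (8 * 2 ^ k)) ^ s" by (simp only: power_mult)
    also have "\<dots> \<ge> 2 ^ s"
      using \<beta> D2 by (intro power_mono power_ge_two) (auto simp: \<beta>_def D_def)
    finally have "\<mu> * 2 ^ s \<le> \<mu> * (1 + \<beta> / 4) ^ m" using \<mu>0 by (intro mult_left_mono) auto
    then have "2 / Z \<le> \<mu> * (1 + \<beta> / 4) ^ m / Z" using \<mu>(2) Z1 by (intro divide_right_mono) auto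
    then show ?thesis using 2 by simp
  qed

  define \<epsilon> where "\<epsilon> = \<gamma> / Z"
  \<comment> \<open>Makes the second-order term n * \<theta> ^ 2 equal to \<theta> / (8 * Z): in
    units of 1 / Z, it takes 1 / 8 of the margin 3 / 8 between mean and threshold and leaves the 1 /
    4 in \<open>final\<close>.\<close>
  define \<theta> where "\<theta> = 1 / (8 * real n * Z)"
  have NN: "NN = N * n" by (simp add: par N_def)
  have Nr: "real N = Z ^ 4 * real g" by (simp add: N_def par Z_def power_add[symmetric] eval_nat_numeral algebra_simps)
  have thr: "real thr = real N / Z" using Z1 by (simp add: N_def Z_def)
  have \<theta>: "0 < \<theta>" "\<theta> \<le> 1" "real n * \<theta>\<^sup>2 = \<theta> / (8 * Z)"
  proof -
    show "0 < \<theta>" using n1 Z1 by (simp add: \<theta>_def)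
    have "1 * 1 \<le> (8 * real n) * Z" using n1 Z1 by (intro mult_mono) auto
    moreover have "1 / x \<le> 1" if "1 \<le> x" for x :: real using that by (simp add: divide_le_eq)
    ultimately show "\<theta> \<le> 1" by (simp add: \<theta>_def del: divide_le_eq_1_pos)
    show "real n * \<theta>\<^sup>2 = \<theta> / (8 * Z)" using n1 Z1 by (simp add: \<theta>_def power2_eq_square)
  qed
  \<comment> \<open>The exponent is Z ^ 2 * g / (32 * n), at least Z * g and so at least m + g: this
    pays for the union over fewer than 2 ^ m tests and for 2 ^ (- g) \<le> \<gamma>.\<close>
  have final: "exp (- (real N * (\<theta> / (4 * Z)))) \<le> \<epsilon>"
  proof -
    have "32 * real n \<le> Z"
    proof -
      have "32 * real n \<le> 8 * 2 ^ s" using n by simp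
      also have "\<dots> \<le> 2 ^ s * 2 ^ s" using s16 by (intro mult_right_mono) auto
      also have "\<dots> \<le> Z" using Z8[of 2] by (simp add: power2_eq_square)
      finally show ?thesis .
    qed
    then have nz: "1 \<le> Z / (32 * real n)" using n1 by (simp add: le_divide_eq)
    have "real N * (\<theta> / (4 * Z)) = (Z / (32 * real n)) * (Z * real g)"
      using Z1 n1 by (simp add: Nr \<theta>_def field_simps eval_nat_numeral)
    also have "\<dots> \<ge> 1 * (Z * real g)" using nz Z1 by (intro mult_right_mono) auto
    also have "1 * (Z * real g) \<ge> real m + real g"
    proof -
      have "Suc m \<le> 2 ^ m" by (simp add: Suc_leI)
      then have "Suc m * g \<le> 2 ^ m * g" by (rule mult_right_mono) simp
      moreover have "m + g \<le> Suc m * g"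
      proof -
        have "m \<le> m * g" using g(1) by simp
        then have "m + g \<le> m * g + g" by (rule add_right_mono)
        then show ?thesis by (simp only: mult_Suc add.commute)
      qed
      ultimately have "m + g \<le> 2 ^ m * g" by (rule order_trans[rotated])
      then have "real (m + g) \<le> real (2 ^ m * g)" by (simp only: of_nat_le_iff)
      then show ?thesis by (simp add: Z_def)
    qed
    finally have "real m + real g \<le> real N * (\<theta> / (4 * Z))" by simp
    then have "exp (- (real N * (\<theta> / (4 * Z)))) \<le> exp (- real m) * exp (- real g)"
      by (simp add: exp_add[symmetric])
    also have "\<dots> \<le> (1 / Z) * \<gamma>"
    proof -
      have e: "exp (- real i) \<le> 1 / 2 ^ i" for i
      proof -
        have "(2::real) ^ i \<le> exp 1 ^ i" using exp_ge_add_one_self[of 1] by (intro power_mono) auto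
        also have "\<dots> = exp (real i)" by (simp add: exp_of_nat_mult[symmetric])
        finally show ?thesis by (simp add: exp_minus divide_simps)
      qed
      have "exp (- real g) \<le> \<gamma>" using e[of g] g(2) by simp
      then show ?thesis using e[of m] Z1 by (intro mult_mono) (auto simp: Z_def)
    qed
    finally show ?thesis by (simp add: \<epsilon>_def)
  qed
  have fail_hi: "measure_pmf.prob (total j) {acc. \<not> acc \<le> int thr} \<le> \<epsilon>"
    if j: "0 < j" "j < 2 ^ m" and y: "real j \<le> (1 - \<beta>) * \<mu> * (Z - real j)" for j
  proof -
    have Sj: "S' j \<le> 5 / 8 / Z" using small[OF j y] acc[OF j] by (simp add: abs_le_iff)
    have "measure_pmf.prob (total j) {acc. \<not> acc \<le> int thr} \<le> exp (real N * (\<theta> * S' j + real n * \<theta>\<^sup>2) - \<theta> * real thr)"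
      unfolding S'_def using \<theta> by (intro total_tail[OF NN]) auto
    also have "\<dots> \<le> exp (- (real N * (\<theta> / (4 * Z))))"
    proof -
      have "\<theta> * S' j \<le> \<theta> * (5 / 8 / Z)" using Sj \<theta> by (intro mult_left_mono) auto
      then have "real N * (\<theta> * S' j + real n * \<theta>\<^sup>2) \<le> real N * (\<theta> * (5 / 8 / Z) + \<theta> / (8 * Z))"
        unfolding \<theta>(3) by (intro mult_left_mono) auto
      also have "\<dots> - \<theta> * real thr = - (real N * (\<theta> / (4 * Z)))"
        unfolding thr using Z1 by (simp add: field_simps)
      finally show ?thesis by simp
    qed
    finally show ?thesis using final by simp
  qed
  have fail_lo: "measure_pmf.prob (total j) {acc. acc \<le> int thr} \<le> \<epsilon>"
    if j: "0 < j" "j < 2 ^ m" and y: "(1 + \<beta>) * \<mu> * (Z - real j) \<le> real j" for j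
  proof -
    \<comment> \<open>Only 11 / 8 of the available 15 / 8 is used, so that the margin is the same as
      in \<open>fail_hi\<close>.\<close>
    have "1 / (8 * Z) + 11 / 8 / Z \<le> 2 / Z" using Z1 by (simp add: field_simps)
    then have Sj: "11 / 8 / Z \<le> S' j" using large[OF j y] acc[OF j] by (simp add: abs_le_iff)
    have "measure_pmf.prob (total j) {acc. acc \<le> int thr} \<le> exp (real N * (- \<theta> * S' j + real n * (- \<theta>)\<^sup>2) - (- \<theta>) * real thr)"
      unfolding S'_def using \<theta> by (intro total_tail[OF NN]) auto
    also have "\<dots> \<le> exp (- (real N * (\<theta> / (4 * Z))))"
    proof -
      have "\<theta> * (11 / 8 / Z) \<le> \<theta> * S' j" using Sj \<theta> by (intro mult_left_mono) auto
      then have "- \<theta> * S' j \<le> - \<theta> * (11 / 8 / Z)" by (simp only: mult_minus_left neg_le_iff_le)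
      then have "- \<theta> * S' j + \<theta> / (8 * Z) \<le> - \<theta> * (11 / 8 / Z) + \<theta> / (8 * Z)" by (rule add_right_mono)
      then have "real N * (- \<theta> * S' j + real n * (- \<theta>)\<^sup>2) \<le> real N * (- \<theta> * (11 / 8 / Z) + \<theta> / (8 * Z))"
        unfolding power2_minus \<theta>(3) by (rule mult_left_mono) simp
      also have "\<dots> - (- \<theta>) * real thr = - (real N * (\<theta> / (4 * Z)))"
        unfolding thr using Z1 by (simp add: field_simps)
      finally show ?thesis by simp
    qed
    finally show ?thesis using final by simp
  qed

  let ?k = "2 ^ m - 1 :: nat"
  let ?lo = "\<lambda>j. of_bool (real (Suc j) \<le> (1 - \<beta>) * \<mu> * (Z - real (Suc j))) :: int"
  let ?hi = "\<lambda>j. of_bool (real (Suc j) < (1 + \<beta>) * \<mu> * (Z - real (Suc j))) :: int"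
  have \<epsilon>0: "0 \<le> \<epsilon>" using final by (meson exp_ge_zero order_trans)
  have bad: "measure_pmf.prob (counting ?k) {c. \<not> ((\<Sum>j<?k. ?lo j) \<le> c \<and> c \<le> (\<Sum>j<?k. ?hi j))} \<le> real ?k * \<epsilon>"
  proof (rule counting_bound)
    fix j assume "j < ?k"
    then have j: "0 < Suc j" "Suc j < 2 ^ m" by auto
    have excl: "\<not> (real (Suc j) \<le> (1 - \<beta>) * \<mu> * (Z - real (Suc j)) \<and> (1 + \<beta>) * \<mu> * (Z - real (Suc j)) \<le> real (Suc j))"
    proof
      assume "real (Suc j) \<le> (1 - \<beta>) * \<mu> * (Z - real (Suc j)) \<and> (1 + \<beta>) * \<mu> * (Z - real (Suc j)) \<le> real (Suc j)"
      then have "(1 + \<beta>) * (\<mu> * (Z - real (Suc j))) \<le> (1 - \<beta>) * (\<mu> * (Z - real (Suc j)))" by (simp add: mult.assoc)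
      moreover have "0 < \<mu> * (Z - real (Suc j))" using \<mu>0 jZ[OF j(2)] by (intro mult_pos_pos) auto
      ultimately have "1 + \<beta> \<le> 1 - \<beta>" by (simp only: mult_le_cancel_right_pos)
      then show False using \<beta> by simp
    qed
    consider "real (Suc j) \<le> (1 - \<beta>) * \<mu> * (Z - real (Suc j))" | "(1 + \<beta>) * \<mu> * (Z - real (Suc j)) \<le> real (Suc j)"
      | "\<not> real (Suc j) \<le> (1 - \<beta>) * \<mu> * (Z - real (Suc j))" "\<not> (1 + \<beta>) * \<mu> * (Z - real (Suc j)) \<le> real (Suc j)" by blast
    then show "measure_pmf.prob (total (Suc j))
        {acc. \<not> (?lo j \<le> of_bool (acc \<le> int thr) \<and> of_bool (acc \<le> int thr) \<le> ?hi j)} \<le> \<epsilon>"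
    proof cases
      case 1
      then have "?lo j = 1" "?hi j = 1" using excl by auto
      then have "{acc. \<not> (?lo j \<le> of_bool (acc \<le> int thr) \<and> of_bool (acc \<le> int thr) \<le> ?hi j)} = {acc. \<not> acc \<le> int thr}"
        by (simp only: of_bool_def) auto
      then show ?thesis using fail_hi[OF j 1] by simp
    next
      case 2
      then have "?lo j = 0" "?hi j = 0" using excl by auto
      then have "{acc. \<not> (?lo j \<le> of_bool (acc \<le> int thr) \<and> of_bool (acc \<le> int thr) \<le> ?hi j)} = {acc. acc \<le> int thr}"
        by (simp only: of_bool_def) auto
      then show ?thesis using fail_lo[OF j 2] by simp
    next
      case 3
      then have "?lo j = 0" "?hi j = 1" by auto
      then have "{acc. \<not> (?lo j \<le> of_bool (acc \<le> int thr) \<and> of_bool (acc \<le> int thr) \<le> ?hi j)} = {}"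
        by (simp only: of_bool_def) auto
      then show ?thesis using \<epsilon>0 by simp
    qed
  qed
  also have "real ?k * \<epsilon> \<le> Z * \<epsilon>"
    using \<epsilon>0 by (intro mult_right_mono) (auto simp: Z_def of_nat_diff)
  also have "\<dots> = \<gamma>" using Z1 by (simp add: \<epsilon>_def)
  finally have bad': "measure_pmf.prob (counting ?k) {c. \<not> ((\<Sum>j<?k. ?lo j) \<le> c \<and> c \<le> (\<Sum>j<?k. ?hi j))} \<le> \<gamma>" .
  have big: "21 \<le> 2 * \<beta> * \<mu> * Z"
  proof -
    have "D \<le> 2 ^ (2 ^ k)" unfolding D_def by (intro power_increasing) (auto simp: less_imp_le)
    also have "\<dots> \<le> 2 ^ (2 ^ k * s)" using s by (intro power_increasing) auto
    finally have D: "D \<le> 2 ^ (2 ^ k * s)" .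
    have s': "(2::real) ^ s \<le> 2 ^ (2 ^ k * s)" by (intro power_increasing) auto
    have "21 * D * 2 ^ s \<le> (2 ^ (2 ^ k * s) * 2 ^ (2 ^ k * s)) * 2 ^ (2 ^ k * s) * 2 ^ (2 ^ k * s)"
    proof (intro mult_mono D s')
      have "(16::real) * 16 \<le> 2 ^ (2 ^ k * s) * 2 ^ (2 ^ k * s)"
        by (intro mult_mono order_trans[OF s16 s']) auto
      then show "(21::real) \<le> 2 ^ (2 ^ k * s) * 2 ^ (2 ^ k * s)" by simp
    qed (auto simp: D_def)
    also have "\<dots> = 2 ^ (4 * (2 ^ k * s))" by (simp add: power_add[symmetric])
    also have "\<dots> \<le> Z" unfolding Z_def m by (intro power_increasing) auto
    finally have DZ: "21 * D * 2 ^ s \<le> Z" .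
    have "21 * D * 2 \<le> 21 * D * (\<mu> * 2 ^ s)" using \<mu>(2) D2 by (intro mult_left_mono) auto
    also have "\<dots> = \<mu> * (21 * D * 2 ^ s)" by simp
    also have "\<dots> \<le> \<mu> * Z" using DZ \<mu>0 by (intro mult_left_mono) auto
    finally have "21 * D \<le> \<mu> * Z" using D2 by simp
    then show ?thesis using D2 by (simp add: \<beta>_def le_divide_eq)
  qed
  have zk: "(2::int) ^ m = int ?k + 1" by (simp add: of_nat_diff)
  have sub: "{c. (\<Sum>j<?k. ?lo j) \<le> c \<and> c \<le> (\<Sum>j<?k. ?hi j)} \<subseteq> {c. mult_approx (1 / 2 ^ k) (of_int c / of_int (2 ^ m - c)) \<mu>}"
  proof safe
    fix c assume c: "(\<Sum>j<?k. ?lo j) \<le> c" "c \<le> (\<Sum>j<?k. ?hi j)"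
    have "mult_approx (2 * \<beta>) (of_int c / of_int (2 ^ m - c)) \<mu>"
      by (rule count_accuracy[OF zk \<mu>0 \<mu>2 \<beta>]) (use c big in \<open>simp_all add: Z_def\<close>)
    then show "mult_approx (1 / 2 ^ k) (of_int c / of_int (2 ^ m - c)) \<mu>" using D2 by (simp add: \<beta>_def D_def)
  qed
  have "1 - \<gamma> \<le> 1 - measure_pmf.prob (counting ?k) {c. \<not> ((\<Sum>j<?k. ?lo j) \<le> c \<and> c \<le> (\<Sum>j<?k. ?hi j))}"
    using bad' by simp
  also have "\<dots> = measure_pmf.prob (counting ?k) {c. (\<Sum>j<?k. ?lo j) \<le> c \<and> c \<le> (\<Sum>j<?k. ?hi j)}"
    using measure_pmf.prob_compl[of "{c. \<not> ((\<Sum>j<?k. ?lo j) \<le> c \<and> c \<le> (\<Sum>j<?k. ?hi j))}" "counting ?k"]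
    by (simp add: Compl_eq_Diff_UNIV[symmetric] Collect_neg_eq[symmetric] del: of_bool_eq_iff)
  also have "\<dots> \<le> measure_pmf.prob (counting ?k) {c. mult_approx (1 / 2 ^ k) (of_int c / of_int (2 ^ m - c)) \<mu>}"
    using sub by (intro measure_pmf.finite_measure_mono) auto
  finally show ?thesis .
qed

end

section \<open>Space and correctness of the whole program\<close>

definition eigenvalue_prog :: "nat \<Rightarrow> prog" where
  "eigenvalue_prog a = block [parameter_prog a, main_prog]"

lemma bitlen_mono: "x \<le> y \<Longrightarrow> bitlen x \<le> bitlen y"
  by (simp add: bitlen_def floorlog_mono)

text \<open>One bound on all register contents suffices, since the number of registers is a constant
  of the program.\<close>

lemma uses_space_bigstep:
  assumes "bigstep I b (P, init I) \<mu>"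
    and B: "real (card (regs P)) * real_of_int (1 + bitlen b) \<le> B"
  shows "uses_space P I B"
  unfolding uses_space_def
proof (intro allI ballI, clarify)
  fix t Q s assume "(Q, s) \<in> set_pmf (run P I t)"
  then have "bounded_regs b s"
    using bigstep_run_from[OF assms(1)] unfolding run_eq_run_from by blast
  then have "space_used P s \<le> (\<Sum>x\<in>regs P. 1 + bitlen b)"
    unfolding space_used_def bounded_regs_def by (intro sum_mono add_left_mono bitlen_mono) auto
  then have "real_of_int (space_used P s) \<le> real_of_int (\<Sum>x\<in>regs P. 1 + bitlen b)"
    by (simp only: of_int_le_iff)
  also have "\<dots> = real (card (regs P)) * real_of_int (1 + bitlen b)" by simp
  finally show "real_of_int (space_used P s) \<le> B" using B by linarith
qed

lemma bigstep_halts_outputs: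
  assumes "bigstep I b (P, init I) \<mu>"
  shows "halts P I"
    and "p \<le> measure_pmf.prob \<mu> {s. result s \<in> A} \<Longrightarrow> outputs_with_prob P I A p"
proof -
  obtain t where t: "run P I t = map_pmf (Pair Skip) \<mu>"
    using bigstep_run_from[OF assms] unfolding run_eq_run_from by blast
  show "halts P I" unfolding halts_def by (rule exI[of _ t]) (auto simp: t)
  have "Pair Skip -` {(Q, s). Q = Skip \<and> result s \<in> A} = {s. result s \<in> A}" by auto
  then have "measure_pmf.prob (run P I t) {(Q, s). Q = Skip \<and> result s \<in> A} = measure_pmf.prob \<mu> {s. result s \<in> A}"
    unfolding t by simp
  then show "p \<le> measure_pmf.prob \<mu> {s. result s \<in> A} \<Longrightarrow> outputs_with_prob P I A p"
    unfolding outputs_with_prob_def by (intro exI[of _ t]) simp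
qed

text \<open>\<open>s\<close> collects the exponents of the spectral gap 1 / (n ^ 3 * 2 ^ (2 * l *
  C)) with n \<le> 2 ^ l, plus one more \<open>l\<close> for the 2 in
  \<open>2 \<le> \<mu> * 2 ^ s\<close>. In \<open>b\<close>, 21 = 1 + 10 + 10 comes from n * 2 ^ (2
  * M) * 2 ^ (2 * M) with M = 5 * m and n \<le> 2 ^ m; the factor \<open>g\<close> stems from
  threshold and trials.\<close>

lemma eigenvalue_prog_correct:
  fixes n E w \<delta> \<gamma> C k g l
  defines "s \<equiv> l * (4 + 2 * C)"
  defines "m \<equiv> 8 * 2 ^ k * s"
  defines "b \<equiv> (2::int) ^ (21 * m) * int g"
  defines "I \<equiv> \<lparr>size_in = n, weight_in = w, delta_in = \<delta>, gamma_in = \<gamma>\<rparr>"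
  assumes n: "2 \<le> n" and graph: "weighted_graph n E w"
    and weights: "\<And>i j. i < n \<Longrightarrow> j < n \<Longrightarrow> w i j \<noteq> 0 \<Longrightarrow> 1 / 2 ^ (l * C) \<le> w i j \<and> w i j \<le> 2 ^ (l * C)"
    and k: "0 < \<delta>" "\<And>i. i < k \<Longrightarrow> \<delta> * 2 ^ i < 1" "1 \<le> \<delta> * 2 ^ k" "\<delta> * 2 ^ k < 2" "0 < k"
    and g: "0 < \<gamma>" "\<And>i. i < g \<Longrightarrow> \<gamma> * 2 ^ i < 1" "1 \<le> \<gamma> * 2 ^ g" "\<gamma> * 2 ^ g < 2" "0 < g"
    and l: "\<And>i. i < l \<Longrightarrow> 2 ^ i < n" "n \<le> 2 ^ l" "0 < l"
  obtains \<nu> where "bigstep I b (eigenvalue_prog (8 * (4 + 2 * C)), init I) \<nu>"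
    "\<And>\<mu>. smallest_nonzero_eigenvalue (normalized_laplacian n E w) \<mu> \<Longrightarrow>
      1 - \<gamma> \<le> measure_pmf.prob \<nu> {s. result s \<in> {x. mult_approx \<delta> x \<mu>}}"
proof -
  define thr where "thr = 2 ^ m * (2 ^ m * 2 ^ m) * g"
  define NN where "NN = thr * 2 ^ m * n"
  have ls: "l * C + 4 * l + l * C = s" by (simp add: s_def algebra_simps)
  have sm: "16 * s \<le> m" unfolding m_def using k(5) power_increasing[of 1 k "2::nat"] by simp
  have s4: "4 \<le> s" using ls l(3) by linarith
  have km: "k \<le> m"
  proof -
    have "k \<le> 2 ^ k" by (rule less_imp_le[OF less_exp])
    also have "2 ^ k * 1 \<le> 2 ^ k * (8 * s)" using s4 by (intro mult_left_mono) auto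
    finally show ?thesis by (simp add: m_def)
  qed
  have lm: "l \<le> m" "l * C < 5 * m" "3 \<le> m" using ls sm s4 by linarith+
  have m_eq': "m = 8 * 2 ^ k * s" unfolding m_def ..
  have m_eq: "m = 8 * (4 + 2 * C) * 2 ^ k * l" by (simp add: m_def s_def)
  have nz: "int n \<le> 2 ^ m"
  proof -
    have "n \<le> 2 ^ m" by (rule order_trans[OF l(2) power_increasing[OF lm(1)]]) simp
    then show ?thesis by (metis of_nat_le_iff of_nat_numeral of_nat_power)
  qed
  have P: "(2::int) ^ i * int g \<le> b" if "i \<le> 21 * m" for i
    unfolding b_def using that by (intro mult_right_mono power_increasing) auto
  have Q: "(2::int) ^ i \<le> b" if "i \<le> 21 * m" for i
  proof -
    have "(2::int) ^ i * 1 \<le> 2 ^ i * int g" using g(5) by (intro mult_left_mono) auto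
    also have "\<dots> \<le> b" by (rule P[OF that])
    finally show ?thesis by (simp only: mult_1_right)
  qed
  have small: "int x \<le> b" if "x \<le> m" for x
  proof -
    have "int x \<le> int m" using that by simp
    also have "\<dots> \<le> 2 ^ m" by (metis less_imp_le of_nat_less_two_power)
    also have "\<dots> \<le> b" by (rule Q) simp
    finally show ?thesis .
  qed
  have thr_b: "int (thr * 2 ^ j) \<le> b" if "j \<le> 18 * m" for j
  proof -
    have "int (thr * 2 ^ j) = 2 ^ (3 * m + j) * int g"
      by (simp add: thr_def power_add eval_nat_numeral power_mult mult_2 algebra_simps)
    then show ?thesis using P[of "3 * m + j"] that by simp
  qed
  have NN_le: "NN \<le> thr * 2 ^ (2 * m)"
  proof -
    have "n \<le> 2 ^ m" using nz by (metis of_nat_le_iff of_nat_numeral of_nat_power)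
    then have "thr * 2 ^ m * n \<le> thr * 2 ^ m * 2 ^ m" by (rule mult_left_mono) simp
    then show ?thesis by (simp add: NN_def mult_2 power_add mult.assoc)
  qed
  have pow_z: "(2::int) ^ (i * m) = (2 ^ m) ^ i" for i by (simp add: power_mult[symmetric] mult.commute)
  interpret sampled_walk I b n m "5 * m" "2 ^ m * 2 ^ m" thr NN E w "1 / 2 ^ (l * C)"
  proof unfold_locales
    show "size_in I = n" "weight_in I = w" "0 < n" "m \<le> 2 * (5 * m)" "weighted_graph n E w"
      using n graph by (simp_all add: I_def)
    show "0 \<le> weight_in I i j \<and> weight_in I i j < 2 ^ (5 * m)" if "i < n" "j < n" for i j
    proof (cases "w i j = 0")
      case True then show ?thesis by (simp add: I_def)
    next
      case False
      have "0 < 1 / (2::real) ^ (l * C)" by simp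
      then have "0 \<le> w i j" using weights[OF that False] by linarith
      moreover have "(2::real) ^ (l * C) < 2 ^ (5 * m)" using lm(2) by (intro power_strict_increasing) auto
      ultimately show ?thesis using weights[OF that False] le_less_trans[of "w i j" "2 ^ (l * C)" "2 ^ (5 * m)"]
        by (simp add: I_def)
    qed
    show "1 / 2 ^ (l * C) \<le> w i j" if "i < n" "j < n" "w i j \<noteq> 0" for i j
      using weights[OF that] by simp
    have "(2::real) ^ (l * C) \<le> 2 ^ (5 * m)" using lm(2) by (intro power_increasing) auto
    then show "1 \<le> 1 / 2 ^ (l * C) * (2::real) ^ (5 * m)" by (simp add: le_divide_eq)
    have "int n * 2 ^ (2 * (5 * m)) * 2 ^ (2 * (5 * m)) \<le> 2 ^ m * 2 ^ (2 * (5 * m)) * 2 ^ (2 * (5 * m))"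
      using nz by (intro mult_right_mono) auto
    also have "\<dots> = 2 ^ (21 * m)" by (simp add: power_add[symmetric])
    also have "\<dots> \<le> b" by (rule Q) simp
    finally show "int n * 2 ^ (2 * (5 * m)) * 2 ^ (2 * (5 * m)) \<le> b" .
    have "thr \<le> thr * 2 ^ (2 * m)" by simp
    with NN_le have "NN + thr \<le> thr * 2 ^ (2 * m) + thr * 2 ^ (2 * m)" by (rule add_mono)
    also have "\<dots> = thr * 2 ^ (2 * m + 1)" by simp
    finally have "int (NN + thr) \<le> int (thr * 2 ^ (2 * m + 1))" by (simp only: of_nat_le_iff)
    then show "int (NN + thr) \<le> b" using thr_b[of "2 * m + 1"] lm(3) by simp
    have zz: "(2::int) ^ m * 2 ^ m \<le> b" using Q[of "2 * m"] by (simp add: mult_2 power_add)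
    then show "int (2 ^ m * 2 ^ m) \<le> b" by simp
    have "int n * int n \<le> 2 ^ m * 2 ^ m" using nz by (intro mult_mono) auto
    then show "int n * int n \<le> b" using zz by simp
  qed
  let ?a = "8 * (4 + 2 * C)"
  let ?z = "(\<lambda>_. 0) (0 := int n, 2 := 1, 3 := int m, 4 := 2 ^ m, 5 := int (5 * m), 6 := int (10 * m), 7 := 2 ^ (10 * m),
     8 := int (2 ^ m * 2 ^ m), 9 := int (2 ^ m * (2 ^ m * 2 ^ m) * g),
     10 := int (2 ^ m * (2 ^ m * 2 ^ m) * g * 2 ^ m * n)) :: state"
  have am: "?a * 2 ^ k \<le> m" unfolding m_eq using l(3) by (cases l) auto
  have par: "bigstep I b (parameter_prog ?a, init I) (return_pmf ?z)"
  proof (rule bigstep_parameter[OF _ _ _ k g l(1,2) m_eq])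
    show "size_in I = n" "delta_in I = \<delta>" "gamma_in I = \<gamma>" by (simp_all add: I_def)
    show "int g \<le> b" using P[of 0] by simp
    show "(2::int) ^ k \<le> b" "(2::int) ^ l \<le> b" "(2::int) ^ (10 * m) \<le> b" using km lm by (auto intro!: Q)
    show "int (?a * 2 ^ k) \<le> b" by (rule small[OF am])
    have "?a \<le> ?a * 2 ^ k" by simp
    from this am show "int ?a \<le> b" by (intro small) (rule order_trans)
    show "5 \<le> b" using Q[of 3] lm(3) by simp
    show "int (2 ^ m * (2 ^ m * 2 ^ m)) \<le> b"
      using Q[of "3 * m"] by (simp add: pow_z power3_eq_cube mult.assoc)
    show "int (2 ^ m * (2 ^ m * 2 ^ m) * g) \<le> b" using thr_b[of 0] by (simp add: thr_def)
    show "int (2 ^ m * (2 ^ m * 2 ^ m) * g * 2 ^ m) \<le> b" using thr_b[of m] by (simp add: thr_def)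
    have "int NN \<le> int (thr * 2 ^ (2 * m))" using NN_le by (simp only: of_nat_le_iff)
    also have "\<dots> \<le> b" by (rule thr_b) simp
    finally show "int (2 ^ m * (2 ^ m * 2 ^ m) * g * 2 ^ m * n) \<le> b" unfolding NN_def thr_def .
  qed
  have bz: "bounded_regs b ?z" using bigstep_final_bounded[OF par] by simp
  have rz: "ready ?z"
    unfolding ready_def using bz by (simp add: NN_def thr_def)
  have "bigstep I b (main_prog, ?z) (map_pmf (\<lambda>c. ?z(0 := c, 1 := 2 ^ m - c, 12 := c)) (counting (2 ^ m - 1)))"
    by (rule bigstep_main[OF rz]) simp
  then have main: "bigstep I b (eigenvalue_prog ?a, init I) (map_pmf (\<lambda>c. ?z(0 := c, 1 := 2 ^ m - c, 12 := c)) (counting (2 ^ m - 1)))"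
    unfolding eigenvalue_prog_def by (intro block_det[OF par] block_single)
  moreover have "1 - \<gamma> \<le> measure_pmf.prob (map_pmf (\<lambda>c. ?z(0 := c, 1 := 2 ^ m - c, 12 := c)) (counting (2 ^ m - 1)))
      {s. result s \<in> {x. mult_approx \<delta> x \<mu>}}"
    if \<mu>: "smallest_nonzero_eigenvalue (normalized_laplacian n E w) \<mu>" for \<mu>
  proof -
    have pow: "(2::real) ^ (l * C) * 2 ^ (3 * l) * 2 ^ (l * C) * 2 ^ l = 2 ^ s"
      unfolding ls[symmetric] by (simp add: power_add[symmetric] algebra_simps)
    have nl: "real n \<le> 2 ^ l" using l(2) by (metis of_nat_le_iff of_nat_numeral of_nat_power)
    have "1 / 2 ^ (l * C) / (real n ^ 3 * 2 ^ (l * C)) \<le> \<mu>"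
      using \<mu> by (intro eigenvalue_gap) (auto simp: smallest_nonzero_eigenvalue_def weights)
    moreover have "1 / 2 ^ (l * C) / (2 ^ (3 * l) * 2 ^ (l * C)) \<le> 1 / 2 ^ (l * C) / (real n ^ 3 * 2 ^ (l * C))"
    proof -
      have "real n ^ 3 \<le> (2 ^ l) ^ 3" using nl by (intro power_mono) auto
      then have "real n ^ 3 \<le> 2 ^ (3 * l)" by (simp add: power_mult[symmetric] mult.commute)
      then show ?thesis using n by (intro divide_left_mono mult_right_mono) auto
    qed
    ultimately have "1 / 2 ^ (l * C) / (2 ^ (3 * l) * 2 ^ (l * C)) * 2 ^ s \<le> \<mu> * 2 ^ s"
      by (intro mult_right_mono) auto
    moreover have "1 / 2 ^ (l * C) / (2 ^ (3 * l) * 2 ^ (l * C)) * 2 ^ s = (2::real) ^ l"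
      unfolding pow[symmetric] by simp
    moreover have "(2::real) \<le> 2 ^ l" using power_increasing[of 1 l "2::real"] l(3) by simp
    ultimately have \<mu>s: "2 \<le> \<mu> * 2 ^ s" by linarith
    have "1 - \<gamma> \<le> measure_pmf.prob (counting (2 ^ m - 1)) {c. mult_approx (1 / 2 ^ k) (of_int c / of_int (2 ^ m - c)) \<mu>}"
    proof (rule counting_accurate[OF refl refl thr_def NN_def m_eq'])
      have "4 * real n \<le> 2 ^ 2 * 2 ^ l" using nl by simp
      also have "\<dots> = 2 ^ (2 + l)" by (simp only: power_add)
      also have "\<dots> \<le> 2 ^ s" using ls l(3) by (intro power_increasing) linarith+
      finally show "4 * real n \<le> 2 ^ s" .
      have "(2::real) ^ (l * C) \<le> 2 ^ s" using ls by (intro power_increasing) linarith+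
      then show "1 \<le> 1 / 2 ^ (l * C) * (2::real) ^ s" by (simp add: le_divide_eq)
      show "1 / 2 ^ g \<le> \<gamma>" using g(3) by (simp add: divide_le_eq)
    qed (use k(5) s4 g(5) \<mu> \<mu>s in auto)
    also have "\<dots> \<le> measure_pmf.prob (counting (2 ^ m - 1)) {c. mult_approx \<delta> (of_int c / of_int (2 ^ m - c)) \<mu>}"
    proof (rule measure_pmf.finite_measure_mono)
      have "1 / 2 ^ k \<le> \<delta>" using k(3) by (simp add: divide_le_eq)
      then have "1 / 2 ^ k * \<bar>\<mu>\<bar> \<le> \<delta> * \<bar>\<mu>\<bar>" by (rule mult_right_mono) simp
      then show "{c. mult_approx (1 / 2 ^ k) (of_int c / of_int (2 ^ m - c)) \<mu>}
          \<subseteq> {c. mult_approx \<delta> (of_int c / of_int (2 ^ m - c)) \<mu>}"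
        unfolding mult_approx_def by (auto intro: order_trans)
    qed simp
    also have "\<dots> = measure_pmf.prob (map_pmf (\<lambda>c. ?z(0 := c, 1 := 2 ^ m - c, 12 := c)) (counting (2 ^ m - 1)))
      {s. result s \<in> {x. mult_approx \<delta> x \<mu>}}"
      unfolding measure_map_pmf by (rule arg_cong[where f = "measure_pmf.prob _"]) (auto simp: result_def)
    finally show ?thesis .
  qed
  ultimately show ?thesis using that by blast
qed

section \<open>Logarithms of the parameters and the space bound\<close>

lemma least_power:
  fixes x :: real assumes x: "0 < x" "x < 1"
  obtains k where "\<And>i. i < k \<Longrightarrow> x * 2 ^ i < 1" "1 \<le> x * 2 ^ k" "x * 2 ^ k < 2" "0 < k"
proof -
  define k where "k = (LEAST k. 1 \<le> x * 2 ^ k)"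
  obtain j where "1 / x < 2 ^ j" using real_arch_pow[of 2 "1 / x"] by auto
  then have "1 \<le> x * 2 ^ j" using x by (simp add: divide_less_eq mult.commute less_imp_le)
  then have k: "1 \<le> x * 2 ^ k" unfolding k_def by (rule LeastI)
  have less: "x * 2 ^ i < 1" if "i < k" for i
    using not_less_Least[OF that[unfolded k_def]] by simp
  have "0 < k" using k x by (cases k) auto
  moreover from this have "x * 2 ^ k < 2" using less[of "k - 1"] by (cases k) auto
  ultimately show ?thesis using that[OF less k] by blast
qed

lemma least_log:
  fixes n :: nat assumes "2 \<le> n"
  obtains l where "\<And>i. i < l \<Longrightarrow> 2 ^ i < n" "n \<le> 2 ^ l" "0 < l"
proof -
  define l where "l = (LEAST l. n \<le> 2 ^ l)"
  have "n \<le> 2 ^ n" by (rule less_imp_le[OF less_exp])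
  then have l: "n \<le> 2 ^ l" unfolding l_def by (rule LeastI)
  have less: "2 ^ i < n" if "i < l" for i
    using not_less_Least[OF that[unfolded l_def]] by simp
  have "0 < l" using l assms by (cases l) auto
  then show ?thesis using that[OF less l] by blast
qed

text \<open>The bounds 2 ^ k < 2 / \<delta> and 2 ^ (l - 1) < n make the exponent a multiple of ln n
  / \<delta>, and \<gamma> * 2 ^ g < 2 makes ln g at most ln ln (1 / \<gamma>) up to a constant.
  Additive constants are absorbed because ln n / \<delta> is at least ln 2.\<close>

lemma bitlen_space_bound:
  assumes n: "2 \<le> n" and \<delta>: "0 < \<delta>" "\<delta> < 1" and \<gamma>: "0 < \<gamma>" "\<gamma> < 1"
    and k: "\<delta> * 2 ^ k < 2" and g: "\<gamma> * 2 ^ g < 2" "0 < g" and l: "\<And>i. i < l \<Longrightarrow> 2 ^ i < n" "0 < l"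
  shows "real_of_int (1 + bitlen ((2::int) ^ (21 * (a * 2 ^ k * l)) * int g))
    \<le> ((84 * real a + 2) / ln 2 + 2 / (ln 2 * ln 2) + 1 / ln 2) * space_bound n \<delta> \<gamma>"
proof -
  define X where "X = 1 / \<delta> * ln (real n)"
  define Y where "Y = max 0 (ln (ln (1 / \<gamma>)))"
  have l2: "0 < ln (2::real)" by simp
  have ln2n: "ln 2 \<le> ln (real n)" using n by simp
  have X: "ln 2 \<le> X"
  proof -
    have "1 * ln (real n) \<le> 1 / \<delta> * ln (real n)" using \<delta> n by (intro mult_right_mono) (auto simp: le_divide_eq)
    then show ?thesis using ln2n by (simp add: X_def)
  qed
  have Y: "0 \<le> Y" by (simp add: Y_def)
  have lb: "real l \<le> 2 * ln (real n) / ln 2"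
  proof -
    have "2 ^ (l - 1) < n" using l by simp
    then have "(2::real) ^ (l - 1) \<le> real n" by (metis less_imp_le of_nat_le_iff of_nat_numeral of_nat_power)
    then have "ln ((2::real) ^ (l - 1)) \<le> ln (real n)" using n by (subst ln_le_cancel_iff) auto
    then have "real (l - 1) * ln 2 \<le> ln (real n)" by (simp add: ln_realpow)
    then have "real l * ln 2 \<le> 2 * ln (real n)" using ln2n l(2) by (simp add: of_nat_diff algebra_simps)
    then show ?thesis by (simp add: le_divide_eq)
  qed
  have Db: "2 ^ k \<le> 2 / \<delta>" using k \<delta> by (simp add: le_divide_eq mult.commute less_imp_le)
  have mb: "real (a * 2 ^ k * l) \<le> 4 * real a / ln 2 * X"
  proof -
    have "real a * 2 ^ k * real l \<le> real a * (2 / \<delta>) * (2 * ln (real n) / ln 2)"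
      using lb Db \<delta> by (intro mult_mono mult_left_mono) auto
    also have "\<dots> = 4 * real a / ln 2 * X" by (simp add: X_def mult_ac)
    finally show ?thesis by simp
  qed
  \<comment> \<open>For g > 2 one has g / 4 \<le> (g - 1) * ln 2 < ln (1 / \<gamma>), and ln 4 \<le>
    2; for g \<le> 2 the iterated logarithm may be negative, and the constant alone
    suffices.\<close>
  have gb: "ln (real g) \<le> 2 + Y"
  proof (cases "g \<le> 2")
    case True
    then have "ln (real g) \<le> ln 2" using g(2) by (subst ln_le_cancel_iff) auto
    moreover have "ln (2::real) \<le> 1" using ln_add_one_self_le_self[of 1] by simp
    ultimately show ?thesis using Y by simp
  next
    case False
    have "real (g - 1) * ln 2 < ln (1 / \<gamma>)"
    proof -
      have "(2::real) ^ g = 2 * 2 ^ (g - 1)" using g(2) by (cases g) auto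
      then have "(2::real) ^ (g - 1) < 1 / \<gamma>" using g(1) \<gamma> by (simp add: less_divide_eq mult.commute)
      then have "ln ((2::real) ^ (g - 1)) < ln (1 / \<gamma>)" using \<gamma> by (subst ln_less_cancel_iff) auto
      then show ?thesis by (simp add: ln_realpow)
    qed
    moreover have "real g / 4 \<le> real (g - 1) * ln 2"
    proof -
      have "(1::real) / 2 \<le> ln 2" using ln_one_minus_pos_lower_bound[of "1 / 2"] ln_inverse[of "2::real"]
        ln_le_minus_one[of "1 / 2 :: real"] by (simp add: ln_div)
      then have "real g / 2 * (1 / 2) \<le> real (g - 1) * ln 2" using False by (intro mult_mono) (auto simp: of_nat_diff)
      then show ?thesis by simp
    qed
    ultimately have "real g / 4 < ln (1 / \<gamma>)" by linarith
    then have "ln (real g / 4) \<le> ln (ln (1 / \<gamma>))" using g(2) by (subst ln_le_cancel_iff) auto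
    then have "ln (real g) - ln 4 \<le> Y" using g(2) by (simp add: ln_div Y_def)
    moreover have "ln (4::real) \<le> 2"
    proof -
      have "ln (4::real) = ln (2 * 2)" by simp
      also have "\<dots> = ln 2 + ln 2" by (rule ln_mult_pos) auto
      finally show ?thesis using ln_add_one_self_le_self[of 1] by simp
    qed
    ultimately show ?thesis by simp
  qed
  have "bitlen ((2::int) ^ (21 * (a * 2 ^ k * l)) * int g) = bitlen (int g) + int (21 * (a * 2 ^ k * l))"
    using bitlen_pow2[of "int g" "21 * (a * 2 ^ k * l)"] g(2) by (simp add: mult.commute)
  moreover have "real_of_int (bitlen (int g)) \<le> ln (real g) / ln 2 + 1"
  proof -
    have "bitlen (int g) = \<lfloor>log 2 (real g)\<rfloor> + 1" using g(2) by (simp add: bitlen_alt_def)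
    then show ?thesis by (simp add: log_def)
  qed
  ultimately have "real_of_int (1 + bitlen ((2::int) ^ (21 * (a * 2 ^ k * l)) * int g))
    \<le> 2 + ln (real g) / ln 2 + 21 * real (a * 2 ^ k * l)" by simp
  also have "\<dots> \<le> 2 * (X / ln 2) + (2 * (X / ln 2) + Y) / ln 2 + 21 * (4 * real a / ln 2 * X)"
  proof (intro add_mono)
    have x1: "1 \<le> X / ln 2" using X l2 by (simp add: le_divide_eq)
    then show "2 \<le> 2 * (X / ln 2)" by linarith
    have "ln (real g) \<le> 2 * (X / ln 2) + Y" using gb x1 by linarith
    then show "ln (real g) / ln 2 \<le> (2 * (X / ln 2) + Y) / ln 2" by (rule divide_right_mono) simp
  qed (use mb in simp)
  also have "\<dots> = ((84 * real a + 2) / ln 2 + 2 / (ln 2 * ln 2)) * X + 1 / ln 2 * Y"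
    by (simp add: field_simps)
  also have "\<dots> \<le> ((84 * real a + 2) / ln 2 + 2 / (ln 2 * ln 2) + 1 / ln 2) * X
      + ((84 * real a + 2) / ln 2 + 2 / (ln 2 * ln 2) + 1 / ln 2) * Y"
  proof (rule add_mono)
    have "0 \<le> X" using X l2 by linarith
    then show "((84 * real a + 2) / ln 2 + 2 / (ln 2 * ln 2)) * X
        \<le> ((84 * real a + 2) / ln 2 + 2 / (ln 2 * ln 2) + 1 / ln 2) * X"
      by (intro mult_right_mono) auto
    show "1 / ln 2 * Y \<le> ((84 * real a + 2) / ln 2 + 2 / (ln 2 * ln 2) + 1 / ln 2) * Y"
      using Y by (intro mult_right_mono) auto
  qed
  finally show ?thesis by (simp only: space_bound_def X_def Y_def distrib_left)
qed

theorem theorem2: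
  fixes c c' :: real
  assumes "c > 0" and "c' > 0"
  shows "\<exists>(P :: prog) (K :: real).
    \<forall>(n :: nat) (E :: (nat \<times> nat) set) (w :: nat \<Rightarrow> nat \<Rightarrow> real) (\<delta> :: real) (\<gamma> :: real).
      n \<ge> 2 \<and> weighted_graph n E w \<and>
      (\<forall>(i, j) \<in> E. real n powr (- c) \<le> w i j \<and> w i j \<le> real n powr c') \<and>
      0 < \<delta> \<and> \<delta> < 1 \<and> 0 < \<gamma> \<and> \<gamma> < 1 \<longrightarrow>
      (let I = \<lparr>size_in = n, weight_in = w, delta_in = \<delta>, gamma_in = \<gamma>\<rparr> in
        halts P I \<and>
        uses_space P I (K * space_bound n \<delta> \<gamma>) \<and>
        (\<forall>\<mu>. smallest_nonzero_eigenvalue (normalized_laplacian n E w) \<mu> \<longrightarrow>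
           outputs_with_prob P I {a. mult_approx \<delta> a \<mu>} (1 - \<gamma>)))"
proof -
  \<comment> \<open>An integer exponent dominating both constants turns the bounds on the weights
    into 2 ^ (l * C) and its inverse, by n \<le> 2 ^ l.\<close>
  define C where "C = nat \<lceil>max c c'\<rceil>"
  have C: "c \<le> real C" "c' \<le> real C" unfolding C_def by linarith+
  define a where "a = 8 * (4 + 2 * C)"
  define P where "P = eigenvalue_prog a"
  define K where "K = real (card (regs P)) * ((84 * real a + 2) / ln 2 + 2 / (ln 2 * ln 2) + 1 / ln 2)"
  have main: "halts P I \<and> uses_space P I (K * space_bound n \<delta> \<gamma>) \<and>
        (\<forall>\<mu>. smallest_nonzero_eigenvalue (normalized_laplacian n E w) \<mu> \<longrightarrow>
           outputs_with_prob P I {a. mult_approx \<delta> a \<mu>} (1 - \<gamma>))"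
    if I: "I = \<lparr>size_in = n, weight_in = w, delta_in = \<delta>, gamma_in = \<gamma>\<rparr>"
      and n: "n \<ge> 2" and graph: "weighted_graph n E w"
      and weights: "\<forall>(i, j) \<in> E. real n powr (- c) \<le> w i j \<and> w i j \<le> real n powr c'"
      and \<delta>: "0 < \<delta>" "\<delta> < 1" and \<gamma>: "0 < \<gamma>" "\<gamma> < 1" for n E w \<delta> \<gamma> I
  proof -
    obtain k where k: "\<And>i. i < k \<Longrightarrow> \<delta> * 2 ^ i < 1" "1 \<le> \<delta> * 2 ^ k" "\<delta> * 2 ^ k < 2" "0 < k"
      using least_power[OF \<delta>] by blast
    obtain g where g: "\<And>i. i < g \<Longrightarrow> \<gamma> * 2 ^ i < 1" "1 \<le> \<gamma> * 2 ^ g" "\<gamma> * 2 ^ g < 2" "0 < g"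
      using least_power[OF \<gamma>] by blast
    obtain l where l: "\<And>i. i < l \<Longrightarrow> 2 ^ i < n" "n \<le> 2 ^ l" "0 < l"
      using least_log[OF n] by blast
    have powr_le: "real n powr x \<le> 2 ^ (l * C)" if "x \<le> real C" for x
    proof -
      have "real n powr x \<le> real n powr real C" using n that by (intro powr_mono) auto
      also have "\<dots> = real n ^ C" using n by (simp add: powr_realpow)
      also have "\<dots> \<le> (2 ^ l) ^ C"
        using l(2) by (intro power_mono) (metis of_nat_le_iff of_nat_numeral of_nat_power, simp)
      finally show ?thesis by (simp add: power_mult)
    qed
    have w: "1 / 2 ^ (l * C) \<le> w i j \<and> w i j \<le> 2 ^ (l * C)" if "i < n" "j < n" "w i j \<noteq> 0" for i j
    proof -
      have "(i, j) \<in> E" using graph that unfolding weighted_graph_def by metis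
      then have "real n powr (- c) \<le> w i j" "w i j \<le> real n powr c'" using weights by auto
      moreover have "1 / 2 ^ (l * C) \<le> real n powr (- c)"
        unfolding powr_minus_divide using powr_le[OF C(1)] n by (intro divide_left_mono) auto
      ultimately show ?thesis using powr_le[OF C(2)] by simp
    qed
    define b where "b = (2::int) ^ (21 * (8 * 2 ^ k * (l * (4 + 2 * C)))) * int g"
    obtain \<nu> where \<nu>: "bigstep I b (P, init I) \<nu>"
      "\<And>\<mu>. smallest_nonzero_eigenvalue (normalized_laplacian n E w) \<mu> \<Longrightarrow>
        1 - \<gamma> \<le> measure_pmf.prob \<nu> {s. result s \<in> {x. mult_approx \<delta> x \<mu>}}"
      unfolding P_def a_def I b_def
      using eigenvalue_prog_correct[OF n graph w \<delta>(1) k \<gamma>(1) g l] by blast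
    have "8 * 2 ^ k * (l * (4 + 2 * C)) = a * 2 ^ k * l" by (simp add: a_def)
    then have "real_of_int (1 + bitlen b) \<le> ((84 * real a + 2) / ln 2 + 2 / (ln 2 * ln 2) + 1 / ln 2) * space_bound n \<delta> \<gamma>"
      unfolding b_def using bitlen_space_bound[OF n \<delta> \<gamma> k(3) g(3,4) l(1,3), of a] by (simp only:)
    then have "real (card (regs P)) * real_of_int (1 + bitlen b) \<le> K * space_bound n \<delta> \<gamma>"
      unfolding K_def mult.assoc by (rule mult_left_mono) simp
    then have "uses_space P I (K * space_bound n \<delta> \<gamma>)" by (rule uses_space_bigstep[OF \<nu>(1)])
    then show ?thesis using bigstep_halts_outputs[OF \<nu>(1)] \<nu>(2) by blast
  qed
  show ?thesis
    by (rule exI[of _ P], rule exI[of _ K]) (use main in \<open>auto simp: Let_def\<close>)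
qed

end
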